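(* Let $\Lambda$ be a finite dimensional algebra with $n$ isomorphism classes of simple modules and let $0\ne v\in\mathbb R^n$. Denote $$\mathfrak D_{0,v}(\Lambda):=\{D_{0,v}(X)\mid 0\ne X\in\mathrm{mod}\,\Lambda,\ v\in D(X)\}.$$ Then $\mathfrak D_{0,v}(\Lambda)$ gives a wall-and-chamber structure in $v^\perp$.
   Context: Algebras are basic and connected over an algebraically closed field $K$; $\mathrm{mod}\,\Lambda$ is the category of finitely generated left modules; $\underline{\dim}\,M=(\dim_K\mathrm{Hom}_\Lambda(P(i),M))_i\in\mathbb N^n$, where $P(1),\dots,P(n)$ are the indecomposable projectives. For nonzero $X$, $D(X)=\{u\in\mathbb R^n\mid u\cdot\underline{\dim}\,X=0,\ u\cdot\underline{\dim}\,X'\le0\text{ for all submodules }X'\subseteq X\}$, and for $v\in D(X)$, $D_{0,v}(X)=\{w\in v^\perp\mid\exists\varepsilon>0:\ v+\varepsilon w\in D(X)\}$, where $v^\perp=\{w\in\mathbb R^n: v\cdot w=0\}$. A polyhedral cone in $\mathbb R^N$ is the set $C(v_1,\dots,v_k)$ of nonnegative linear combinations of finitely many vectors $v_1,\dots,v_k$; it is rational if there exists a scalar multiple of each $v_i$ which is rational. Its dimension is the minimum of the dimensions of the linear subspaces containing it, and it is a wall if it has dimension $N-1$. A set $\mathfrak X$ of rational polyhedral cones in $\mathbb R^N$ gives a wall-and-chamber structure if: (1) $C,C'\in\mathfrak X$ implies $C\cap C'\in\mathfrak X$; (2) for every $C\in\mathfrak X$ there is a wall $W\in\mathfrak X$ with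 $C\subseteq W$; (3) every connected component (chamber) of $\mathbb R^N\setminus\overline{\bigcup_{X\in\mathfrak X}X}$ is convex. A wall-and-chamber structure in $v^\perp$ is meant in this sense with the $(n-1)$-dimensional space $v^\perp$ in place of $\mathbb R^N$, so that $N=n-1$ and walls have dimension $n-2$.
   Formalization: Rationality of cones in v^⊥ is taken with respect to one basis of v^⊥ containing a basis of the span of its rational vectors; this is ordinary rationality if v is proportional to a rational vector, and for other v ordinary rationality in R^n can fail (A_3, v=(0,1,√2), X=S_1). *)

theory Defs
  imports
    "HOL-Analysis.Analysis"
    "HOL-Algebra.Algebraic_Closure"
    "Jordan_Normal_Form.Missing_VectorSpace"
begin

section \<open>Finite-dimensional algebras and their left modules\<close>

text \<open>
  The locale \<^locale>\<open>module\<close> assumes a commutative ring of scalars, so left modules over a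
  noncommutative ring need their own locale.  The record type, \<^const>\<open>module_hom\<close> and
  \<^const>\<open>Module.submodule\<close> do not presuppose commutativity and are reused.
\<close>

locale left_module = R?: ring R + M?: abelian_group M
  for R :: "('a, 'c) ring_scheme" (structure) and M :: "('a, 'm, 'd) module_scheme" (structure) +
  assumes smult_closed:
      "\<lbrakk>a \<in> carrier R; x \<in> carrier M\<rbrakk> \<Longrightarrow> a \<odot>\<^bsub>M\<^esub> x \<in> carrier M"
    and smult_l_distr:
      "\<lbrakk>a \<in> carrier R; b \<in> carrier R; x \<in> carrier M\<rbrakk> \<Longrightarrow>
        (a \<oplus>\<^bsub>R\<^esub> b) \<odot>\<^bsub>M\<^esub> x = a \<odot>\<^bsub>M\<^esub> x \<oplus>\<^bsub>M\<^esub> b \<odot>\<^bsub>M\<^esub> x"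
    and smult_r_distr:
      "\<lbrakk>a \<in> carrier R; x \<in> carrier M; y \<in> carrier M\<rbrakk> \<Longrightarrow>
        a \<odot>\<^bsub>M\<^esub> (x \<oplus>\<^bsub>M\<^esub> y) = a \<odot>\<^bsub>M\<^esub> x \<oplus>\<^bsub>M\<^esub> a \<odot>\<^bsub>M\<^esub> y"
    and smult_assoc:
      "\<lbrakk>a \<in> carrier R; b \<in> carrier R; x \<in> carrier M\<rbrakk> \<Longrightarrow>
        (a \<otimes>\<^bsub>R\<^esub> b) \<odot>\<^bsub>M\<^esub> x = a \<odot>\<^bsub>M\<^esub> (b \<odot>\<^bsub>M\<^esub> x)"
    and smult_one: "x \<in> carrier M \<Longrightarrow> \<one>\<^bsub>R\<^esub> \<odot>\<^bsub>M\<^esub> x = x"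

definition fin_dim_algebra :: "'k ring \<Rightarrow> ('k, 'a) module \<Rightarrow> bool" where
  "fin_dim_algebra K \<Lambda> \<longleftrightarrow>
     vectorspace K \<Lambda> \<and> ring \<Lambda> \<and>
     (\<forall>k\<in>carrier K. \<forall>x\<in>carrier \<Lambda>. \<forall>y\<in>carrier \<Lambda>.
        k \<odot>\<^bsub>\<Lambda>\<^esub> (x \<otimes>\<^bsub>\<Lambda>\<^esub> y) = (k \<odot>\<^bsub>\<Lambda>\<^esub> x) \<otimes>\<^bsub>\<Lambda>\<^esub> y \<and>
        k \<odot>\<^bsub>\<Lambda>\<^esub> (x \<otimes>\<^bsub>\<Lambda>\<^esub> y) = x \<otimes>\<^bsub>\<Lambda>\<^esub> (k \<odot>\<^bsub>\<Lambda>\<^esub> y)) \<and>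
     vectorspace.fin_dim K \<Lambda>"

definition fin_gen_module :: "('k, 'a) module \<Rightarrow> ('a, 'm) module \<Rightarrow> bool" where
  "fin_gen_module \<Lambda> M \<longleftrightarrow>
     left_module \<Lambda> M \<and>
     (\<exists>S. finite S \<and> S \<subseteq> carrier M \<and>
        (\<forall>N. Module.submodule N \<Lambda> M \<and> S \<subseteq> N \<longrightarrow> N = carrier M))"

text \<open>
  The objects of the category of finitely generated modules, with elements drawn from the fixed
  type \<open>'a list\<close>.  This loses nothing up to isomorphism: choosing coefficients with respect to
  generators \<open>s\<^sub>1, \<dots>, s\<^sub>m\<close> embeds any finitely generated module, as a set, into the lists of
  length \<open>m\<close> over \<open>\<Lambda>\<close>.
\<close>

definition mods :: "('k, 'a) module \<Rightarrow> ('a, 'a list) module set" where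
  "mods \<Lambda> = {M. fin_gen_module \<Lambda> M}"

definition nonzero_module :: "('a, 'm) module \<Rightarrow> bool" where
  "nonzero_module M \<longleftrightarrow> carrier M \<noteq> {\<zero>\<^bsub>M\<^esub>}"

definition module_iso ::
  "('k, 'a) module \<Rightarrow> ('a, 'm) module \<Rightarrow> ('a, 'l) module \<Rightarrow> bool" where
  "module_iso \<Lambda> M N \<longleftrightarrow> (\<exists>f\<in>module_hom \<Lambda> M N. bij_betw f (carrier M) (carrier N))"

definition simple_module :: "('k, 'a) module \<Rightarrow> ('a, 'm) module \<Rightarrow> bool" where
  "simple_module \<Lambda> M \<longleftrightarrow>
     nonzero_module M \<and>
     (\<forall>N. Module.submodule N \<Lambda> M \<longrightarrow> N = {\<zero>\<^bsub>M\<^esub>} \<or> N = carrier M)"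

definition indecomposable_module :: "('k, 'a) module \<Rightarrow> ('a, 'm) module \<Rightarrow> bool" where
  "indecomposable_module \<Lambda> M \<longleftrightarrow>
     nonzero_module M \<and>
     (\<forall>N N'. Module.submodule N \<Lambda> M \<and> Module.submodule N' \<Lambda> M \<and>
        N \<inter> N' = {\<zero>\<^bsub>M\<^esub>} \<and> N <+>\<^bsub>M\<^esub> N' = carrier M \<longrightarrow> N = {\<zero>\<^bsub>M\<^esub>} \<or> N' = {\<zero>\<^bsub>M\<^esub>})"

definition projective_module :: "('k, 'a) module \<Rightarrow> ('a, 'm) module \<Rightarrow> bool" where
  "projective_module \<Lambda> P \<longleftrightarrow>
     (\<forall>M\<in>mods \<Lambda>. \<forall>N\<in>mods \<Lambda>. \<forall>g\<in>module_hom \<Lambda> M N. \<forall>f\<in>module_hom \<Lambda> P N.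
        g ` carrier M = carrier N \<longrightarrow>
        (\<exists>h\<in>module_hom \<Lambda> P M. \<forall>x\<in>carrier P. g (h x) = f x))"

definition simple_classes :: "('k, 'a) module \<Rightarrow> ('a, 'a list) module set set" where
  "simple_classes \<Lambda> =
     {S \<in> mods \<Lambda>. simple_module \<Lambda> S} //
     {(M, N). M \<in> mods \<Lambda> \<and> N \<in> mods \<Lambda> \<and> module_iso \<Lambda> M N}"

definition indecomposable_projectives ::
  "('k, 'a) module \<Rightarrow> ('n \<Rightarrow> ('a, 'a list) module) \<Rightarrow> bool" where
  "indecomposable_projectives \<Lambda> P \<longleftrightarrow>
     (\<forall>i. P i \<in> mods \<Lambda> \<and> projective_module \<Lambda> (P i) \<and> indecomposable_module \<Lambda> (P i)) \<and>
     (\<forall>i j. module_iso \<Lambda> (P i) (P j) \<longrightarrow> i = j) \<and>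
     (\<forall>Q\<in>mods \<Lambda>. projective_module \<Lambda> Q \<and> indecomposable_module \<Lambda> Q \<longrightarrow>
        (\<exists>i. module_iso \<Lambda> Q (P i)))"


section \<open>Basic and connected algebras\<close>

definition left_ideal_module :: "('k, 'a) module \<Rightarrow> 'a \<Rightarrow> ('a, 'a) module" where
  "left_ideal_module \<Lambda> e =
     \<lparr>carrier = (\<lambda>x. x \<otimes>\<^bsub>\<Lambda>\<^esub> e) ` carrier \<Lambda>, mult = mult \<Lambda>, one = \<one>\<^bsub>\<Lambda>\<^esub>,
      zero = \<zero>\<^bsub>\<Lambda>\<^esub>, add = add \<Lambda>, smult = mult \<Lambda>\<rparr>"

definition idempotents :: "('k, 'a) module \<Rightarrow> 'a set" where
  "idempotents \<Lambda> = {e \<in> carrier \<Lambda>. e \<otimes>\<^bsub>\<Lambda>\<^esub> e = e}"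

definition orthogonal_elems :: "('k, 'a) module \<Rightarrow> 'a \<Rightarrow> 'a \<Rightarrow> bool" where
  "orthogonal_elems \<Lambda> e f \<longleftrightarrow> e \<otimes>\<^bsub>\<Lambda>\<^esub> f = \<zero>\<^bsub>\<Lambda>\<^esub> \<and> f \<otimes>\<^bsub>\<Lambda>\<^esub> e = \<zero>\<^bsub>\<Lambda>\<^esub>"

definition primitive_idempotent :: "('k, 'a) module \<Rightarrow> 'a \<Rightarrow> bool" where
  "primitive_idempotent \<Lambda> e \<longleftrightarrow>
     e \<in> idempotents \<Lambda> \<and> e \<noteq> \<zero>\<^bsub>\<Lambda>\<^esub> \<and>
     (\<forall>f\<in>idempotents \<Lambda>. \<forall>g\<in>idempotents \<Lambda>.
        orthogonal_elems \<Lambda> f g \<and> e = f \<oplus>\<^bsub>\<Lambda>\<^esub> g \<longrightarrow> f = \<zero>\<^bsub>\<Lambda>\<^esub> \<or> g = \<zero>\<^bsub>\<Lambda>\<^esub>)"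

definition basic_algebra :: "('k, 'a) module \<Rightarrow> bool" where
  "basic_algebra \<Lambda> \<longleftrightarrow>
     (\<exists>E. finite E \<and> (\<forall>e\<in>E. primitive_idempotent \<Lambda> e) \<and>
        (\<forall>e\<in>E. \<forall>f\<in>E. e \<noteq> f \<longrightarrow> orthogonal_elems \<Lambda> e f) \<and>
        (\<Oplus>\<^bsub>\<Lambda>\<^esub>e\<in>E. e) = \<one>\<^bsub>\<Lambda>\<^esub> \<and>
        (\<forall>e\<in>E. \<forall>f\<in>E.
           module_iso \<Lambda> (left_ideal_module \<Lambda> e) (left_ideal_module \<Lambda> f) \<longrightarrow> e = f))"

text \<open>
  A product decomposition of \<open>\<Lambda>\<close> into two algebras is the same as a decomposition into two
  two-sided ideals.
\<close>

definition connected_algebra :: "('k, 'a) module \<Rightarrow> bool" where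
  "connected_algebra \<Lambda> \<longleftrightarrow>
     carrier \<Lambda> \<noteq> {\<zero>\<^bsub>\<Lambda>\<^esub>} \<and>
     (\<forall>I J. ideal I \<Lambda> \<and> ideal J \<Lambda> \<and> I \<inter> J = {\<zero>\<^bsub>\<Lambda>\<^esub>} \<and> I <+>\<^bsub>\<Lambda>\<^esub> J = carrier \<Lambda> \<longrightarrow>
        I = {\<zero>\<^bsub>\<Lambda>\<^esub>} \<or> J = {\<zero>\<^bsub>\<Lambda>\<^esub>})"


section \<open>Dimension vectors and semistability cones\<close>

text \<open>
  The \<open>K\<close>-vector space \<open>Hom(P, M)\<close>.  Homomorphisms are taken extensional on the carrier of \<open>P\<close>,
  so that each of them is a single function; \<open>K\<close> acts on \<open>M\<close> through the scalars \<open>k \<cdot> 1\<close> of \<open>\<Lambda>\<close>.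
  The fields \<open>mult\<close> and \<open>one\<close> are unused.
\<close>

definition hom_space ::
  "('k, 'a) module \<Rightarrow> ('a, 'm) module \<Rightarrow> ('a, 'l) module \<Rightarrow> ('k, 'm \<Rightarrow> 'l) module" where
  "hom_space \<Lambda> P M =
     \<lparr>carrier = module_hom \<Lambda> P M \<inter> extensional (carrier P),
      mult = undefined, one = undefined,
      zero = (\<lambda>x\<in>carrier P. \<zero>\<^bsub>M\<^esub>),
      add = (\<lambda>f g. \<lambda>x\<in>carrier P. f x \<oplus>\<^bsub>M\<^esub> g x),
      smult = (\<lambda>k f. \<lambda>x\<in>carrier P. (k \<odot>\<^bsub>\<Lambda>\<^esub> \<one>\<^bsub>\<Lambda>\<^esub>) \<odot>\<^bsub>M\<^esub> f x)\<rparr>"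

definition dimension_vector ::
  "'k ring \<Rightarrow> ('k, 'a) module \<Rightarrow> ('n \<Rightarrow> ('a, 'a list) module) \<Rightarrow>
    ('a, 'm) module \<Rightarrow> real ^ 'n::finite" where
  "dimension_vector K \<Lambda> P M = (\<chi> i. real (vectorspace.dim K (hom_space \<Lambda> (P i) M)))"

definition semistability_cone ::
  "'k ring \<Rightarrow> ('k, 'a) module \<Rightarrow> ('n \<Rightarrow> ('a, 'a list) module) \<Rightarrow>
    ('a, 'm) module \<Rightarrow> (real ^ 'n::finite) set" where
  "semistability_cone K \<Lambda> P M =
     {u. u \<bullet> dimension_vector K \<Lambda> P M = 0 \<and>
         (\<forall>N. Module.submodule N \<Lambda> M \<longrightarrow>
            u \<bullet> dimension_vector K \<Lambda> P (M\<lparr>carrier := N\<rparr>) \<le> 0)}"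

definition orth_hyperplane :: "real ^ 'n::finite \<Rightarrow> (real ^ 'n) set" where
  "orth_hyperplane v = {w. v \<bullet> w = 0}"

definition local_cone ::
  "'k ring \<Rightarrow> ('k, 'a) module \<Rightarrow> ('n \<Rightarrow> ('a, 'a list) module) \<Rightarrow>
    real ^ 'n \<Rightarrow> ('a, 'm) module \<Rightarrow> (real ^ 'n::finite) set" where
  "local_cone K \<Lambda> P v M =
     {w \<in> orth_hyperplane v. \<exists>\<epsilon>>0. v + \<epsilon> *\<^sub>R w \<in> semistability_cone K \<Lambda> P M}"

definition local_cones ::
  "'k ring \<Rightarrow> ('k, 'a) module \<Rightarrow> ('n \<Rightarrow> ('a, 'a list) module) \<Rightarrow>
    real ^ 'n \<Rightarrow> (real ^ 'n::finite) set set" where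
  "local_cones K \<Lambda> P v =
     {local_cone K \<Lambda> P v M | M.
        M \<in> mods \<Lambda> \<and> nonzero_module M \<and> v \<in> semistability_cone K \<Lambda> P M}"


section \<open>Wall-and-chamber structures\<close>

definition cone_generated_by :: "'v::real_vector set \<Rightarrow> 'v set" where
  "cone_generated_by S = {\<Sum>s\<in>S. c s *\<^sub>R s | c. \<forall>s\<in>S. 0 \<le> c s}"

definition rational_vectors :: "(real ^ 'n::finite) set" where
  "rational_vectors = {x. \<forall>i. x $ i \<in> \<rat>}"

text \<open>
  Rationality of a cone in a subspace \<open>V\<close> of \<open>\<real>\<^sup>n\<close> refers to coordinates identifying \<open>V\<close> with
  \<open>\<real>\<^sup>d\<close>, \<open>d = dim V\<close>, that is, to a basis of \<open>V\<close>.  The basis has to contain a basis of the span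
  of the rational vectors of \<open>V\<close>.  Hence if \<open>V\<close> is spanned by rational vectors (in particular, if
  \<open>V = \<real>\<^sup>n\<close>) then the basis consists of rational vectors, and rationality with respect to it is
  rationality in \<open>\<real>\<^sup>n\<close>.  If \<open>V = v\<^sup>\<bottom>\<close> with \<open>v\<close> not proportional to a rational vector, then \<open>V\<close> is
  not spanned by rational vectors, and rationality in \<open>\<real>\<^sup>n\<close> would not be the notion for \<open>\<real>\<^sup>d\<close>.
\<close>

definition rational_frame :: "(real ^ 'n::finite) set \<Rightarrow> (real ^ 'n) set \<Rightarrow> bool" where
  "rational_frame V B \<longleftrightarrow>
     independent B \<and> Real_Vector_Spaces.span B = V \<and>
     V \<inter> rational_vectors \<subseteq> Real_Vector_Spaces.span (B \<inter> rational_vectors)"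

lemma rational_frame_rational:
  assumes "rational_frame V B" and "V = Real_Vector_Spaces.span (V \<inter> rational_vectors)"
  shows "B \<subseteq> rational_vectors"
proof
  fix b assume b: "b \<in> B"
  have ind: "independent B" and BV: "Real_Vector_Spaces.span B = V"
    and sub: "V \<inter> rational_vectors \<subseteq> Real_Vector_Spaces.span (B \<inter> rational_vectors)"
    using assms(1) by (auto simp: rational_frame_def)
  have "b \<in> V"
    using b BV real_vector.span_base by blast
  also have "V \<subseteq> Real_Vector_Spaces.span (B \<inter> rational_vectors)"
    using assms(2) real_vector.span_minimal[OF sub real_vector.subspace_span] by simp
  finally have in_span: "b \<in> Real_Vector_Spaces.span (B \<inter> rational_vectors)" .
  show "b \<in> rational_vectors"
  proof (rule ccontr)
    assume "b \<notin> rational_vectors"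
    then have "B \<inter> rational_vectors \<subseteq> B - {b}"
      by auto
    then have "b \<in> Real_Vector_Spaces.span (B - {b})"
      using in_span real_vector.span_mono by blast
    then show False
      using ind b real_vector.dependent_def by blast
  qed
qed

definition rational_combinations :: "'v::real_vector set \<Rightarrow> 'v set" where
  "rational_combinations B = {\<Sum>b\<in>B. q b *\<^sub>R b | q. \<forall>b\<in>B. q b \<in> \<rat>}"

definition rational_polyhedral_cone :: "'v::real_vector set \<Rightarrow> 'v set \<Rightarrow> bool" where
  "rational_polyhedral_cone B C \<longleftrightarrow>
     (\<exists>S. finite S \<and> C = cone_generated_by S \<and>
        (\<forall>s\<in>S. \<exists>c. c \<noteq> 0 \<and> c *\<^sub>R s \<in> rational_combinations B))"

definition cone_dim :: "'v::euclidean_space set \<Rightarrow> nat" where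
  "cone_dim C = (LEAST d. \<exists>U. Real_Vector_Spaces.subspace U \<and> C \<subseteq> U \<and> d = dim U)"

lemma cone_dim_eq_dim: "cone_dim C = dim C"
  unfolding cone_dim_def
proof (rule Least_equality)
  show "\<exists>U. Real_Vector_Spaces.subspace U \<and> C \<subseteq> U \<and> dim C = dim U"
    by (intro exI[of _ "Real_Vector_Spaces.span C"])
       (simp add: real_vector.span_superset dim_span)
qed (auto intro: dim_subset)

text \<open>
  \<open>\<XX>\<close> gives a wall-and-chamber structure in the subspace \<open>V\<close>; one frame serves all cones.  The
  closure may be taken in \<open>\<real>\<^sup>n\<close> because \<open>V\<close> is closed.
\<close>

definition wall_and_chamber_structure ::
  "(real ^ 'n::finite) set \<Rightarrow> (real ^ 'n) set set \<Rightarrow> bool" where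
  "wall_and_chamber_structure V \<XX> \<longleftrightarrow>
     (\<exists>B. rational_frame V B \<and> (\<forall>C\<in>\<XX>. rational_polyhedral_cone B C)) \<and>
     (\<forall>C\<in>\<XX>. \<forall>C'\<in>\<XX>. C \<inter> C' \<in> \<XX>) \<and>
     (\<forall>C\<in>\<XX>. \<exists>W\<in>\<XX>. cone_dim W + 1 = dim V \<and> C \<subseteq> W) \<and>
     (\<forall>U\<in>components (V - closure (\<Union>\<XX>)). convex U)"

end

theory Submission
  imports Defs
begin

text \<open>
  Fix \<open>v\<close> and call a nonzero module \<open>M\<close> with \<open>v \<in> D(M)\<close> semistable.  Moving from \<open>v\<close> to
  \<open>v + \<epsilon> w\<close> with \<open>\<epsilon>\<close> small keeps every strict inequality in the definition of \<open>D(M)\<close>, and a module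
  has only finitely many submodule dimension vectors.  So for \<open>w \<bottom> v\<close> only the submodules \<open>N\<close> with
  \<open>v \<cdot> dim N = 0\<close> matter, which are again semistable, and \<open>D\<^sub>0\<^sub>,\<^sub>v(M)\<close> is cut out of the hyperplane
  \<open>V = v\<^sup>\<bottom>\<close> by \<open>w \<cdot> dim M = 0\<close> and \<open>w \<cdot> dim N \<le> 0\<close> for the nonzero such \<open>N\<close>
  (\<open>local_cone_inequalities\<close>).  From this description everything is deduced in an abstract setting,
  the locale \<open>semistable_system\<close>, which remembers only the semistable modules, their semistable
  submodules and their dimension vectors.

  \<^item> Rationality.  The dimension vectors that occur are rational vectors of \<open>V\<close>.  A basis of the span
  \<open>U\<close> of the rational vectors of \<open>V\<close>, taken from among them and completed by a basis of the
  orthogonal complement of \<open>U\<close> in \<open>V\<close>, is a frame on which all of them take rational values: the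
  added vectors pair to zero with them (\<open>rational_frame_exists\<close>).  Fourier-Motzkin elimination then
  produces generators without leaving the rational combinations of the frame
  (\<open>rational_polyhedral_cone_inequalities\<close>).

  \<^item> Intersections.  The cone of a direct sum is the intersection of the cones, because
  \<open>Hom(P(i), -)\<close> is exact: a submodule of \<open>M \<oplus> N\<close> is an extension of a submodule of \<open>N\<close> by one of
  \<open>M\<close>, and dimension vectors add up (\<open>dim_hom_space_exact\<close>, \<open>mods_semistable_Int\<close>).

  \<^item> Walls.  Among the semistable submodules \<open>Y\<close> of \<open>M\<close> with \<open>w \<cdot> dim Y = 0\<close> on the whole cone of \<open>M\<close>
  take a smallest one.  The cone of \<open>Y\<close> contains that of \<open>M\<close>, and by minimality some point of the
  latter satisfies the remaining inequalities for \<open>Y\<close> strictly.  So the cone of \<open>Y\<close> is a neighbourhood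
  of that point in the hyperplane \<open>w \<cdot> dim Y = 0\<close> of \<open>V\<close> (\<open>cone_contained_in_wall\<close>).  This is a proper
  hyperplane as \<open>dim Y \<noteq> 0\<close>: some indecomposable projective \<open>\<Lambda>e\<close> maps nontrivially to \<open>Y\<close>
  (\<open>exists_nonzero_hom_from_projective\<close>).

  \<^item> Chambers.  On a connected set \<open>U\<close> that meets no cone, the condition that \<open>\<theta>\<close> be negative on all
  semistable submodules of a given \<open>M\<close> is open, and also closed since its boundary consists of points
  of cones; so it does not depend on \<open>\<theta> \<in> U\<close>.  Let \<open>z\<close> lie on a segment with endpoints in \<open>U\<close> and in the
  cone of \<open>M\<close>.  The condition fails for \<open>M\<close>, for otherwise \<open>z \<cdot> dim M < 0\<close> by linearity; take a
  smallest submodule \<open>Y\<close> for which it fails.  Every \<open>\<theta> \<in> U\<close> is negative on the smaller submodules of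
  \<open>Y\<close>, so the failure means \<open>\<theta> \<cdot> dim Y \<ge> 0\<close>, and equality would put \<open>\<theta>\<close> into the cone of \<open>Y\<close>.  Thus all
  of \<open>U\<close> is positive on \<open>Y\<close>, and then so is \<open>z\<close>, contradicting \<open>z \<cdot> dim Y \<le> 0\<close>
  (\<open>segment_avoids_cones\<close>).  Convexity of chambers follows by thickening segments
  (\<open>chamber_convex\<close>).
\<close>

section \<open>Cones cut out by rational inequalities\<close>

lemma sum_mem_cone_generated_by:
  assumes "\<And>s. s \<in> S \<Longrightarrow> 0 \<le> c s"
  shows "(\<Sum>s\<in>S. c s *\<^sub>R s) \<in> cone_generated_by S"
  using assms unfolding cone_generated_by_def by blast

lemma cone_generated_by_add:
  assumes "x \<in> cone_generated_by S" and "y \<in> cone_generated_by S"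
  shows "x + y \<in> cone_generated_by S"
proof -
  obtain c e where "x = (\<Sum>s\<in>S. c s *\<^sub>R s)" "\<forall>s\<in>S. 0 \<le> c s"
    and "y = (\<Sum>s\<in>S. e s *\<^sub>R s)" "\<forall>s\<in>S. 0 \<le> e s"
    using assms unfolding cone_generated_by_def by blast
  then have "x + y = (\<Sum>s\<in>S. (c s + e s) *\<^sub>R s)" "\<forall>s\<in>S. 0 \<le> c s + e s"
    by (simp_all add: sum.distrib scaleR_add_left)
  then show ?thesis
    using sum_mem_cone_generated_by[of S "\<lambda>s. c s + e s"] by simp
qed

lemma cone_generated_by_scale:
  assumes "x \<in> cone_generated_by S" and "0 \<le> r"
  shows "r *\<^sub>R x \<in> cone_generated_by S"
proof -
  obtain c where "x = (\<Sum>s\<in>S. c s *\<^sub>R s)" "\<forall>s\<in>S. 0 \<le> c s"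
    using assms unfolding cone_generated_by_def by blast
  then have "r *\<^sub>R x = (\<Sum>s\<in>S. (r * c s) *\<^sub>R s)" "\<forall>s\<in>S. 0 \<le> r * c s"
    using assms(2) by (simp_all add: scaleR_sum_right)
  then show ?thesis
    using sum_mem_cone_generated_by[of S "\<lambda>s. r * c s"] by simp
qed

lemma zero_mem_cone_generated_by: "0 \<in> cone_generated_by S"
  using sum_mem_cone_generated_by[of S "\<lambda>_. 0"] by simp

lemma cone_generated_by_sum:
  assumes "\<And>i. i \<in> I \<Longrightarrow> f i \<in> cone_generated_by S"
  shows "(\<Sum>i\<in>I. f i) \<in> cone_generated_by S"
  using assms
  by (induction I rule: infinite_finite_induct)
     (auto intro: cone_generated_by_add zero_mem_cone_generated_by)

lemma generator_mem_cone:
  assumes "finite S" and "s \<in> S"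
  shows "s \<in> cone_generated_by S"
proof -
  have "(\<Sum>t\<in>S. (if t = s then 1 else 0) *\<^sub>R t) = (\<Sum>t\<in>S. if t = s then t else 0)"
    by (rule sum.cong) auto
  also have "\<dots> = s"
    using assms by simp
  finally show ?thesis
    using sum_mem_cone_generated_by[of S "\<lambda>t. if t = s then 1 else 0"] by simp
qed

lemma cone_generated_by_subset:
  assumes "S \<subseteq> cone_generated_by T"
  shows "cone_generated_by S \<subseteq> cone_generated_by T"
proof
  fix x assume "x \<in> cone_generated_by S"
  then obtain c where "x = (\<Sum>s\<in>S. c s *\<^sub>R s)" "\<forall>s\<in>S. 0 \<le> c s"
    unfolding cone_generated_by_def by blast
  then show "x \<in> cone_generated_by T"
    using assms by (auto intro!: cone_generated_by_sum cone_generated_by_scale)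
qed

lemma inner_le_zero_on_cone:
  assumes "\<And>s. s \<in> S \<Longrightarrow> s \<bullet> d \<le> 0" and "x \<in> cone_generated_by S"
  shows "x \<bullet> d \<le> 0"
proof -
  obtain c where "x = (\<Sum>s\<in>S. c s *\<^sub>R s)" "\<forall>s\<in>S. 0 \<le> c s"
    using assms(2) unfolding cone_generated_by_def by blast
  then show ?thesis
    using assms(1) by (auto simp: inner_sum_left mult_nonneg_nonpos intro!: sum_nonpos)
qed

text \<open>
  One step of the double description method (Fourier-Motzkin elimination on generators): generators
  on the wrong side of the hyperplane are replaced by the points where the segments to the generators
  on the good side cross it, up to positive scaling.  (For \<open>t\<close> on the hyperplane itself this point is a
  multiple of \<open>t\<close>.)
\<close>

definition halfspace_generators :: "'v::real_inner \<Rightarrow> 'v set \<Rightarrow> 'v set" where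
  "halfspace_generators d S =
     {t \<in> S. t \<bullet> d \<le> 0} \<union>
     (\<lambda>(s, t). (s \<bullet> d) *\<^sub>R t - (t \<bullet> d) *\<^sub>R s) ` ({s \<in> S. s \<bullet> d > 0} \<times> {t \<in> S. t \<bullet> d \<le> 0})"

text \<open>
  The weight \<open>p\<close> that a point of the half-space carries on the wrong side is at most the weight \<open>q\<close>
  on the good side.  So the whole part on the wrong side can be balanced against the fraction \<open>p / q\<close>
  of the part on the good side, and this balanced combination is one of crossing points.
\<close>

lemma cone_inter_halfspace:
  assumes fin: "finite S"
  shows "{w \<in> cone_generated_by S. w \<bullet> d \<le> 0} = cone_generated_by (halfspace_generators d S)"
proof
  define N where "N = {t \<in> S. t \<bullet> d \<le> 0}"
  define Q where "Q = {s \<in> S. s \<bullet> d > 0}"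
  let ?H = "halfspace_generators d S"
  have finNQ: "finite N" "finite Q" and S: "S = N \<union> Q" "N \<inter> Q = {}"
    using fin by (auto simp: N_def Q_def)
  have finH: "finite ?H"
    using fin by (auto simp: halfspace_generators_def)
  have NH: "t \<in> cone_generated_by ?H" if "t \<in> N" for t
    using that finH by (auto intro!: generator_mem_cone simp: halfspace_generators_def N_def)
  have MH: "(s \<bullet> d) *\<^sub>R t - (t \<bullet> d) *\<^sub>R s \<in> cone_generated_by ?H" if "s \<in> Q" "t \<in> N" for s t
    using that finH by (auto intro!: generator_mem_cone simp: halfspace_generators_def N_def Q_def)
  show "{w \<in> cone_generated_by S. w \<bullet> d \<le> 0} \<subseteq> cone_generated_by ?H"
  proof safe
    fix w assume w: "w \<in> cone_generated_by S" "w \<bullet> d \<le> 0"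
    obtain c where wc: "w = (\<Sum>s\<in>S. c s *\<^sub>R s)" and c0: "\<And>s. s \<in> S \<Longrightarrow> 0 \<le> c s"
      using w(1) unfolding cone_generated_by_def by blast
    define p where "p = (\<Sum>s\<in>Q. c s * (s \<bullet> d))"
    define q where "q = (\<Sum>t\<in>N. c t * (-(t \<bullet> d)))"
    have split: "w = (\<Sum>t\<in>N. c t *\<^sub>R t) + (\<Sum>s\<in>Q. c s *\<^sub>R s)"
      unfolding wc S using finNQ S(2) by (simp add: sum.union_disjoint)
    have "w \<bullet> d = p - q"
      unfolding split by (simp add: inner_add_left inner_sum_left p_def q_def sum_negf)
    then have pq: "p \<le> q"
      using w(2) by simp
    have p0: "0 \<le> p"
      unfolding p_def using c0 by (auto intro!: sum_nonneg mult_nonneg_nonneg simp: Q_def)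
    show "w \<in> cone_generated_by ?H"
    proof (cases "q = 0")
      case True
      then have "p = 0" using pq p0 by simp
      then have "\<forall>s\<in>Q. c s * (s \<bullet> d) = 0"
        unfolding p_def using finNQ c0
        by (subst (asm) sum_nonneg_eq_0_iff) (auto simp: Q_def)
      then have "\<forall>s\<in>Q. c s = 0"
        by (auto simp: Q_def)
      then have "w = (\<Sum>t\<in>N. c t *\<^sub>R t)"
        using split by simp
      then show ?thesis
        using c0 NH by (auto simp: N_def intro!: cone_generated_by_sum cone_generated_by_scale)
    next
      case False
      then have q: "q > 0" using p0 pq by simp
      \<comment> \<open>The coefficient \<open>c s * c t / q\<close> spreads each \<open>s\<close> over all \<open>t\<close>; the sums over \<open>t\<close> and over \<open>s\<close>
        return \<open>c s\<close> and \<open>(p / q) * c t\<close>.\<close>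
      have "(\<Sum>s\<in>Q. \<Sum>t\<in>N. (c s * c t / q) *\<^sub>R ((s \<bullet> d) *\<^sub>R t - (t \<bullet> d) *\<^sub>R s)) =
          (\<Sum>s\<in>Q. \<Sum>t\<in>N. (c s * (s \<bullet> d)) *\<^sub>R ((c t / q) *\<^sub>R t)) +
          (\<Sum>s\<in>Q. \<Sum>t\<in>N. (c t * (-(t \<bullet> d))) *\<^sub>R ((c s / q) *\<^sub>R s))"
        by (simp add: sum.distrib[symmetric] scaleR_diff_right algebra_simps)
      also have "(\<Sum>s\<in>Q. \<Sum>t\<in>N. (c s * (s \<bullet> d)) *\<^sub>R ((c t / q) *\<^sub>R t)) =
          p *\<^sub>R (\<Sum>t\<in>N. (c t / q) *\<^sub>R t)"
        unfolding p_def scaleR_sum_left by (simp only: scaleR_sum_right)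
      also have "(\<Sum>s\<in>Q. \<Sum>t\<in>N. (c t * (-(t \<bullet> d))) *\<^sub>R ((c s / q) *\<^sub>R s)) =
          (\<Sum>s\<in>Q. q *\<^sub>R ((c s / q) *\<^sub>R s))"
        unfolding scaleR_sum_left[symmetric] q_def ..
      also have "(\<Sum>s\<in>Q. q *\<^sub>R ((c s / q) *\<^sub>R s)) = (\<Sum>s\<in>Q. c s *\<^sub>R s)"
        using q by simp
      also have "p *\<^sub>R (\<Sum>t\<in>N. (c t / q) *\<^sub>R t) =
          (\<Sum>t\<in>N. c t *\<^sub>R t) - (\<Sum>t\<in>N. ((1 - p / q) * c t) *\<^sub>R t)"
        by (simp add: scaleR_sum_right sum_subtractf[symmetric] algebra_simps)
      finally have "w = (\<Sum>t\<in>N. ((1 - p / q) * c t) *\<^sub>R t) +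
          (\<Sum>s\<in>Q. \<Sum>t\<in>N. (c s * c t / q) *\<^sub>R ((s \<bullet> d) *\<^sub>R t - (t \<bullet> d) *\<^sub>R s))"
        using split by simp
      moreover have "0 \<le> (1 - p / q) * c t" if "t \<in> N" for t
        using that c0 q pq by (auto simp: N_def)
      moreover have "0 \<le> c s * c t / q" if "s \<in> Q" "t \<in> N" for s t
        using that c0 q by (auto simp: N_def Q_def)
      ultimately show ?thesis
        using NH MH
        by (auto intro!: cone_generated_by_add cone_generated_by_sum cone_generated_by_scale)
    qed
  qed
  show "cone_generated_by ?H \<subseteq> {w \<in> cone_generated_by S. w \<bullet> d \<le> 0}"
  proof
    fix w assume w: "w \<in> cone_generated_by ?H"
    have "h \<in> cone_generated_by S \<and> h \<bullet> d \<le> 0" if "h \<in> ?H" for h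
      using that
    proof (unfold halfspace_generators_def, elim UnE imageE, goal_cases)
      case 1
      then show ?case using generator_mem_cone[OF fin] by auto
    next
      case (2 st)
      then obtain s t where st: "s \<in> S" "t \<in> S" "s \<bullet> d > 0" "t \<bullet> d \<le> 0"
        "h = (s \<bullet> d) *\<^sub>R t + (- (t \<bullet> d)) *\<^sub>R s"
        by (cases st) auto
      then show ?case
        using generator_mem_cone[OF fin, of s] generator_mem_cone[OF fin, of t]
        by (auto simp: inner_add_left simp del: scaleR_minus_left
            intro!: cone_generated_by_add cone_generated_by_scale)
    qed
    then show "w \<in> {w \<in> cone_generated_by S. w \<bullet> d \<le> 0}"
      using w cone_generated_by_subset[of ?H S] inner_le_zero_on_cone[of ?H d w] by blast
  qed
qed

lemma rational_combinations_diff: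
  assumes "x \<in> rational_combinations B" "y \<in> rational_combinations B" "q \<in> \<rat>" "r \<in> \<rat>"
  shows "q *\<^sub>R x - r *\<^sub>R y \<in> rational_combinations B"
proof -
  obtain a b where "x = (\<Sum>z\<in>B. a z *\<^sub>R z)" "\<forall>z\<in>B. a z \<in> \<rat>"
    "y = (\<Sum>z\<in>B. b z *\<^sub>R z)" "\<forall>z\<in>B. b z \<in> \<rat>"
    using assms unfolding rational_combinations_def by blast
  then have "q *\<^sub>R x - r *\<^sub>R y = (\<Sum>z\<in>B. (q * a z - r * b z) *\<^sub>R z)"
    "\<forall>z\<in>B. q * a z - r * b z \<in> \<rat>"
    using assms by (simp_all add: scaleR_sum_right sum_subtractf scaleR_diff_left)
  then show ?thesis
    unfolding rational_combinations_def mem_Collect_eq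
    by (intro exI[of _ "\<lambda>z. q * a z - r * b z"]) simp
qed

text \<open>
  A rational form of the Minkowski-Weyl theorem.  The double description steps preserve rationality,
  as the coefficients \<open>s \<bullet> d\<close> they introduce are rational.
\<close>

lemma rational_polyhedral_cone_inequalities:
  fixes B :: "'v::real_inner set"
  assumes "finite D" and finB: "finite B" and "\<And>d b. d \<in> D \<Longrightarrow> b \<in> B \<Longrightarrow> b \<bullet> d \<in> \<rat>"
  shows "rational_polyhedral_cone B {w \<in> Real_Vector_Spaces.span B. \<forall>d\<in>D. w \<bullet> d \<le> 0}"
proof -
  have "\<exists>S. finite S \<and> S \<subseteq> rational_combinations B \<and>
      {w \<in> Real_Vector_Spaces.span B. \<forall>d\<in>D. w \<bullet> d \<le> 0} = cone_generated_by S"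
    using assms(1,3)
  proof (induction D)
    case empty
    let ?S = "B \<union> uminus ` B"
    have one: "b \<in> rational_combinations B" if "b \<in> B" for b
    proof -
      have "b = (\<Sum>z\<in>B. (if z = b then 1 else 0) *\<^sub>R z)"
        using that finB by (subst sum.cong[OF refl, of _ _ "\<lambda>z. if z = b then z else 0"]) auto
      then show ?thesis
        unfolding rational_combinations_def mem_Collect_eq
        by (intro exI[of _ "\<lambda>z. if z = b then 1 else 0"]) simp
    qed
    have "- b \<in> rational_combinations B" if "b \<in> B" for b
      using rational_combinations_diff[OF one[OF that] one[OF that], of 0 1] by simp
    then have "?S \<subseteq> rational_combinations B"
      using one by auto
    moreover have "Real_Vector_Spaces.span B = cone_generated_by ?S"
    proof
      have gen: "s \<in> cone_generated_by ?S" if "s \<in> ?S" for s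
        using that finB by (intro generator_mem_cone) auto
      have scal: "c *\<^sub>R b \<in> cone_generated_by ?S" if "b \<in> B" for b c
      proof (cases "0 \<le> c")
        case True
        then show ?thesis using gen that by (intro cone_generated_by_scale) auto
      next
        case False
        then have "(- c) *\<^sub>R (- b) \<in> cone_generated_by ?S"
          using gen that by (intro cone_generated_by_scale) auto
        then show ?thesis by simp
      qed
      then show "Real_Vector_Spaces.span B \<subseteq> cone_generated_by ?S"
        by (auto simp: real_vector.span_finite[OF finB] intro!: cone_generated_by_sum)
      show "cone_generated_by ?S \<subseteq> Real_Vector_Spaces.span B"
        unfolding cone_generated_by_def
        by (auto intro!: real_vector.span_sum real_vector.span_scale real_vector.span_neg
            intro: real_vector.span_base)
    qed
    ultimately show ?case
      using finB by (intro exI[of _ ?S]) auto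
  next
    case (insert d D)
    then obtain S where S: "finite S" "S \<subseteq> rational_combinations B"
      "{w \<in> Real_Vector_Spaces.span B. \<forall>d\<in>D. w \<bullet> d \<le> 0} = cone_generated_by S"
      by auto
    have rat: "s \<bullet> d \<in> \<rat>" if s: "s \<in> S" for s
    proof -
      obtain a where "s = (\<Sum>b\<in>B. a b *\<^sub>R b)" "\<forall>b\<in>B. a b \<in> \<rat>"
        using s S(2) unfolding rational_combinations_def by blast
      then show ?thesis
        using insert.prems by (auto simp: inner_sum_left intro!: Rats_sum Rats_mult)
    qed
    have "{w \<in> Real_Vector_Spaces.span B. \<forall>d\<in>insert d D. w \<bullet> d \<le> 0} =
        {w \<in> cone_generated_by S. w \<bullet> d \<le> 0}"
      unfolding S(3)[symmetric] by auto
    moreover have "finite (halfspace_generators d S)"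
      using S(1) by (auto simp: halfspace_generators_def)
    moreover have "halfspace_generators d S \<subseteq> rational_combinations B"
      using S(2) rat by (auto simp: halfspace_generators_def intro!: rational_combinations_diff)
    ultimately show ?case
      using cone_inter_halfspace[OF S(1)] by auto
  qed
  moreover have "\<exists>c. c \<noteq> 0 \<and> c *\<^sub>R s \<in> rational_combinations B"
    if "s \<in> rational_combinations B" for s
    using that by (intro exI[of _ 1]) simp
  ultimately show ?thesis
    unfolding rational_polyhedral_cone_def by blast
qed

text \<open>
  The frame consists of a basis \<open>B1\<close> of the span \<open>U\<close> of the rational vectors of \<open>V\<close>, chosen from
  among them, and a basis \<open>B2\<close> of the orthogonal complement of \<open>U\<close> in \<open>V\<close>.  Taking the orthogonal
  complement makes the inner products of \<open>B2\<close> with rational vectors of \<open>V\<close> vanish, although \<open>B2\<close>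
  itself need not be rational.
\<close>

lemma rational_frame_exists:
  fixes V :: "(real ^ 'n::finite) set"
  assumes V: "Real_Vector_Spaces.subspace V"
  obtains B where "rational_frame V B" and "finite B"
    and "\<And>b d. b \<in> B \<Longrightarrow> d \<in> V \<inter> rational_vectors \<Longrightarrow> b \<bullet> d \<in> \<rat>"
proof -
  obtain B1 where B1: "B1 \<subseteq> V \<inter> rational_vectors" "independent B1"
    "V \<inter> rational_vectors \<subseteq> Real_Vector_Spaces.span B1"
    using real_vector.maximal_independent_subset by blast
  let ?U = "Real_Vector_Spaces.span B1"
  define T where "T = {y \<in> V. \<forall>x\<in>?U. orthogonal x y}"
  have UV: "?U \<subseteq> V"
    using B1(1) V real_vector.span_minimal by blast
  obtain B2 where B2: "B2 \<subseteq> T" "independent B2" "T \<subseteq> Real_Vector_Spaces.span B2" "card B2 = dim T"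
    using basis_exists[of T] by blast
  have fin: "finite B1" "finite B2"
    using B1(2) B2(2) independent_imp_finite by auto
  have "dim T + dim ?U = dim V"
    unfolding T_def using V UV by (intro dim_subspace_orthogonal_to_vectors) auto
  then have card: "card (B1 \<union> B2) \<le> dim V"
    using card_Un_le[of B1 B2] B2(4) dim_eq_card_independent[OF B1(2)] by simp
  have "V \<subseteq> Real_Vector_Spaces.span (B1 \<union> B2)"
  proof
    fix x assume x: "x \<in> V"
    obtain y z where yz: "y \<in> ?U" "\<And>w. w \<in> ?U \<Longrightarrow> orthogonal z w" "x = y + z"
      using orthogonal_subspace_decomp_exists[of B1 x] by auto
    have "z \<in> V"
      using yz x UV V real_vector.subspace_diff[of V x y] by auto
    then have "z \<in> T"
      using yz(2) by (auto simp: T_def orthogonal_commute)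
    then show "x \<in> Real_Vector_Spaces.span (B1 \<union> B2)"
      using yz(1,3) B2(3) real_vector.span_mono[of B1 "B1 \<union> B2"] real_vector.span_mono[of B2 "B1 \<union> B2"]
      by (auto intro!: real_vector.span_add)
  qed
  moreover have BV: "B1 \<union> B2 \<subseteq> V"
    using B1(1) B2(1) by (auto simp: T_def)
  ultimately have ind: "independent (B1 \<union> B2)" and span: "Real_Vector_Spaces.span (B1 \<union> B2) = V"
    using card fin V card_le_dim_spanning[of "B1 \<union> B2" V] real_vector.span_minimal[of "B1 \<union> B2" V]
    by auto
  have "V \<inter> rational_vectors \<subseteq> Real_Vector_Spaces.span ((B1 \<union> B2) \<inter> rational_vectors)"
    using B1(1,3) real_vector.span_mono[of B1 "(B1 \<union> B2) \<inter> rational_vectors"] by blast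
  then have "rational_frame V (B1 \<union> B2)"
    unfolding rational_frame_def using ind span by blast
  moreover have "b \<bullet> d \<in> \<rat>" if "b \<in> B1 \<union> B2" "d \<in> V \<inter> rational_vectors" for b d
  proof (cases "b \<in> B1")
    case True
    then show ?thesis
      using that B1(1) by (auto simp: rational_vectors_def inner_vec_def intro!: Rats_sum Rats_mult)
  next
    case False
    then have "b \<in> T" "d \<in> ?U"
      using that B1(3) B2(1) by auto
    then show ?thesis
      by (auto simp: T_def orthogonal_def inner_commute)
  qed
  ultimately show ?thesis
    using that fin by blast
qed

section \<open>Wall-and-chamber structures from semistable objects\<close>

lemma positive_step_exists:
  fixes a b :: "'e \<Rightarrow> real"
  assumes "finite E" and "\<And>e. e \<in> E \<Longrightarrow> a e < 0 \<or> a e = 0 \<and> b e \<le> 0"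
  shows "\<exists>\<delta>>0. \<forall>e\<in>E. a e + \<delta> * b e \<le> 0"
proof -
  have "\<exists>\<delta>>0. \<forall>e\<in>E. \<forall>r. 0 \<le> r \<and> r \<le> \<delta> \<longrightarrow> a e + r * b e \<le> 0"
    using assms
  proof (induction E)
    case empty
    then show ?case by (intro exI[of _ 1]) simp
  next
    case (insert x E)
    then obtain \<delta> where \<delta>: "\<delta> > 0" "\<forall>e\<in>E. \<forall>r. 0 \<le> r \<and> r \<le> \<delta> \<longrightarrow> a e + r * b e \<le> 0"
      by auto
    have "\<exists>\<eta>>0. \<forall>r. 0 \<le> r \<and> r \<le> \<eta> \<longrightarrow> a x + r * b x \<le> 0"
    proof (cases "b x \<le> 0")
      case True
      have "a x \<le> 0" using insert.prems[of x] by auto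
      then show ?thesis using True
        by (intro exI[of _ 1]) (auto intro!: add_nonpos_nonpos mult_nonneg_nonpos)
    next
      case False
      then have "a x < 0" using insert.prems[of x] by auto
      then show ?thesis using False
        by (intro exI[of _ "- a x / b x"]) (auto simp: field_simps)
    qed
    then obtain \<eta> where \<eta>: "\<eta> > 0" "\<forall>r. 0 \<le> r \<and> r \<le> \<eta> \<longrightarrow> a x + r * b x \<le> 0"
      by blast
    show ?case
      using \<delta> \<eta> by (intro exI[of _ "min \<delta> \<eta>"]) auto
  qed
  then obtain \<delta> where "\<delta> > 0" "\<forall>e\<in>E. \<forall>r. 0 \<le> r \<and> r \<le> \<delta> \<longrightarrow> a e + r * b e \<le> 0"
    by blast
  then show ?thesis
    by (intro exI[of _ \<delta>]) auto
qed

lemma finite_nat_vectors_below: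
  fixes c :: "real ^ 'n::finite"
  shows "finite {x. \<forall>i. x $ i \<in> \<nat> \<and> x $ i \<le> c $ i}"
proof -
  define A where "A i = real ` {..nat \<lfloor>c $ i\<rfloor>}" for i
  have "{x. \<forall>i. x $ i \<in> \<nat> \<and> x $ i \<le> c $ i} \<subseteq> vec_lambda ` (PiE UNIV A)"
  proof
    fix x :: "real ^ 'n" assume x: "x \<in> {x. \<forall>i. x $ i \<in> \<nat> \<and> x $ i \<le> c $ i}"
    have "x $ i \<in> A i" for i
    proof -
      obtain k where k: "x $ i = real k"
        using x by (auto elim: Nats_cases)
      moreover have "x $ i \<le> c $ i"
        using x by auto
      ultimately have "k \<le> nat \<lfloor>c $ i\<rfloor>"
        by (simp add: le_nat_floor)
      then show ?thesis unfolding A_def k by blast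
    qed
    then have "vec_nth x \<in> PiE UNIV A" by auto
    then show "x \<in> vec_lambda ` (PiE UNIV A)"
      by (metis image_eqI vec_nth_inverse)
  qed
  moreover have "finite (PiE UNIV A)"
    by (rule finite_PiE) (auto simp: A_def)
  ultimately show ?thesis
    using finite_surj by blast
qed

lemma orth_hyperplane_subspace: "Real_Vector_Spaces.subspace (orth_hyperplane v)"
  unfolding orth_hyperplane_def by (rule subspace_hyperplane)

text \<open>
  The data on which the argument depends.  In the application, \<open>Obj\<close> consists of the nonzero modules
  \<open>M\<close> with \<open>v \<in> D(M)\<close>, \<open>d\<close> is the dimension vector, and \<open>Sub M\<close> consists of the nonzero submodules of
  \<open>M\<close> whose dimension vectors are orthogonal to \<open>v\<close>.
\<close>

locale semistable_system =
  fixes v :: "real ^ 'n::finite"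
    and Obj :: "'x set"
    and d :: "'x \<Rightarrow> real ^ 'n"
    and Sub :: "'x \<Rightarrow> 'x set"
  assumes Sub_self: "M \<in> Obj \<Longrightarrow> M \<in> Sub M"
    and Sub_Obj: "M \<in> Obj \<Longrightarrow> Y \<in> Sub M \<Longrightarrow> Y \<in> Obj"
    and Sub_trans: "M \<in> Obj \<Longrightarrow> Y \<in> Sub M \<Longrightarrow> Z \<in> Sub Y \<Longrightarrow> Z \<in> Sub M"
    and d_orth: "M \<in> Obj \<Longrightarrow> v \<bullet> d M = 0"
    and d_Nats: "M \<in> Obj \<Longrightarrow> d M $ i \<in> \<nat>"
    and d_nonzero: "M \<in> Obj \<Longrightarrow> d M \<noteq> 0"
    and d_mono: "M \<in> Obj \<Longrightarrow> Y \<in> Sub M \<Longrightarrow> d Y $ i \<le> d M $ i"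
begin

definition cone :: "'x \<Rightarrow> (real ^ 'n) set" where
  "cone M = {w \<in> orth_hyperplane v. w \<bullet> d M = 0 \<and> (\<forall>Y\<in>Sub M. w \<bullet> d Y \<le> 0)}"

lemma finite_d_Sub: "M \<in> Obj \<Longrightarrow> finite (d ` Sub M)"
  by (rule finite_subset[OF _ finite_nat_vectors_below[of "d M"]])
     (auto simp: d_mono intro: d_Nats Sub_Obj)

text \<open>
  Minimality refers to the sum of the coordinates of \<open>d\<close>.  Monotonicity of \<open>d\<close> makes a subobject with
  the same sum have the same \<open>d\<close>, and this is all that the cones see.
\<close>

lemma d_minimal:
  assumes M: "M \<in> Obj" and Q: "Q \<subseteq> Sub M" "Q \<noteq> {}"
  obtains Y where "Y \<in> Q" and "\<And>Z. Z \<in> Sub Y \<Longrightarrow> Z \<in> Q \<Longrightarrow> d Z = d Y"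
proof -
  define h where "h x = (\<Sum>i\<in>UNIV. x $ i)" for x :: "real ^ 'n"
  have fin: "finite (d ` Q)" and ne: "d ` Q \<noteq> {}"
    using finite_subset[OF image_mono[OF Q(1)] finite_d_Sub[OF M]] Q(2) by auto
  obtain e where "e \<in> d ` Q" "\<And>e'. e' \<in> d ` Q \<Longrightarrow> h e \<le> h e'"
    using arg_min_if_finite(1)[OF fin ne, of h] arg_min_least[OF fin ne, of _ h] by blast
  then obtain Y where Y: "Y \<in> Q" "\<And>Z. Z \<in> Q \<Longrightarrow> h (d Y) \<le> h (d Z)"
    by auto
  have "d Z = d Y" if Z: "Z \<in> Sub Y" "Z \<in> Q" for Z
  proof -
    have Yo: "Y \<in> Obj" using Y Q M Sub_Obj by blast
    have "(\<Sum>i\<in>UNIV. d Y $ i - d Z $ i) = 0"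
      using sum_nonneg[of UNIV "\<lambda>i. d Y $ i - d Z $ i"] d_mono[OF Yo Z(1)] Y(2)[OF Z(2)]
      by (simp add: h_def sum_subtractf)
    then show ?thesis
      using d_mono[OF Yo Z(1)]
      by (subst (asm) sum_nonneg_eq_0_iff) (auto simp: vec_eq_iff)
  qed
  then show ?thesis using that Y by blast
qed

lemma cone_add: "M \<in> Obj \<Longrightarrow> a \<in> cone M \<Longrightarrow> b \<in> cone M \<Longrightarrow> a + b \<in> cone M"
  by (auto simp: cone_def orth_hyperplane_def inner_add_left inner_add_right add_nonpos_nonpos)

lemma cone_zero: "0 \<in> cone M"
  by (simp add: cone_def orth_hyperplane_def)

lemma cone_sum:
  assumes "M \<in> Obj" and "\<And>i. i \<in> I \<Longrightarrow> f i \<in> cone M"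
  shows "(\<Sum>i\<in>I. f i) \<in> cone M"
  using assms(2)
  by (induction I rule: infinite_finite_induct) (auto intro: cone_zero cone_add[OF assms(1)])

text \<open>
  A minimal \<open>Y\<close> in \<open>Sub M\<close> on which all of \<open>cone M\<close> vanishes plays the part of a stable object.  The sum
  \<open>\<theta>\<close> of suitable points of \<open>cone M\<close> is strictly negative on all subobjects \<open>Z\<close> of \<open>Y\<close> with
  \<open>d Z \<noteq> d Y\<close>, so near \<open>\<theta>\<close> the only condition left for \<open>cone Y\<close> is orthogonality to \<open>d Y\<close>.
\<close>

lemma cone_contained_in_wall:
  assumes M: "M \<in> Obj"
  shows "\<exists>Y\<in>Obj. cone_dim (cone Y) + 1 = dim (orth_hyperplane v) \<and> cone M \<subseteq> cone Y"
proof -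
  define Q where "Q = {Y \<in> Sub M. \<forall>w\<in>cone M. w \<bullet> d Y = 0}"
  have "M \<in> Q"
    using Sub_self[OF M] by (auto simp: Q_def cone_def)
  then obtain Y where Y: "Y \<in> Q" and min: "\<And>Z. Z \<in> Sub Y \<Longrightarrow> Z \<in> Q \<Longrightarrow> d Z = d Y"
    using d_minimal[OF M, of Q] unfolding Q_def by auto
  have YM: "Y \<in> Sub M" and Yo: "Y \<in> Obj"
    using Y M Sub_Obj by (auto simp: Q_def)
  have sub: "cone M \<subseteq> cone Y"
  proof
    fix w assume w: "w \<in> cone M"
    then have "w \<bullet> d Y = 0" using Y by (auto simp: Q_def)
    then show "w \<in> cone Y"
      using w Sub_trans[OF M YM] by (auto simp: cone_def)
  qed
  define E where "E = d ` {Z \<in> Sub Y. d Z \<noteq> d Y}"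
  have finE: "finite E"
    by (rule finite_subset[OF _ finite_d_Sub[OF Yo]]) (auto simp: E_def)
  have nonpos: "w \<bullet> e \<le> 0" if "w \<in> cone M" "e \<in> E" for w e
    using that sub by (auto simp: E_def cone_def)
  have "\<exists>w\<in>cone M. w \<bullet> e < 0" if e: "e \<in> E" for e
  proof -
    obtain Z where Z: "Z \<in> Sub Y" "d Z \<noteq> d Y" "e = d Z"
      using e by (auto simp: E_def)
    then have "Z \<notin> Q" using min by blast
    then obtain w where "w \<in> cone M" "w \<bullet> e \<noteq> 0"
      using Z Sub_trans[OF M YM] by (auto simp: Q_def)
    then show ?thesis using nonpos[OF _ e] by force
  qed
  then obtain g where g: "\<And>e. e \<in> E \<Longrightarrow> g e \<in> cone M" "\<And>e. e \<in> E \<Longrightarrow> g e \<bullet> e < 0"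
    by metis
  define \<theta> where "\<theta> = (\<Sum>e\<in>E. g e)"
  have \<theta>: "\<theta> \<in> cone M"
    unfolding \<theta>_def by (rule cone_sum[OF M g(1)])
  have neg: "\<theta> \<bullet> e < 0" if e: "e \<in> E" for e
  proof -
    have "\<theta> \<bullet> e = g e \<bullet> e + (\<Sum>f\<in>E - {e}. g f \<bullet> e)"
      unfolding \<theta>_def inner_sum_left using finE e by (simp add: sum.remove)
    moreover have "(\<Sum>f\<in>E - {e}. g f \<bullet> e) \<le> 0"
      using g(1) nonpos e by (intro sum_nonpos) auto
    ultimately show ?thesis using g(2)[OF e] by simp
  qed
  define H where "H = {y \<in> orth_hyperplane v. \<forall>x\<in>Real_Vector_Spaces.span {d Y}. orthogonal x y}"
  have dY: "d Y \<in> Real_Vector_Spaces.span {d Y}"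
    by (simp add: real_vector.span_base)
  have "H \<subseteq> Real_Vector_Spaces.span (cone Y)"
  proof
    fix w assume w: "w \<in> H"
    have wY: "w \<bullet> d Y = 0"
      using w dY by (auto simp: H_def orthogonal_def inner_commute)
    obtain \<delta> where \<delta>: "\<delta> > 0" "\<forall>e\<in>E. \<theta> \<bullet> e + \<delta> * (w \<bullet> e) \<le> 0"
      using positive_step_exists[OF finE, of "\<lambda>e. \<theta> \<bullet> e" "\<lambda>e. w \<bullet> e"] neg by auto
    have "(\<theta> + \<delta> *\<^sub>R w) \<bullet> d Z \<le> 0" if Z: "Z \<in> Sub Y" for Z
    proof (cases "d Z = d Y")
      case True
      then show ?thesis using wY \<theta> sub by (auto simp: cone_def inner_add_left)
    next
      case False
      then show ?thesis using Z \<delta> by (auto simp: E_def inner_add_left)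
    qed
    moreover have "(\<theta> + \<delta> *\<^sub>R w) \<bullet> d Y = 0"
      using wY \<theta> sub by (auto simp: cone_def inner_add_left)
    moreover have "\<theta> + \<delta> *\<^sub>R w \<in> orth_hyperplane v"
      using w \<theta> by (auto simp: cone_def orth_hyperplane_def H_def inner_add_right)
    ultimately have "\<theta> + \<delta> *\<^sub>R w \<in> cone Y"
      by (auto simp: cone_def)
    then have "(1 / \<delta>) *\<^sub>R ((\<theta> + \<delta> *\<^sub>R w) - \<theta>) \<in> Real_Vector_Spaces.span (cone Y)"
      using \<theta> sub by (intro real_vector.span_scale real_vector.span_diff real_vector.span_base) auto
    then show "w \<in> Real_Vector_Spaces.span (cone Y)"
      using \<delta>(1) by simp
  qed
  moreover have "cone Y \<subseteq> H"
    by (auto simp: cone_def H_def real_vector.span_singleton orthogonal_def inner_commute)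
  ultimately have "dim (cone Y) = dim H"
    by (metis dim_span dim_subset order_antisym)
  moreover have "dim H + dim (Real_Vector_Spaces.span {d Y}) = dim (orth_hyperplane v)"
    unfolding H_def
    using d_orth[OF Yo] orth_hyperplane_subspace
    by (intro dim_subspace_orthogonal_to_vectors real_vector.span_minimal)
       (auto simp: orth_hyperplane_def)
  moreover have "dim (Real_Vector_Spaces.span {d Y}) = 1"
    using d_nonzero[OF Yo] by (simp add: dim_span)
  ultimately show ?thesis
    using Yo sub by (intro bexI[of _ Y]) (simp_all add: cone_dim_eq_dim)
qed

text \<open>
  The equation \<open>w \<bullet> d M = 0\<close> enters as the two inequalities given by \<open>d M\<close> and \<open>- d M\<close>.
\<close>

lemma rational_frame_for_cones:
  "\<exists>B. rational_frame (orth_hyperplane v) B \<and> (\<forall>M\<in>Obj. rational_polyhedral_cone B (cone M))"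
proof -
  obtain B where B: "rational_frame (orth_hyperplane v) B" "finite B"
    "\<And>b e. b \<in> B \<Longrightarrow> e \<in> orth_hyperplane v \<inter> rational_vectors \<Longrightarrow> b \<bullet> e \<in> \<rat>"
    using rational_frame_exists[OF orth_hyperplane_subspace[of v]] by blast
  have "rational_polyhedral_cone B (cone M)" if M: "M \<in> Obj" for M
  proof -
    define D where "D = insert (d M) (insert (- d M) (d ` Sub M))"
    have rat: "d Y \<in> orth_hyperplane v \<inter> rational_vectors" if "Y \<in> Obj" for Y
      using that d_orth d_Nats Nats_subset_Rats
      by (auto simp: orth_hyperplane_def rational_vectors_def)
    have "b \<bullet> e \<in> \<rat>" if "e \<in> D" "b \<in> B" for e b
      using that B(3)[OF that(2) rat] M Sub_Obj[OF M] by (auto simp: D_def)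
    moreover have "finite D"
      using finite_d_Sub[OF M] by (simp add: D_def)
    ultimately have "rational_polyhedral_cone B {w \<in> Real_Vector_Spaces.span B. \<forall>e\<in>D. w \<bullet> e \<le> 0}"
      using B(2) by (intro rational_polyhedral_cone_inequalities)
    also have "{w \<in> Real_Vector_Spaces.span B. \<forall>e\<in>D. w \<bullet> e \<le> 0} = cone M"
      using B(1) by (auto simp: D_def cone_def rational_frame_def)
    finally show ?thesis .
  qed
  then show ?thesis using B(1) by blast
qed

text \<open>
  If \<open>\<zeta>\<close> is nonpositive on \<open>Sub M\<close> and vanishes on some \<open>Y\<close> there, then \<open>\<zeta> \<in> cone Y\<close>.  Off the cones
  the strict and the weak form of the condition therefore agree, so that it defines a subset of \<open>U\<close>
  that is both open and closed.
\<close>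

lemma all_Sub_negative_locally_constant:
  assumes M: "M \<in> Obj" and conn: "connected U"
    and U: "U \<subseteq> orth_hyperplane v" "U \<inter> \<Union>(cone ` Obj) = {}"
    and \<theta>: "\<theta> \<in> U" "\<forall>Y\<in>Sub M. \<theta> \<bullet> d Y < 0" and \<eta>: "\<eta> \<in> U"
  shows "\<forall>Y\<in>Sub M. \<eta> \<bullet> d Y < 0"
proof -
  define G where "G = {\<zeta> \<in> U. \<forall>Y\<in>Sub M. \<zeta> \<bullet> d Y < 0}"
  have fin: "finite (d ` Sub M)" by (rule finite_d_Sub[OF M])
  have weak: "\<zeta> \<in> G" if \<zeta>: "\<zeta> \<in> U" "\<forall>Y\<in>Sub M. \<zeta> \<bullet> d Y \<le> 0" for \<zeta>
  proof -
    have "\<zeta> \<bullet> d Y \<noteq> 0" if Y: "Y \<in> Sub M" for Y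
    proof
      assume "\<zeta> \<bullet> d Y = 0"
      then have "\<zeta> \<in> cone Y"
        using \<zeta> U(1) Sub_trans[OF M Y] by (auto simp: cone_def)
      then show False
        using \<zeta>(1) U(2) Sub_Obj[OF M Y] by blast
    qed
    then show ?thesis
      using \<zeta> by (force simp: G_def)
  qed
  have "G = U \<inter> (\<Inter>e\<in>d ` Sub M. {\<zeta>. e \<bullet> \<zeta> < 0})"
    by (auto simp: G_def inner_commute)
  moreover have "open (\<Inter>e\<in>d ` Sub M. {\<zeta>. e \<bullet> \<zeta> < 0})"
    using fin by (intro open_INT ballI open_halfspace_lt)
  ultimately have "openin (top_of_set U) G"
    by (simp only: openin_open_Int)
  moreover have "G = U \<inter> (\<Inter>e\<in>d ` Sub M. {\<zeta>. e \<bullet> \<zeta> \<le> 0})"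
    using weak by (auto simp: G_def inner_commute less_imp_le)
  then have "closedin (top_of_set U) G"
    by (auto intro!: closedin_closed_Int closed_INT closed_halfspace_le)
  moreover have "G \<noteq> {}"
    using \<theta> by (auto simp: G_def)
  ultimately have "G = U"
    using conn unfolding connected_clopen by blast
  then show ?thesis using \<eta> by (auto simp: G_def)
qed

text \<open>
  Torsion classes are constant on chambers, and this is the trace of that fact needed here.  The set
  \<open>Q\<close> consists of the subobjects that fail the condition of \<open>all_Sub_negative_locally_constant\<close>; a
  minimal element of it is positive on all of \<open>U\<close>, hence on segments with endpoints in \<open>U\<close>.
\<close>

lemma segment_avoids_cones:
  assumes conn: "connected U"
    and U: "U \<subseteq> orth_hyperplane v" "U \<inter> \<Union>(cone ` Obj) = {}"
    and xy: "x \<in> U" "y \<in> U" and t: "0 \<le> t" "t \<le> 1"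
  shows "(1 - t) *\<^sub>R x + t *\<^sub>R y \<notin> \<Union>(cone ` Obj)"
proof
  let ?z = "(1 - t) *\<^sub>R x + t *\<^sub>R y"
  assume "?z \<in> \<Union>(cone ` Obj)"
  then obtain M where M: "M \<in> Obj" "?z \<in> cone M" by blast
  have positive: "0 < (1 - t) * a + t * b" if "0 < a" "0 < b" for a b :: real
  proof (cases "t = 0")
    case False
    then have "0 < t * b" "0 \<le> (1 - t) * a" using that t by auto
    then show ?thesis by linarith
  qed (use that in simp)
  define Q where "Q = {Y \<in> Sub M. \<exists>\<theta>\<in>U. \<not> (\<forall>Z\<in>Sub Y. \<theta> \<bullet> d Z < 0)}"
  have "M \<in> Q"
  proof (rule ccontr)
    assume "M \<notin> Q"
    then have "x \<bullet> d M < 0" "y \<bullet> d M < 0"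
      using xy Sub_self[OF M(1)] by (auto simp: Q_def)
    then have "0 < (1 - t) * (- (x \<bullet> d M)) + t * (- (y \<bullet> d M))"
      by (intro positive) auto
    then show False
      using M(2) by (simp add: cone_def inner_add_left)
  qed
  then have "Q \<subseteq> Sub M" "Q \<noteq> {}"
    by (auto simp: Q_def)
  then obtain Y where Y: "Y \<in> Q" and min: "\<And>Z. Z \<in> Sub Y \<Longrightarrow> Z \<in> Q \<Longrightarrow> d Z = d Y"
    by (rule d_minimal[OF M(1)]) blast
  have YM: "Y \<in> Sub M" and Yo: "Y \<in> Obj"
    using Y M Sub_Obj by (auto simp: Q_def)
  have small: "d Z = d Y \<or> \<theta> \<bullet> d Z < 0" if "Z \<in> Sub Y" "\<theta> \<in> U" for Z \<theta>
  proof (cases "Z \<in> Q")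
    case True
    then show ?thesis using min that by blast
  next
    case False
    moreover have "Z \<in> Sub M" "Z \<in> Sub Z"
      using Sub_trans[OF M(1) YM that(1)] Sub_Obj[OF Yo that(1)] Sub_self by auto
    ultimately show ?thesis using that(2) by (auto simp: Q_def)
  qed
  have pos: "0 < \<theta> \<bullet> d Y" if \<theta>: "\<theta> \<in> U" for \<theta>
  proof -
    have "\<not> (\<forall>Z\<in>Sub Y. \<theta> \<bullet> d Z < 0)"
      using all_Sub_negative_locally_constant[OF Yo conn U \<theta>] Y by (auto simp: Q_def)
    then have "0 \<le> \<theta> \<bullet> d Y"
      using small \<theta> by force
    moreover have "\<theta> \<bullet> d Y \<noteq> 0"
    proof
      assume "\<theta> \<bullet> d Y = 0"
      then have "\<theta> \<in> cone Y"
        using small[OF _ \<theta>] \<theta> U(1) by (fastforce simp: cone_def)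
      then show False using \<theta> U(2) Yo by blast
    qed
    ultimately show ?thesis by simp
  qed
  have "0 < ?z \<bullet> d Y"
    using positive[OF pos[OF xy(1)] pos[OF xy(2)]] by (simp add: inner_add_left)
  then show False
    using M(2) YM by (auto simp: cone_def not_less[symmetric])
qed

text \<open>
  To keep segments away from the closure as well, both endpoints are translated by the same small
  vector \<open>z' - z\<close> of the hyperplane, which moves \<open>z\<close> to any given nearby point \<open>z'\<close>.
\<close>

lemma chamber_convex:
  assumes U: "U \<in> components (orth_hyperplane v - closure (\<Union>(cone ` Obj)))"
  shows "convex U"
proof -
  let ?V = "orth_hyperplane v" and ?A = "\<Union>(cone ` Obj)"
  have UV: "U \<subseteq> ?V" and UA: "U \<inter> closure ?A = {}" and conn: "connected U"
    using in_components_subset[OF U] in_components_connected[OF U] by auto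
  have UA': "U \<inter> ?A = {}" using UA closure_subset[of ?A] by (auto simp only: disjoint_iff subset_iff)
  have AV: "?A \<subseteq> ?V" by (auto simp: cone_def)
  have V: "Real_Vector_Spaces.subspace ?V" by (rule orth_hyperplane_subspace)
  have "locally connected ?V"
    using V by (intro convex_imp_locally_connected subspace_imp_convex)
  moreover have opn: "openin (top_of_set ?V) (?V - closure ?A)"
    by (simp add: Diff_eq openin_open_Int open_Compl)
  ultimately have "locally connected (?V - closure ?A)"
    using locally_open_subset by blast
  then have "openin (top_of_set (?V - closure ?A)) U"
    using U openin_components_locally_connected by blast
  then have "openin (top_of_set ?V) U"
    using opn openin_trans by blast
  then have ball: "\<exists>r>0. ball a r \<inter> ?V \<subseteq> U" if "a \<in> U" for a
    using that unfolding openin_contains_ball by simp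
  have segment: "closed_segment x y \<subseteq> ?V - closure ?A" if xy: "x \<in> U" "y \<in> U" for x y
  proof
    fix z assume "z \<in> closed_segment x y"
    then obtain t where t: "z = (1 - t) *\<^sub>R x + t *\<^sub>R y" "0 \<le> t" "t \<le> 1"
      by (auto simp: in_segment)
    have zV: "z \<in> ?V"
      unfolding t(1) using xy UV V
      by (intro real_vector.subspace_add real_vector.subspace_scale) auto
    obtain r s where rs: "r > 0" "ball x r \<inter> ?V \<subseteq> U" "s > 0" "ball y s \<inter> ?V \<subseteq> U"
      using ball xy by meson
    have "z' \<notin> ball z (min r s)" if z': "z' \<in> ?A" for z'
    proof
      assume b: "z' \<in> ball z (min r s)"
      let ?e = "z' - z"
      have eV: "?e \<in> ?V" using zV z' AV V by (intro real_vector.subspace_diff) auto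
      have "x + ?e \<in> ball x r" "y + ?e \<in> ball y s"
        using b by (auto simp: dist_norm norm_minus_commute)
      moreover have "x + ?e \<in> ?V" "y + ?e \<in> ?V"
        using eV xy UV V by (auto intro!: real_vector.subspace_add)
      ultimately have "x + ?e \<in> U" "y + ?e \<in> U"
        using rs by blast+
      then have "(1 - t) *\<^sub>R (x + ?e) + t *\<^sub>R (y + ?e) \<notin> ?A"
        using t(2,3) by (intro segment_avoids_cones[OF conn UV UA'])
      moreover have "(1 - t) *\<^sub>R (x + ?e) + t *\<^sub>R (y + ?e) = z'"
        unfolding t(1) by (simp add: algebra_simps)
      ultimately show False using z' by simp
    qed
    then have "z \<notin> closure ?A"
      using rs unfolding closure_approachable by (metis dist_commute mem_ball min_less_iff_conj)
    then show "z \<in> ?V - closure ?A" using zV by simp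
  qed
  show ?thesis
    unfolding convex_contains_segment
  proof (intro ballI)
    fix x y assume xy: "x \<in> U" "y \<in> U"
    then show "closed_segment x y \<subseteq> U"
      using components_maximal[OF U connected_segment(1) segment[OF xy]] by auto
  qed
qed

theorem wall_and_chamber_structure_cones:
  assumes "\<And>M Y. M \<in> Obj \<Longrightarrow> Y \<in> Obj \<Longrightarrow> \<exists>Z\<in>Obj. cone Z = cone M \<inter> cone Y"
  shows "wall_and_chamber_structure (orth_hyperplane v) (cone ` Obj)"
  unfolding wall_and_chamber_structure_def
proof (intro conjI)
  show "\<exists>B. rational_frame (orth_hyperplane v) B \<and> (\<forall>C\<in>cone ` Obj. rational_polyhedral_cone B C)"
    using rational_frame_for_cones by simp
  show "\<forall>C\<in>cone ` Obj. \<forall>C'\<in>cone ` Obj. C \<inter> C' \<in> cone ` Obj"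
  proof (intro ballI)
    fix C C' assume "C \<in> cone ` Obj" "C' \<in> cone ` Obj"
    then obtain M N where MN: "M \<in> Obj" "N \<in> Obj" "C = cone M" "C' = cone N"
      by blast
    obtain Z where "Z \<in> Obj" "cone Z = C \<inter> C'"
      using assms[OF MN(1,2)] unfolding MN(3,4) by blast
    then show "C \<inter> C' \<in> cone ` Obj"
      by (metis imageI)
  qed
  show "\<forall>C\<in>cone ` Obj. \<exists>W\<in>cone ` Obj. cone_dim W + 1 = dim (orth_hyperplane v) \<and> C \<subseteq> W"
    using cone_contained_in_wall by auto
  show "\<forall>U\<in>components (orth_hyperplane v - closure (\<Union>(cone ` Obj))). convex U"
    using chamber_convex by blast
qed

end

section \<open>Finite-dimensional vector spaces\<close>

lemma (in vectorspace) fin_dim_submodule: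
  assumes fd: fin_dim and W: "LinearCombinations.submodule K W V"
  shows "vectorspace.fin_dim K (vs W)" and "vectorspace.dim K (vs W) \<le> dim"
proof -
  have sub: "VectorSpace.subspace K W V"
    using W vectorspace_axioms by (simp add: VectorSpace.subspace_def)
  interpret W: vectorspace K "vs W"
    by (rule subspace_is_vs[OF sub])
  have WV: "W \<subseteq> carrier V"
    using W by (simp add: LinearCombinations.submodule_def)
  have small: "finite A \<and> card A \<le> dim" if "A \<subseteq> carrier (vs W) \<and> W.lin_indpt A" for A
  proof -
    have "lin_indpt A"
      using that span_li_not_depend(2)[OF _ W, of A] by auto
    then show ?thesis
      using that WV li_le_dim[OF fd, of A] by auto
  qed
  have "W.lin_indpt {}"
    by (rule W.finite_lin_indpt2) auto
  then obtain A where A: "finite A" "maximal A (\<lambda>S. S \<subseteq> carrier (vs W) \<and> W.lin_indpt S)"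
    using maximal_exists[of "\<lambda>S. S \<subseteq> carrier (vs W) \<and> W.lin_indpt S" dim "{}"] small by auto
  have basis: "W.basis A"
    by (rule W.max_li_is_basis[OF A(2)])
  then show "W.fin_dim"
    using A(1) unfolding W.fin_dim_def W.basis_def by blast
  show "W.dim \<le> dim"
    using W.dim_basis[OF A(1) basis] small[of A] basis unfolding W.basis_def by auto
qed

lemma linear_mapI:
  assumes "vectorspace K V" and "vectorspace K W" and "T \<in> module_hom K V W"
  shows "linear_map K V W T"
  using assms by (simp add: linear_map_def mod_hom_def mod_hom_axioms_def vectorspace_def)

text \<open>
  Preimages of generators of the image, together with generators of the kernel, generate the domain.
\<close>

lemma (in linear_map) fin_dim_of_kernel:
  assumes fW: "W.fin_dim" and fker: "vectorspace.fin_dim K (V.vs kerT)"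
  shows "V.fin_dim"
proof -
  have imsub: "LinearCombinations.submodule K imT W" and kersub: "LinearCombinations.submodule K kerT V"
    using im_is_submodule ker_is_submodule by auto
  interpret im: vectorspace K "W.vs imT"
    using imT_is_subspace W.subspace_is_vs by blast
  interpret ker: vectorspace K "V.vs kerT"
    using kerT_is_subspace V.subspace_is_vs by blast
  obtain C where C: "finite C" "C \<subseteq> imT" "W.module.span C = imT"
    using W.fin_dim_submodule(1)[OF fW imsub] W.module.span_li_not_depend(1)[OF _ imsub]
    unfolding im.fin_dim_def by auto
  obtain B where B: "finite B" "B \<subseteq> kerT" "V.module.span B = kerT"
    using fker V.module.span_li_not_depend(1)[OF _ kersub]
    unfolding ker.fin_dim_def by auto
  have kerV: "kerT \<subseteq> carrier V"
    by (auto simp: ker_def)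
  have "\<forall>c\<in>C. \<exists>x. x \<in> carrier V \<and> T x = c"
    using C(2) by (auto simp: im_def)
  then obtain g where g: "\<And>c. c \<in> C \<Longrightarrow> g c \<in> carrier V" "\<And>c. c \<in> C \<Longrightarrow> T (g c) = c"
    by metis
  define A where "A = B \<union> g ` C"
  have AV: "A \<subseteq> carrier V"
    using B(2) kerV g(1) by (auto simp: A_def)
  define S where "S = V.module.span A"
  have S: "LinearCombinations.submodule K S V"
    unfolding S_def by (rule V.module.span_is_submodule[OF AV])
  then have SV: "S \<subseteq> carrier V" and S0: "\<zero>\<^bsub>V\<^esub> \<in> S"
    and Sadd: "\<And>x y. x \<in> S \<Longrightarrow> y \<in> S \<Longrightarrow> x \<oplus>\<^bsub>V\<^esub> y \<in> S"
    and Ssmult: "\<And>k x. k \<in> carrier K \<Longrightarrow> x \<in> S \<Longrightarrow> k \<odot>\<^bsub>V\<^esub> x \<in> S"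
    by (auto simp: LinearCombinations.submodule_def)
  have AS: "A \<subseteq> S"
    unfolding S_def by (rule V.module.in_own_span[OF AV])
  have TS: "LinearCombinations.submodule K (T ` S) W"
  proof
    show "T ` S \<subseteq> carrier W" using SV by auto
    fix v w assume "v \<in> T ` S" "w \<in> T ` S"
    then obtain x y where xy: "x \<in> S" "v = T x" "y \<in> S" "w = T y"
      by blast
    then have "v \<oplus>\<^bsub>W\<^esub> w = T (x \<oplus>\<^bsub>V\<^esub> y)"
      using SV by (simp add: subset_iff)
    then show "v \<oplus>\<^bsub>W\<^esub> w \<in> T ` S"
      using Sadd xy by blast
  next
    show "\<zero>\<^bsub>W\<^esub> \<in> T ` S" using S0 by (metis T0_is_0 imageI)
  next
    fix c v assume c: "c \<in> carrier K" "v \<in> T ` S"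
    then obtain x where x: "x \<in> S" "v = T x"
      by blast
    then have "c \<odot>\<^bsub>W\<^esub> v = T (c \<odot>\<^bsub>V\<^esub> x)"
      using SV c(1) by auto
    then show "c \<odot>\<^bsub>W\<^esub> v \<in> T ` S"
      using Ssmult c(1) x by blast
  qed
  have "C \<subseteq> T ` S"
    using g(2) AS by (force simp: A_def)
  then have imTS: "imT \<subseteq> T ` S"
    using W.module.span_is_subset[OF _ TS] C(3) by blast
  have BS: "kerT \<subseteq> S"
    using V.module.span_is_subset[OF _ S, of B] AS B(3) by (auto simp: A_def)
  have "carrier V \<subseteq> S"
  proof
    fix v assume v: "v \<in> carrier V"
    then have "T v \<in> T ` S"
      using imTS by (auto simp: im_def)
    then obtain u where u: "u \<in> S" "T v = T u"
      by blast
    have uV: "u \<in> carrier V" using u SV by blast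
    have "T (v \<ominus>\<^bsub>V\<^esub> u) = \<zero>\<^bsub>W\<^esub>"
      using v uV u(2) by (simp add: W.module.M.r_neg a_minus_def)
    then have "v \<ominus>\<^bsub>V\<^esub> u \<in> S"
      using BS v uV by (auto simp: ker_def)
    then have "(v \<ominus>\<^bsub>V\<^esub> u) \<oplus>\<^bsub>V\<^esub> u \<in> S"
      using Sadd u(1) by blast
    then show "v \<in> S"
      using v uV by (simp add: a_minus_def V.module.M.a_assoc V.module.M.l_neg)
  qed
  then have "V.module.gen_set A"
    using SV by (auto simp: S_def)
  moreover have "finite A"
    using B(1) C(1) by (simp add: A_def)
  ultimately show ?thesis
    using AV unfolding V.fin_dim_def by blast
qed

section \<open>Left modules and their homomorphisms\<close>

lemma left_moduleI:
  fixes R :: "('a, 'c) ring_scheme" and M :: "('a, 'm, 'd) module_scheme"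
  assumes "ring R" and "abelian_group M"
    and "\<And>a x. a \<in> carrier R \<Longrightarrow> x \<in> carrier M \<Longrightarrow> a \<odot>\<^bsub>M\<^esub> x \<in> carrier M"
    and "\<And>a b x. a \<in> carrier R \<Longrightarrow> b \<in> carrier R \<Longrightarrow> x \<in> carrier M \<Longrightarrow>
        (a \<oplus>\<^bsub>R\<^esub> b) \<odot>\<^bsub>M\<^esub> x = a \<odot>\<^bsub>M\<^esub> x \<oplus>\<^bsub>M\<^esub> b \<odot>\<^bsub>M\<^esub> x"
    and "\<And>a x y. a \<in> carrier R \<Longrightarrow> x \<in> carrier M \<Longrightarrow> y \<in> carrier M \<Longrightarrow>
        a \<odot>\<^bsub>M\<^esub> (x \<oplus>\<^bsub>M\<^esub> y) = a \<odot>\<^bsub>M\<^esub> x \<oplus>\<^bsub>M\<^esub> a \<odot>\<^bsub>M\<^esub> y"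
    and "\<And>a b x. a \<in> carrier R \<Longrightarrow> b \<in> carrier R \<Longrightarrow> x \<in> carrier M \<Longrightarrow>
        (a \<otimes>\<^bsub>R\<^esub> b) \<odot>\<^bsub>M\<^esub> x = a \<odot>\<^bsub>M\<^esub> (b \<odot>\<^bsub>M\<^esub> x)"
    and "\<And>x. x \<in> carrier M \<Longrightarrow> \<one>\<^bsub>R\<^esub> \<odot>\<^bsub>M\<^esub> x = x"
  shows "left_module R M"
  using assms by (simp add: left_module_def left_module_axioms_def)

context left_module
begin

lemma smult_l_null: "x \<in> carrier M \<Longrightarrow> \<zero> \<odot>\<^bsub>M\<^esub> x = \<zero>\<^bsub>M\<^esub>"
  using smult_l_distr[of \<zero> \<zero> x] smult_closed[of \<zero> x]
  by (metis M.add.r_cancel_one' R.l_zero R.zero_closed)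

lemma smult_r_null: "a \<in> carrier R \<Longrightarrow> a \<odot>\<^bsub>M\<^esub> \<zero>\<^bsub>M\<^esub> = \<zero>\<^bsub>M\<^esub>"
  using smult_r_distr[of a "\<zero>\<^bsub>M\<^esub>" "\<zero>\<^bsub>M\<^esub>"] smult_closed[of a "\<zero>\<^bsub>M\<^esub>"]
  by (metis M.add.r_cancel_one' M.l_zero M.zero_closed)

text \<open>
  Hence a subset closed under addition and scalars is closed under negation.
\<close>

lemma smult_minus_one: "x \<in> carrier M \<Longrightarrow> (\<ominus> \<one>) \<odot>\<^bsub>M\<^esub> x = \<ominus>\<^bsub>M\<^esub> x"
  using smult_l_distr[of "\<ominus> \<one>" \<one> x] smult_closed[of "\<ominus> \<one>" x] smult_one[of x] smult_l_null[of x]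
  by (simp add: R.l_neg M.minus_equality[symmetric])

lemma submoduleI_left:
  assumes "N \<subseteq> carrier M" and "\<zero>\<^bsub>M\<^esub> \<in> N"
    and "\<And>x y. x \<in> N \<Longrightarrow> y \<in> N \<Longrightarrow> x \<oplus>\<^bsub>M\<^esub> y \<in> N"
    and "\<And>a x. a \<in> carrier R \<Longrightarrow> x \<in> N \<Longrightarrow> a \<odot>\<^bsub>M\<^esub> x \<in> N"
  shows "Module.submodule N R M"
proof -
  have "inv\<^bsub>add_monoid M\<^esub> x \<in> N" if "x \<in> N" for x
    using assms(4)[of "\<ominus> \<one>" x] smult_minus_one[of x] assms(1) that
    by (auto simp: a_inv_def)
  then show ?thesis
    using assms
    by (auto simp: Module.submodule_def submodule_axioms_def intro!: subgroup.intro)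
qed

lemma submoduleD:
  assumes "Module.submodule N R M"
  shows "N \<subseteq> carrier M" and "\<zero>\<^bsub>M\<^esub> \<in> N"
    and "x \<in> N \<Longrightarrow> y \<in> N \<Longrightarrow> x \<oplus>\<^bsub>M\<^esub> y \<in> N"
    and "a \<in> carrier R \<Longrightarrow> x \<in> N \<Longrightarrow> a \<odot>\<^bsub>M\<^esub> x \<in> N"
  using assms subgroup.subset[of N "add_monoid M"] subgroup.one_closed[of N "add_monoid M"]
    subgroup.m_closed[of N "add_monoid M"]
  by (auto simp: Module.submodule_def submodule_axioms_def)

lemma submodule_carrier: "Module.submodule (carrier M) R M"
  by (rule submoduleI_left) (auto intro: smult_closed)

lemma submodule_zero: "Module.submodule {\<zero>\<^bsub>M\<^esub>} R M"
  by (rule submoduleI_left) (auto simp: smult_r_null)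

lemma left_module_submodule:
  assumes N: "Module.submodule N R M"
  shows "left_module R (M\<lparr>carrier := N\<rparr>)"
proof (rule left_moduleI)
  note N = submoduleD[OF N]
  show "ring R" by (rule R.ring_axioms)
  show "abelian_group (M\<lparr>carrier := N\<rparr>)"
  proof (rule abelian_groupI)
    fix x assume x: "x \<in> carrier (M\<lparr>carrier := N\<rparr>)"
    then have "\<ominus>\<^bsub>M\<^esub> x \<in> N" "\<ominus>\<^bsub>M\<^esub> x \<oplus>\<^bsub>M\<^esub> x = \<zero>\<^bsub>M\<^esub>"
      using N(4)[of "\<ominus> \<one>" x] N(1) smult_minus_one[of x] by (auto simp: M.l_neg)
    then show "\<exists>y\<in>carrier (M\<lparr>carrier := N\<rparr>). y \<oplus>\<^bsub>M\<lparr>carrier := N\<rparr>\<^esub> x = \<zero>\<^bsub>M\<lparr>carrier := N\<rparr>\<^esub>"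
      by auto
  qed (use N in \<open>auto simp: subset_iff M.a_assoc M.a_comm M.a_lcomm\<close>)
qed (use submoduleD[OF N] in
      \<open>auto simp: subset_iff smult_l_distr smult_r_distr smult_assoc smult_one\<close>)

lemma submodule_of_submodule:
  assumes N: "Module.submodule N R M"
  shows "Module.submodule N' R (M\<lparr>carrier := N\<rparr>) \<longleftrightarrow> Module.submodule N' R M \<and> N' \<subseteq> N"
proof -
  interpret N: left_module R "M\<lparr>carrier := N\<rparr>"
    by (rule left_module_submodule[OF N])
  show ?thesis
  proof safe
    assume "Module.submodule N' R (M\<lparr>carrier := N\<rparr>)"
    from N.submoduleD[OF this] show "Module.submodule N' R M"
      using submoduleD(1)[OF N] by (intro submoduleI_left) auto
  next
    fix x assume "Module.submodule N' R (M\<lparr>carrier := N\<rparr>)" "x \<in> N'"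
    then show "x \<in> N"
      using N.submoduleD(1) by auto
  next
    assume "Module.submodule N' R M" "N' \<subseteq> N"
    then show "Module.submodule N' R (M\<lparr>carrier := N\<rparr>)"
      using submoduleD[of N'] by (intro N.submoduleI_left) auto
  qed
qed

end

lemma module_homI:
  assumes "\<And>x. x \<in> carrier M \<Longrightarrow> f x \<in> carrier N"
    and "\<And>x y. x \<in> carrier M \<Longrightarrow> y \<in> carrier M \<Longrightarrow> f (x \<oplus>\<^bsub>M\<^esub> y) = f x \<oplus>\<^bsub>N\<^esub> f y"
    and "\<And>a x. a \<in> carrier R \<Longrightarrow> x \<in> carrier M \<Longrightarrow> f (a \<odot>\<^bsub>M\<^esub> x) = a \<odot>\<^bsub>N\<^esub> f x"
  shows "f \<in> module_hom R M N"
  using assms by (auto simp: module_hom_def)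

lemma module_homD:
  assumes "f \<in> module_hom R M N"
  shows "x \<in> carrier M \<Longrightarrow> f x \<in> carrier N"
    and "x \<in> carrier M \<Longrightarrow> y \<in> carrier M \<Longrightarrow> f (x \<oplus>\<^bsub>M\<^esub> y) = f x \<oplus>\<^bsub>N\<^esub> f y"
    and "a \<in> carrier R \<Longrightarrow> x \<in> carrier M \<Longrightarrow> f (a \<odot>\<^bsub>M\<^esub> x) = a \<odot>\<^bsub>N\<^esub> f x"
  using assms by (auto simp: module_hom_def)

lemma module_hom_zero:
  assumes "left_module R M" "left_module R N" "f \<in> module_hom R M N"
  shows "f \<zero>\<^bsub>M\<^esub> = \<zero>\<^bsub>N\<^esub>"
proof -
  interpret M: left_module R M by fact
  interpret N: left_module R N by fact
  have "f (\<zero>\<^bsub>R\<^esub> \<odot>\<^bsub>M\<^esub> \<zero>\<^bsub>M\<^esub>) = \<zero>\<^bsub>R\<^esub> \<odot>\<^bsub>N\<^esub> f \<zero>\<^bsub>M\<^esub>"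
    using module_homD(3)[OF assms(3)] by simp
  then show ?thesis
    using module_homD(1)[OF assms(3)] by (simp add: M.smult_l_null N.smult_l_null)
qed

lemma module_hom_kernel_submodule:
  assumes M: "left_module R M" and N: "left_module R N" and f: "f \<in> module_hom R M N"
  shows "Module.submodule {x \<in> carrier M. f x = \<zero>\<^bsub>N\<^esub>} R M"
proof -
  interpret M: left_module R M by fact
  interpret N: left_module R N by fact
  show ?thesis
    using module_homD[OF f] module_hom_zero[OF M N f]
    by (intro M.submoduleI_left) (auto intro: M.smult_closed simp: N.smult_r_null)
qed

lemma module_hom_image_submodule:
  assumes M: "left_module R M" and N: "left_module R N" and f: "f \<in> module_hom R M N"
    and S: "Module.submodule S R M"
  shows "Module.submodule (f ` S) R N"
proof -
  interpret M: left_module R M by fact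
  interpret N: left_module R N by fact
  note SD = M.submoduleD[OF S]
  show ?thesis
  proof (rule N.submoduleI_left)
    show "f ` S \<subseteq> carrier N"
      using SD(1) module_homD(1)[OF f] by auto
    show "\<zero>\<^bsub>N\<^esub> \<in> f ` S"
      using SD(2) module_hom_zero[OF M N f] by (metis imageI)
  next
    fix x y assume "x \<in> f ` S" "y \<in> f ` S"
    then obtain s t where st: "s \<in> S" "t \<in> S" "x = f s" "y = f t" by blast
    then have "x \<oplus>\<^bsub>N\<^esub> y = f (s \<oplus>\<^bsub>M\<^esub> t)"
      using SD(1) module_homD(2)[OF f, of s t] by (simp add: subset_iff)
    then show "x \<oplus>\<^bsub>N\<^esub> y \<in> f ` S"
      using SD(3) st by blast
  next
    fix a x assume a: "a \<in> carrier R" "x \<in> f ` S"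
    then obtain s where s: "s \<in> S" "x = f s" by blast
    then have "a \<odot>\<^bsub>N\<^esub> x = f (a \<odot>\<^bsub>M\<^esub> s)"
      using SD(1) a module_homD(3)[OF f] by auto
    then show "a \<odot>\<^bsub>N\<^esub> x \<in> f ` S"
      using SD(4) a s by blast
  qed
qed

section \<open>Finitely generated modules over a finite-dimensional algebra\<close>

locale fd_algebra =
  fixes K :: "'k ring" and \<Lambda> :: "('k, 'a) module"
  assumes field_K: "field K" and fin_dim: "fin_dim_algebra K \<Lambda>"
begin

lemma vectorspace_algebra: "vectorspace K \<Lambda>"
  and ring_algebra: "ring \<Lambda>"
  and fin_dim_over_K: "vectorspace.fin_dim K \<Lambda>"
  using fin_dim by (auto simp: fin_dim_algebra_def)

sublocale K: field K by (rule field_K)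
sublocale VS: vectorspace K \<Lambda> by (rule vectorspace_algebra)
sublocale L: ring \<Lambda> by (rule ring_algebra)

definition scalar :: "'k \<Rightarrow> 'a" where
  "scalar k = k \<odot>\<^bsub>\<Lambda>\<^esub> \<one>\<^bsub>\<Lambda>\<^esub>"

lemma scalar_closed: "k \<in> carrier K \<Longrightarrow> scalar k \<in> carrier \<Lambda>"
  by (simp add: scalar_def)

lemma scalar_mult_left: "k \<in> carrier K \<Longrightarrow> a \<in> carrier \<Lambda> \<Longrightarrow> scalar k \<otimes>\<^bsub>\<Lambda>\<^esub> a = k \<odot>\<^bsub>\<Lambda>\<^esub> a"
  using fin_dim unfolding fin_dim_algebra_def scalar_def by (metis L.l_one L.one_closed)

lemma scalar_mult_right: "k \<in> carrier K \<Longrightarrow> a \<in> carrier \<Lambda> \<Longrightarrow> a \<otimes>\<^bsub>\<Lambda>\<^esub> scalar k = k \<odot>\<^bsub>\<Lambda>\<^esub> a"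
  using fin_dim unfolding fin_dim_algebra_def scalar_def by (metis L.r_one L.one_closed)

lemma scalar_add:
  "k \<in> carrier K \<Longrightarrow> l \<in> carrier K \<Longrightarrow> scalar (k \<oplus>\<^bsub>K\<^esub> l) = scalar k \<oplus>\<^bsub>\<Lambda>\<^esub> scalar l"
  by (simp add: scalar_def VS.smult_l_distr)

lemma scalar_mult:
  "k \<in> carrier K \<Longrightarrow> l \<in> carrier K \<Longrightarrow> scalar (k \<otimes>\<^bsub>K\<^esub> l) = scalar k \<otimes>\<^bsub>\<Lambda>\<^esub> scalar l"
  by (simp add: scalar_mult_left scalar_closed) (simp add: scalar_def VS.smult_assoc1)

lemma scalar_one: "scalar \<one>\<^bsub>K\<^esub> = \<one>\<^bsub>\<Lambda>\<^esub>"
  by (simp add: scalar_def)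

text \<open>
  The underlying \<open>K\<close>-vector space of a module.  The change of scalars changes the type of
  the record, so it is built anew.
\<close>

definition scalar_restriction :: "('a, 'm) module \<Rightarrow> ('k, 'm) module" where
  "scalar_restriction M =
     \<lparr>carrier = carrier M, mult = mult M, one = \<one>\<^bsub>M\<^esub>, zero = \<zero>\<^bsub>M\<^esub>, add = add M,
      smult = (\<lambda>k x. scalar k \<odot>\<^bsub>M\<^esub> x)\<rparr>"

lemma scalar_restriction_simps [simp]:
  "carrier (scalar_restriction M) = carrier M"
  "\<zero>\<^bsub>scalar_restriction M\<^esub> = \<zero>\<^bsub>M\<^esub>"
  "x \<oplus>\<^bsub>scalar_restriction M\<^esub> y = x \<oplus>\<^bsub>M\<^esub> y"
  "k \<odot>\<^bsub>scalar_restriction M\<^esub> x = scalar k \<odot>\<^bsub>M\<^esub> x"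
  by (simp_all add: scalar_restriction_def)

lemma vectorspace_scalar_restriction:
  assumes "left_module \<Lambda> M"
  shows "vectorspace K (scalar_restriction M)"
proof -
  interpret M: left_module \<Lambda> M by fact
  have neg: "\<exists>y\<in>carrier M. x \<oplus>\<^bsub>M\<^esub> y = \<zero>\<^bsub>M\<^esub>" if "x \<in> carrier M" for x
    using that M.M.r_neg by blast
  show ?thesis
    by (rule vs_criteria[OF field_K])
       (auto simp: neg M.smult_closed scalar_closed M.M.a_comm M.M.a_assoc M.M.a_lcomm scalar_mult
          M.smult_assoc scalar_one M.smult_one scalar_add M.smult_l_distr M.smult_r_distr)
qed

lemma submodule_scalar_restriction:
  assumes M: "left_module \<Lambda> M" and N: "Module.submodule N \<Lambda> M"
  shows "LinearCombinations.submodule K N (scalar_restriction M)"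
proof -
  interpret M: left_module \<Lambda> M by fact
  interpret V: vectorspace K "scalar_restriction M" by (rule vectorspace_scalar_restriction[OF M])
  show ?thesis
    using M.submoduleD[OF N] V.module_axioms scalar_closed
    by (auto simp: LinearCombinations.submodule_def)
qed

lemma linear_preimage_submodule:
  assumes V: "vectorspace K V" and W: "vectorspace K W" and f: "f \<in> module_hom K V W"
    and S: "LinearCombinations.submodule K S W"
  shows "LinearCombinations.submodule K {x \<in> carrier V. f x \<in> S} V"
proof -
  interpret f: linear_map K V W f by (rule linear_mapI[OF V W f])
  have "Module.module K V"
    using V by (simp add: vectorspace_def)
  then show ?thesis
    using S by (auto simp: LinearCombinations.submodule_def)
qed

text \<open>
  If \<open>A\<close> spans \<open>\<Lambda>\<close> over \<open>K\<close> and \<open>S\<close> generates \<open>M\<close>, then the products of \<open>A\<close> and \<open>S\<close> span a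
  \<open>\<Lambda>\<close>-submodule containing \<open>S\<close>; that it is stable under \<open>\<Lambda>\<close> is seen by checking generators twice,
  as preimages of subspaces under multiplication maps are subspaces.  In the other direction,
  every \<open>\<Lambda>\<close>-submodule is a subspace.
\<close>

lemma fin_dim_iff_fin_gen:
  assumes M: "left_module \<Lambda> M"
  shows "fin_gen_module \<Lambda> M \<longleftrightarrow> vectorspace.fin_dim K (scalar_restriction M)"
proof -
  interpret M: left_module \<Lambda> M by fact
  interpret V: vectorspace K "scalar_restriction M" by (rule vectorspace_scalar_restriction[OF M])
  show ?thesis
  proof
    assume "fin_gen_module \<Lambda> M"
    then obtain S where S: "finite S" "S \<subseteq> carrier M"
      "\<And>N. Module.submodule N \<Lambda> M \<Longrightarrow> S \<subseteq> N \<Longrightarrow> N = carrier M"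
      by (auto simp: fin_gen_module_def)
    obtain A where A: "finite A" "A \<subseteq> carrier \<Lambda>" "VS.span A = carrier \<Lambda>"
      using fin_dim_over_K unfolding VS.fin_dim_def by blast
    define T where "T = (\<lambda>(a, s). a \<odot>\<^bsub>M\<^esub> s) ` (A \<times> S)"
    have T: "finite T" "T \<subseteq> carrier M"
      using S A by (auto simp: T_def intro!: M.smult_closed)
    define N where "N = V.span T"
    have N: "LinearCombinations.submodule K N (scalar_restriction M)"
      unfolding N_def using T by (intro V.span_is_submodule) auto
    have TN: "T \<subseteq> N"
      unfolding N_def using T by (intro V.in_own_span) auto
    have gen: "a \<odot>\<^bsub>M\<^esub> s \<in> N" if a: "a \<in> carrier \<Lambda>" and s: "s \<in> S" for a s
    proof -
      have sM: "s \<in> carrier M" using s S by blast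
      have "(\<lambda>a. a \<odot>\<^bsub>M\<^esub> s) \<in> module_hom K \<Lambda> (scalar_restriction M)"
        using sM by (intro module_homI)
          (auto simp: M.smult_closed M.smult_l_distr scalar_mult_left[symmetric] scalar_closed M.smult_assoc)
      from linear_preimage_submodule[OF vectorspace_algebra V.vectorspace_axioms this N]
      have "VS.span A \<subseteq> {a \<in> carrier \<Lambda>. a \<odot>\<^bsub>M\<^esub> s \<in> N}"
        using A(2) TN s by (intro VS.span_is_subset) (auto simp: T_def)
      then show ?thesis using a A(3) by blast
    qed
    have closed: "a \<odot>\<^bsub>M\<^esub> x \<in> N" if a: "a \<in> carrier \<Lambda>" and x: "x \<in> N" for a x
    proof -
      have "(\<lambda>x. a \<odot>\<^bsub>M\<^esub> x) \<in> module_hom K (scalar_restriction M) (scalar_restriction M)"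
        using a by (intro module_homI)
          (auto simp: M.smult_closed M.smult_r_distr scalar_closed M.smult_assoc[symmetric]
             scalar_mult_left scalar_mult_right)
      from linear_preimage_submodule[OF V.vectorspace_axioms V.vectorspace_axioms this N]
      have "V.span T \<subseteq> {x \<in> carrier M. a \<odot>\<^bsub>M\<^esub> x \<in> N}"
      proof (intro V.span_is_subset)
        show "T \<subseteq> {x \<in> carrier M. a \<odot>\<^bsub>M\<^esub> x \<in> N}"
        proof
          fix t assume t: "t \<in> T"
          then obtain b s where bs: "b \<in> A" "s \<in> S" "t = b \<odot>\<^bsub>M\<^esub> s"
            by (auto simp: T_def)
          then have "a \<odot>\<^bsub>M\<^esub> t = (a \<otimes>\<^bsub>\<Lambda>\<^esub> b) \<odot>\<^bsub>M\<^esub> s"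
            using a A(2) S(2) by (simp add: M.smult_assoc subset_iff)
          then show "t \<in> {x \<in> carrier M. a \<odot>\<^bsub>M\<^esub> x \<in> N}"
            using gen[of "a \<otimes>\<^bsub>\<Lambda>\<^esub> b" s] t T(2) a bs A(2) by auto
        qed
      qed simp
      then show ?thesis using x by (auto simp: N_def)
    qed
    have "Module.submodule N \<Lambda> M"
      using N closed by (intro M.submoduleI_left) (auto simp: LinearCombinations.submodule_def)
    moreover have "S \<subseteq> N"
      using gen[of "\<one>\<^bsub>\<Lambda>\<^esub>"] S(2) by (auto simp: M.smult_one subset_iff)
    ultimately have "N = carrier M"
      by (rule S(3))
    then show "V.fin_dim"
      unfolding V.fin_dim_def N_def using T by auto
  next
    assume "V.fin_dim"
    then obtain A where A: "finite A" "A \<subseteq> carrier M" "V.span A = carrier M"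
      unfolding V.fin_dim_def by auto
    have "N = carrier M" if N: "Module.submodule N \<Lambda> M" "A \<subseteq> N" for N
      using V.span_is_subset[OF N(2) submodule_scalar_restriction[OF M N(1)]] A(3)
        M.submoduleD(1)[OF N(1)] by auto
    then show "fin_gen_module \<Lambda> M"
      unfolding fin_gen_module_def using M A by blast
  qed
qed

text \<open>
  Finite-dimensional algebras are noetherian.
\<close>

lemma fin_gen_submodule:
  assumes M: "fin_gen_module \<Lambda> M" and N: "Module.submodule N \<Lambda> M"
  shows "fin_gen_module \<Lambda> (M\<lparr>carrier := N\<rparr>)"
proof -
  have lm: "left_module \<Lambda> M" using M by (simp add: fin_gen_module_def)
  interpret M: left_module \<Lambda> M by fact
  interpret V: vectorspace K "scalar_restriction M" by (rule vectorspace_scalar_restriction[OF lm])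
  have "scalar_restriction (M\<lparr>carrier := N\<rparr>) = (scalar_restriction M)\<lparr>carrier := N\<rparr>"
    by (simp add: scalar_restriction_def)
  then show ?thesis
    using V.fin_dim_submodule(1)[OF _ submodule_scalar_restriction[OF lm N]] M
    by (simp add: fin_dim_iff_fin_gen lm M.left_module_submodule[OF N])
qed

section \<open>Spaces of homomorphisms\<close>

lemma hom_space_simps [simp]:
  "carrier (hom_space \<Lambda> P M) = module_hom \<Lambda> P M \<inter> extensional (carrier P)"
  "\<zero>\<^bsub>hom_space \<Lambda> P M\<^esub> = (\<lambda>x\<in>carrier P. \<zero>\<^bsub>M\<^esub>)"
  "f \<oplus>\<^bsub>hom_space \<Lambda> P M\<^esub> g = (\<lambda>x\<in>carrier P. f x \<oplus>\<^bsub>M\<^esub> g x)"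
  "k \<odot>\<^bsub>hom_space \<Lambda> P M\<^esub> f = (\<lambda>x\<in>carrier P. scalar k \<odot>\<^bsub>M\<^esub> f x)"
  by (simp_all add: hom_space_def scalar_def)

lemma restrict_module_hom:
  assumes "left_module \<Lambda> P" and "f \<in> module_hom \<Lambda> P M"
  shows "restrict f (carrier P) \<in> module_hom \<Lambda> P M \<inter> extensional (carrier P)"
proof -
  interpret P: left_module \<Lambda> P by fact
  show ?thesis
    using module_homD[OF assms(2)] by (auto intro!: module_homI simp: P.smult_closed)
qed

text \<open>
  The scalars \<open>k \<cdot> 1\<close> are central in \<open>\<Lambda>\<close>, so multiplying a homomorphism by them gives one again.
\<close>

lemma vectorspace_hom_space:
  assumes P: "left_module \<Lambda> P" and M: "left_module \<Lambda> M"
  shows "vectorspace K (hom_space \<Lambda> P M)"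
proof -
  interpret P: left_module \<Lambda> P by fact
  interpret M: left_module \<Lambda> M by fact
  let ?H = "module_hom \<Lambda> P M \<inter> extensional (carrier P)"
  note D = module_homD[where R = \<Lambda> and M = P and N = M]
  have zero: "(\<lambda>x\<in>carrier P. \<zero>\<^bsub>M\<^esub>) \<in> ?H"
    by (intro restrict_module_hom[OF P] module_homI) (auto simp: M.smult_r_null)
  have add: "(\<lambda>x\<in>carrier P. f x \<oplus>\<^bsub>M\<^esub> g x) \<in> ?H" if "f \<in> ?H" "g \<in> ?H" for f g
    using module_homD[OF IntD1[OF that(1)]] module_homD[OF IntD1[OF that(2)]]
    by (intro restrict_module_hom[OF P] module_homI)
       (simp_all add: M.smult_r_distr M.M.a_assoc M.M.a_lcomm M.M.a_comm)
  have central: "a \<odot>\<^bsub>M\<^esub> (scalar k \<odot>\<^bsub>M\<^esub> x) = scalar k \<odot>\<^bsub>M\<^esub> (a \<odot>\<^bsub>M\<^esub> x)"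
    if "a \<in> carrier \<Lambda>" "k \<in> carrier K" "x \<in> carrier M" for a k x
    using that by (simp add: M.smult_assoc[symmetric] scalar_closed scalar_mult_left scalar_mult_right)
  have smult: "(\<lambda>x\<in>carrier P. scalar k \<odot>\<^bsub>M\<^esub> f x) \<in> ?H" if "k \<in> carrier K" "f \<in> ?H" for k f
    using module_homD[OF IntD1[OF that(2)]] that(1) central
    by (intro restrict_module_hom[OF P] module_homI)
       (simp_all add: M.smult_r_distr M.smult_closed scalar_closed)
  have neg: "\<exists>g\<in>?H. (\<lambda>x\<in>carrier P. f x \<oplus>\<^bsub>M\<^esub> g x) = (\<lambda>x\<in>carrier P. \<zero>\<^bsub>M\<^esub>)" if f: "f \<in> ?H" for f
  proof -
    have "a \<odot>\<^bsub>M\<^esub> (\<ominus>\<^bsub>M\<^esub> x) = \<ominus>\<^bsub>M\<^esub> (a \<odot>\<^bsub>M\<^esub> x)" if "a \<in> carrier \<Lambda>" "x \<in> carrier M" for a x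
      using that by (simp add: M.smult_minus_one[symmetric] M.smult_assoc[symmetric] M.smult_closed
          L.l_minus L.r_minus)
    then have "(\<lambda>x\<in>carrier P. \<ominus>\<^bsub>M\<^esub> f x) \<in> ?H"
      using module_homD[OF IntD1[OF f]] by (intro restrict_module_hom[OF P] module_homI)
        (simp_all add: M.M.minus_add)
    moreover have "(\<lambda>x\<in>carrier P. f x \<oplus>\<^bsub>M\<^esub> (\<lambda>x\<in>carrier P. \<ominus>\<^bsub>M\<^esub> f x) x) = (\<lambda>x\<in>carrier P. \<zero>\<^bsub>M\<^esub>)"
      using f D(1) by (intro restrict_ext) (auto simp: M.M.r_neg)
    ultimately show ?thesis by blast
  qed
  show ?thesis
  proof (rule vs_criteria[OF field_K], goal_cases)
    case 3
    then show ?case using neg by simp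
  qed (use zero add smult D(1) in
    \<open>auto intro!: restrict_ext ext simp: extensional_def restrict_def M.M.a_assoc M.M.a_comm M.M.a_lcomm
       scalar_mult scalar_closed M.smult_assoc scalar_one M.smult_one scalar_add M.smult_l_distr M.smult_r_distr\<close>)
qed

end

lemma module_hom_preimage_submodule:
  assumes M: "left_module R M" and N: "left_module R N" and f: "f \<in> module_hom R M N"
    and S: "Module.submodule S R N"
  shows "Module.submodule {x \<in> carrier M. f x \<in> S} R M"
proof -
  interpret M: left_module R M by fact
  interpret N: left_module R N by fact
  show ?thesis
    using module_homD[OF f] module_hom_zero[OF M N f] N.submoduleD[OF S]
    by (intro M.submoduleI_left) (auto intro: M.smult_closed)
qed

lemma fin_gen_module_image:
  assumes M: "fin_gen_module \<Lambda> M" and N: "left_module \<Lambda> N" and f: "f \<in> module_hom \<Lambda> M N"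
    and surj: "f ` carrier M = carrier N"
  shows "fin_gen_module \<Lambda> N"
proof -
  obtain S where lm: "left_module \<Lambda> M" and S: "finite S" "S \<subseteq> carrier M"
    "\<And>T. Module.submodule T \<Lambda> M \<Longrightarrow> S \<subseteq> T \<Longrightarrow> T = carrier M"
    using M unfolding fin_gen_module_def by blast
  interpret N: left_module \<Lambda> N by fact
  have "T = carrier N" if T: "Module.submodule T \<Lambda> N" "f ` S \<subseteq> T" for T
  proof -
    have all: "{x \<in> carrier M. f x \<in> T} = carrier M"
      using S(2) T(2) by (intro S(3)[OF module_hom_preimage_submodule[OF lm N f T(1)]]) auto
    have "f ` carrier M \<subseteq> T"
    proof (rule image_subsetI)
      fix x assume "x \<in> carrier M"
      then have "x \<in> {x \<in> carrier M. f x \<in> T}" by (simp only: all)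
      then show "f x \<in> T" by simp
    qed
    then show ?thesis
      using N.submoduleD(1)[OF T(1)] unfolding surj by (rule equalityI[rotated])
  qed
  moreover have "f ` S \<subseteq> carrier N" "finite (f ` S)"
    using S surj by auto
  ultimately show ?thesis
    unfolding fin_gen_module_def using N by blast
qed

lemma inv_into_module_hom:
  assumes M: "left_module R M" and f: "f \<in> module_hom R M N" and bij: "bij_betw f (carrier M) (carrier N)"
  shows "inv_into (carrier M) f \<in> module_hom R N M"
proof -
  interpret M: left_module R M by fact
  let ?g = "inv_into (carrier M) f"
  have g: "?g y \<in> carrier M" "f (?g y) = y" if "y \<in> carrier N" for y
    using that bij by (auto simp: bij_betw_def inv_into_into f_inv_into_f)
  have gf: "?g (f x) = x" if "x \<in> carrier M" for x
    using that bij by (auto simp: bij_betw_def inv_into_f_f)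
  show ?thesis
  proof (rule module_homI)
    fix x y assume xy: "x \<in> carrier N" "y \<in> carrier N"
    have "?g (f (?g x \<oplus>\<^bsub>M\<^esub> ?g y)) = ?g x \<oplus>\<^bsub>M\<^esub> ?g y"
      using g xy by (intro gf) auto
    then show "?g (x \<oplus>\<^bsub>N\<^esub> y) = ?g x \<oplus>\<^bsub>M\<^esub> ?g y"
      using g xy by (simp add: module_homD(2)[OF f])
  next
    fix a x assume ax: "a \<in> carrier R" "x \<in> carrier N"
    have "?g (f (a \<odot>\<^bsub>M\<^esub> ?g x)) = a \<odot>\<^bsub>M\<^esub> ?g x"
      using g ax by (intro gf M.smult_closed) auto
    then show "?g (a \<odot>\<^bsub>N\<^esub> x) = a \<odot>\<^bsub>M\<^esub> ?g x"
      using g ax by (simp add: module_homD(3)[OF f])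
  qed (use g in auto)
qed

lemma module_hom_comp:
  assumes "f \<in> module_hom R M N" and "g \<in> module_hom R N L"
  shows "g \<circ> f \<in> module_hom R M L"
  using module_homD[OF assms(1)] module_homD[OF assms(2)]
  by (intro module_homI) auto

definition post_comp :: "('a, 'p) module \<Rightarrow> ('m \<Rightarrow> 'l) \<Rightarrow> ('p \<Rightarrow> 'm) \<Rightarrow> 'p \<Rightarrow> 'l" where
  "post_comp P g f = (\<lambda>x\<in>carrier P. g (f x))"

context fd_algebra
begin

lemma fin_gen_left_module: "fin_gen_module \<Lambda> M \<Longrightarrow> left_module \<Lambda> M"
  by (simp add: fin_gen_module_def)

text \<open>
  A homomorphism is determined by its values on generators of \<open>P\<close>.  Imposing \<open>f s = 0\<close> for one more
  generator \<open>s\<close> passes to the kernel of evaluation at \<open>s\<close>, whose target \<open>M\<close> is finite-dimensional; after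
  all generators only \<open>0\<close> is left, and finite-dimensionality is pulled back along these steps.
\<close>

lemma fin_dim_hom_space:
  assumes P: "fin_gen_module \<Lambda> P" and M: "fin_gen_module \<Lambda> M"
  shows "vectorspace.fin_dim K (hom_space \<Lambda> P M)"
proof -
  obtain S where lP: "left_module \<Lambda> P" and S: "finite S" "S \<subseteq> carrier P"
    "\<And>T. Module.submodule T \<Lambda> P \<Longrightarrow> S \<subseteq> T \<Longrightarrow> T = carrier P"
    using P unfolding fin_gen_module_def by blast
  have lM: "left_module \<Lambda> M" by (rule fin_gen_left_module[OF M])
  interpret P: left_module \<Lambda> P by fact
  interpret M: left_module \<Lambda> M by fact
  interpret V: vectorspace K "scalar_restriction M" by (rule vectorspace_scalar_restriction[OF lM])
  let ?H = "hom_space \<Lambda> P M"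
  interpret H: vectorspace K ?H by (rule vectorspace_hom_space[OF lP lM])
  have fV: "V.fin_dim" using M fin_dim_iff_fin_gen[OF lM] by simp
  define vanishing where "vanishing T = {f \<in> carrier ?H. \<forall>s\<in>T. f s = \<zero>\<^bsub>M\<^esub>}" for T
  have sub: "LinearCombinations.submodule K (vanishing T) ?H" if "T \<subseteq> carrier P" for T
  proof
    show "vanishing T \<subseteq> carrier ?H" by (auto simp: vanishing_def)
    show "f \<oplus>\<^bsub>?H\<^esub> g \<in> vanishing T" if "f \<in> vanishing T" "g \<in> vanishing T" for f g
      using that \<open>T \<subseteq> carrier P\<close> H.M.add.m_closed[of f g] by (auto simp: vanishing_def)
    show "\<zero>\<^bsub>?H\<^esub> \<in> vanishing T"
      using \<open>T \<subseteq> carrier P\<close> H.M.zero_closed by (auto simp: vanishing_def)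
    show "k \<odot>\<^bsub>?H\<^esub> f \<in> vanishing T" if "k \<in> carrier K" "f \<in> vanishing T" for k f
      using that \<open>T \<subseteq> carrier P\<close> H.smult_closed[of k f]
      by (auto simp: vanishing_def scalar_closed M.smult_r_null)
  qed
  have vs: "vectorspace K (?H\<lparr>carrier := vanishing T\<rparr>)" if "T \<subseteq> carrier P" for T
    using sub[OF that] H.vectorspace_axioms
    by (intro H.subspace_is_vs) (simp add: VectorSpace.subspace_def)
  have fin_if: "vectorspace.fin_dim K (?H\<lparr>carrier := vanishing {}\<rparr>)"
    if "finite T" "T \<subseteq> carrier P" "vectorspace.fin_dim K (?H\<lparr>carrier := vanishing T\<rparr>)" for T
    using that
  proof (induction T)
    case (insert s T)
    have T: "T \<subseteq> carrier P" and s: "s \<in> carrier P" using insert.prems by auto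
    have "(\<lambda>f. f s) \<in> module_hom K (?H\<lparr>carrier := vanishing T\<rparr>) (scalar_restriction M)"
      using s by (intro module_homI) (auto simp: vanishing_def dest: module_homD(1))
    then interpret ev: linear_map K "?H\<lparr>carrier := vanishing T\<rparr>" "scalar_restriction M" "\<lambda>f. f s"
      by (intro linear_mapI vs T V.vectorspace_axioms)
    have "ev.kerT = vanishing (insert s T)"
      unfolding ev.ker_def by (auto simp: vanishing_def)
    then have "vectorspace.fin_dim K (?H\<lparr>carrier := vanishing T\<rparr>)"
      using insert.prems(2) fV by (intro ev.fin_dim_of_kernel) auto
    then show ?case
      using insert.IH T by blast
  qed
  have vS: "vanishing S = {\<zero>\<^bsub>?H\<^esub>}"
  proof
    show "vanishing S \<subseteq> {\<zero>\<^bsub>?H\<^esub>}"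
    proof
      fix f assume f: "f \<in> vanishing S"
      then have hom: "f \<in> module_hom \<Lambda> P M" and ext: "f \<in> extensional (carrier P)"
        by (auto simp: vanishing_def)
      have all: "{x \<in> carrier P. f x = \<zero>\<^bsub>M\<^esub>} = carrier P"
        using f S(2) by (intro S(3)[OF module_hom_kernel_submodule[OF lP lM hom]]) (auto simp: vanishing_def)
      have "f x = \<zero>\<^bsub>M\<^esub>" if "x \<in> carrier P" for x
        using that by (subst (asm) all[symmetric]) simp
      then have "f = (\<lambda>x\<in>carrier P. \<zero>\<^bsub>M\<^esub>)"
        using ext by (intro extensionalityI[of _ "carrier P"]) auto
      then show "f \<in> {\<zero>\<^bsub>?H\<^esub>}"
        by simp
    qed
    show "{\<zero>\<^bsub>?H\<^esub>} \<subseteq> vanishing S"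
      using sub[OF S(2)] by (auto simp: LinearCombinations.submodule_def)
  qed
  interpret S: vectorspace K "?H\<lparr>carrier := vanishing S\<rparr>"
    by (rule vs[OF S(2)])
  have "S.fin_dim"
    unfolding S.fin_dim_def using S.span_empty by (intro exI[of _ "{}"]) (simp add: vS)
  then have "vectorspace.fin_dim K (?H\<lparr>carrier := vanishing {}\<rparr>)"
    by (rule fin_if[OF S(1,2)])
  moreover have "vanishing {} = carrier ?H"
    by (auto simp: vanishing_def)
  moreover have "?H\<lparr>carrier := carrier ?H\<rparr> = ?H"
    by simp
  ultimately show ?thesis
    by (simp only:)
qed

lemma post_comp_linear:
  assumes P: "left_module \<Lambda> P" and M: "left_module \<Lambda> M" and N: "left_module \<Lambda> N"
    and g: "g \<in> module_hom \<Lambda> M N"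
  shows "linear_map K (hom_space \<Lambda> P M) (hom_space \<Lambda> P N) (post_comp P g)"
proof (rule linear_mapI)
  interpret P: left_module \<Lambda> P by fact
  show "vectorspace K (hom_space \<Lambda> P M)" "vectorspace K (hom_space \<Lambda> P N)"
    by (rule vectorspace_hom_space[OF P M], rule vectorspace_hom_space[OF P N])
  show "post_comp P g \<in> module_hom K (hom_space \<Lambda> P M) (hom_space \<Lambda> P N)"
  proof (rule module_homI)
    fix f assume "f \<in> carrier (hom_space \<Lambda> P M)"
    then have "g \<circ> f \<in> module_hom \<Lambda> P N"
      using module_hom_comp[OF _ g] by auto
    from restrict_module_hom[OF P this] show "post_comp P g f \<in> carrier (hom_space \<Lambda> P N)"
      by (simp add: post_comp_def comp_def)
  next
    fix f h assume "f \<in> carrier (hom_space \<Lambda> P M)" "h \<in> carrier (hom_space \<Lambda> P M)"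
    then have "f x \<in> carrier M" "h x \<in> carrier M" if "x \<in> carrier P" for x
      using that by (auto dest: module_homD(1))
    then show "post_comp P g (f \<oplus>\<^bsub>hom_space \<Lambda> P M\<^esub> h) =
        post_comp P g f \<oplus>\<^bsub>hom_space \<Lambda> P N\<^esub> post_comp P g h"
      by (auto simp: post_comp_def module_homD(2)[OF g] intro!: restrict_ext)
  next
    fix k f assume "k \<in> carrier K" "f \<in> carrier (hom_space \<Lambda> P M)"
    moreover then have "f x \<in> carrier M" if "x \<in> carrier P" for x
      using that by (auto dest: module_homD(1))
    ultimately show "post_comp P g (k \<odot>\<^bsub>hom_space \<Lambda> P M\<^esub> f) =
        k \<odot>\<^bsub>hom_space \<Lambda> P N\<^esub> post_comp P g f"
      by (auto simp: post_comp_def module_homD(3)[OF g] scalar_closed intro!: restrict_ext)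
  qed
qed

text \<open>
  The sequence of spaces \<open>Hom(P, A)\<close>, \<open>Hom(P, B)\<close>, \<open>Hom(P, C)\<close> is short exact: it is exact on the
  right because \<open>P\<close> is projective and in the middle because \<open>i\<close> identifies \<open>A\<close> with the kernel of \<open>p\<close>.
  The dimensions are compared by applying rank-nullity to both maps.
\<close>

lemma dim_hom_space_exact:
  assumes P: "fin_gen_module \<Lambda> P" "projective_module \<Lambda> P"
    and mods: "A \<in> mods \<Lambda>" "B \<in> mods \<Lambda>" "C \<in> mods \<Lambda>"
    and i: "i \<in> module_hom \<Lambda> A B" "inj_on i (carrier A)"
    and p: "p \<in> module_hom \<Lambda> B C" "p ` carrier B = carrier C"
    and exact: "i ` carrier A = {b \<in> carrier B. p b = \<zero>\<^bsub>C\<^esub>}"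
  shows "vectorspace.dim K (hom_space \<Lambda> P B) =
    vectorspace.dim K (hom_space \<Lambda> P A) + vectorspace.dim K (hom_space \<Lambda> P C)"
proof -
  have fg: "fin_gen_module \<Lambda> A" "fin_gen_module \<Lambda> B" "fin_gen_module \<Lambda> C"
    using mods by (auto simp: mods_def)
  note lm = fin_gen_left_module[OF P(1)] fin_gen_left_module[OF fg(1)] fin_gen_left_module[OF fg(2)]
    fin_gen_left_module[OF fg(3)]
  interpret P: left_module \<Lambda> P by (rule lm)
  interpret A: left_module \<Lambda> A by (rule lm)
  interpret i: linear_map K "hom_space \<Lambda> P A" "hom_space \<Lambda> P B" "post_comp P i"
    by (rule post_comp_linear[OF lm(1,2,3) i(1)])
  interpret p: linear_map K "hom_space \<Lambda> P B" "hom_space \<Lambda> P C" "post_comp P p"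
    by (rule post_comp_linear[OF lm(1,3,4) p(1)])
  have inj: "inj_on (post_comp P i) (carrier (hom_space \<Lambda> P A))"
  proof (rule inj_onI)
    fix f g assume fg: "f \<in> carrier (hom_space \<Lambda> P A)" "g \<in> carrier (hom_space \<Lambda> P A)"
      "post_comp P i f = post_comp P i g"
    show "f = g"
    proof (rule extensionalityI[of _ "carrier P"])
      fix x assume x: "x \<in> carrier P"
      have "i (f x) = i (g x)"
        using fun_cong[OF fg(3), of x] x by (simp add: post_comp_def)
      then show "f x = g x"
        using i(2) fg(1,2) x by (auto simp: inj_on_def dest!: module_homD(1)[OF _ x])
    qed (use fg in auto)
  qed
  have surj: "p.imT = carrier (hom_space \<Lambda> P C)"
  proof (rule p.surj_imp_imT_carrier, intro equalityI subsetI)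
    fix f assume f: "f \<in> carrier (hom_space \<Lambda> P C)"
    then have "f \<in> module_hom \<Lambda> P C"
      by simp
    with P(2) mods(2,3) p obtain h
      where h: "h \<in> module_hom \<Lambda> P B" "\<And>x. x \<in> carrier P \<Longrightarrow> p (h x) = f x"
      unfolding projective_module_def by metis
    have "f = post_comp P p (restrict h (carrier P))"
      using f h(2) by (intro extensionalityI[of _ "carrier P"]) (auto simp: post_comp_def)
    then show "f \<in> post_comp P p ` carrier (hom_space \<Lambda> P B)"
      using restrict_module_hom[OF lm(1) h(1)] by auto
  qed (use p.T_im in blast)
  have middle: "i.imT = p.kerT"
  proof (intro equalityI subsetI)
    fix h assume "h \<in> i.imT"
    then obtain f where f: "f \<in> carrier (hom_space \<Lambda> P A)" "h = post_comp P i f"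
      by (auto simp: i.im_def)
    have "p (i (f x)) = \<zero>\<^bsub>C\<^esub>" if "x \<in> carrier P" for x
      using exact f(1) that by (auto dest: module_homD(1)[OF _ that])
    then have "post_comp P p h = (\<lambda>x\<in>carrier P. \<zero>\<^bsub>C\<^esub>)"
      unfolding f(2) by (auto simp: post_comp_def intro!: restrict_ext)
    moreover have "h \<in> carrier (hom_space \<Lambda> P B)"
      unfolding f(2) by (rule i.T_im[OF f(1)])
    ultimately show "h \<in> p.kerT"
      by (simp add: p.ker_def)
  next
    fix h assume "h \<in> p.kerT"
    then have h: "h \<in> module_hom \<Lambda> P B" "h \<in> extensional (carrier P)"
      and ph: "post_comp P p h = (\<lambda>x\<in>carrier P. \<zero>\<^bsub>C\<^esub>)"
      by (auto simp: p.ker_def)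
    have hi: "h x \<in> i ` carrier A" if x: "x \<in> carrier P" for x
      using exact module_homD(1)[OF h(1) x] fun_cong[OF ph, of x] x by (simp add: post_comp_def)
    define f where "f x = inv_into (carrier A) i (h x)" for x
    have f: "f x \<in> carrier A" "i (f x) = h x" if "x \<in> carrier P" for x
      using hi[OF that] by (auto simp: f_def inv_into_into f_inv_into_f)
    have eqI: "a = b" if "a \<in> carrier A" "b \<in> carrier A" "i a = i b" for a b
      using i(2) that by (auto simp: inj_on_def)
    have "f \<in> module_hom \<Lambda> P A"
    proof (rule module_homI)
      fix x y assume "x \<in> carrier P" "y \<in> carrier P"
      then show "f (x \<oplus>\<^bsub>P\<^esub> y) = f x \<oplus>\<^bsub>A\<^esub> f y"
        using f by - (rule eqI, simp_all add: module_homD(2)[OF i(1)] module_homD(2)[OF h(1)])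
    next
      fix a x assume "a \<in> carrier \<Lambda>" "x \<in> carrier P"
      then show "f (a \<odot>\<^bsub>P\<^esub> x) = a \<odot>\<^bsub>A\<^esub> f x"
        using f by - (rule eqI,
          simp_all add: module_homD(3)[OF i(1)] module_homD(3)[OF h(1)] P.smult_closed A.smult_closed)
    qed (use f in auto)
    moreover have "h = post_comp P i (restrict f (carrier P))"
      using h(2) f(2) by (intro extensionalityI[of _ "carrier P"]) (auto simp: post_comp_def)
    ultimately show "h \<in> i.imT"
      using restrict_module_hom[OF lm(1)] by (auto simp: i.im_def)
  qed
  have "vectorspace.dim K ((hom_space \<Lambda> P B)\<lparr>carrier := i.imT\<rparr>) = vectorspace.dim K (hom_space \<Lambda> P A)"
    using i.rank_nullity[OF fin_dim_hom_space[OF P(1) fg(1)]] i.inj_imp_dim_ker0[OF inj] by simp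
  moreover have "(hom_space \<Lambda> P C)\<lparr>carrier := carrier (hom_space \<Lambda> P C)\<rparr> = hom_space \<Lambda> P C"
    by simp
  ultimately show ?thesis
    using p.rank_nullity[OF fin_dim_hom_space[OF P(1) fg(2)]] by (simp only: surj middle)
qed

lemma dim_hom_space_submodule:
  assumes P: "fin_gen_module \<Lambda> P" and M: "fin_gen_module \<Lambda> M" and N: "Module.submodule N \<Lambda> M"
  shows "vectorspace.dim K (hom_space \<Lambda> P (M\<lparr>carrier := N\<rparr>)) \<le> vectorspace.dim K (hom_space \<Lambda> P M)"
proof -
  note lP = fin_gen_left_module[OF P] and lM = fin_gen_left_module[OF M]
  interpret M: left_module \<Lambda> M by (rule lM)
  interpret H: vectorspace K "hom_space \<Lambda> P M" by (rule vectorspace_hom_space[OF lP lM])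
  let ?HN = "hom_space \<Lambda> P (M\<lparr>carrier := N\<rparr>)"
  interpret HN: vectorspace K ?HN
    by (rule vectorspace_hom_space[OF lP M.left_module_submodule[OF N]])
  have eq: "?HN = (hom_space \<Lambda> P M)\<lparr>carrier := carrier ?HN\<rparr>"
    by (simp add: hom_space_def)
  have "carrier ?HN \<subseteq> carrier (hom_space \<Lambda> P M)"
    using M.submoduleD(1)[OF N] by (auto simp: module_hom_def)
  then have "LinearCombinations.submodule K (carrier ?HN) (hom_space \<Lambda> P M)"
    using H.module_axioms HN.M.add.m_closed HN.M.zero_closed HN.smult_closed
    unfolding LinearCombinations.submodule_def by (subst (asm) (1 2 3 4 5) eq) auto
  from H.fin_dim_submodule(2)[OF fin_dim_hom_space[OF P M] this] show ?thesis
    by (subst eq)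
qed

lemma dim_hom_space_pos:
  assumes P: "fin_gen_module \<Lambda> P" and M: "fin_gen_module \<Lambda> M"
    and f: "f \<in> module_hom \<Lambda> P M" and x: "x \<in> carrier P" "f x \<noteq> \<zero>\<^bsub>M\<^esub>"
  shows "vectorspace.dim K (hom_space \<Lambda> P M) > 0"
proof (rule ccontr)
  note lP = fin_gen_left_module[OF P] and lM = fin_gen_left_module[OF M]
  interpret H: vectorspace K "hom_space \<Lambda> P M" by (rule vectorspace_hom_space[OF lP lM])
  assume "\<not> H.dim > 0"
  moreover obtain b where b: "finite b" "H.basis b"
    using H.finite_basis_exists[OF fin_dim_hom_space[OF P M]] by blast
  ultimately have "b = {}"
    using H.dim_basis[OF b] by simp
  then have "carrier (hom_space \<Lambda> P M) = {\<zero>\<^bsub>hom_space \<Lambda> P M\<^esub>}"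
    using b(2) H.span_empty unfolding H.basis_def by simp
  then have "restrict f (carrier P) = (\<lambda>x\<in>carrier P. \<zero>\<^bsub>M\<^esub>)"
    using restrict_module_hom[OF lP f] by simp
  then show False
    using x by (metis restrict_apply')
qed

end

section \<open>Direct sums within the category of modules\<close>

text \<open>
  Modules in \<open>mods \<Lambda>\<close> have lists as elements.  A module with other elements is brought into this form
  along an injection of its carrier into the lists.
\<close>

definition transport_module :: "('b \<Rightarrow> 'c) \<Rightarrow> ('a, 'b) module \<Rightarrow> ('a, 'c) module" where
  "transport_module \<phi> M =
     \<lparr>carrier = \<phi> ` carrier M, mult = undefined, one = undefined, zero = \<phi> \<zero>\<^bsub>M\<^esub>,
      add = (\<lambda>x y. \<phi> (inv_into (carrier M) \<phi> x \<oplus>\<^bsub>M\<^esub> inv_into (carrier M) \<phi> y)),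
      smult = (\<lambda>a x. \<phi> (a \<odot>\<^bsub>M\<^esub> inv_into (carrier M) \<phi> x))\<rparr>"

lemma transport_module:
  fixes M :: "('a, 'b) module" and R :: "('a, 'r) ring_scheme"
  assumes M: "left_module R M" and inj: "inj_on \<phi> (carrier M)"
  shows "left_module R (transport_module \<phi> M)"
    and "\<phi> \<in> module_hom R M (transport_module \<phi> M)"
    and "bij_betw \<phi> (carrier M) (carrier (transport_module \<phi> M))"
proof -
  interpret M: left_module R M by fact
  let ?T = "transport_module \<phi> M"
  have car: "carrier ?T = \<phi> ` carrier M" and zero: "\<zero>\<^bsub>?T\<^esub> = \<phi> \<zero>\<^bsub>M\<^esub>"
    by (simp_all add: transport_module_def)
  have add: "\<phi> x \<oplus>\<^bsub>?T\<^esub> \<phi> y = \<phi> (x \<oplus>\<^bsub>M\<^esub> y)" if "x \<in> carrier M" "y \<in> carrier M" for x y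
    using that inj by (simp add: transport_module_def inv_into_f_f)
  have smult: "a \<odot>\<^bsub>?T\<^esub> \<phi> x = \<phi> (a \<odot>\<^bsub>M\<^esub> x)" if "x \<in> carrier M" for a x
    using that inj by (simp add: transport_module_def inv_into_f_f)
  have "abelian_group ?T"
  proof (rule abelian_groupI)
    fix x assume "x \<in> carrier ?T"
    then obtain y where y: "y \<in> carrier M" "x = \<phi> y" by (auto simp: car)
    then show "\<exists>z\<in>carrier ?T. z \<oplus>\<^bsub>?T\<^esub> x = \<zero>\<^bsub>?T\<^esub>"
      by (intro bexI[of _ "\<phi> (\<ominus>\<^bsub>M\<^esub> y)"]) (auto simp: car zero add M.M.l_neg)
  qed (auto simp: car zero add M.M.a_assoc M.M.a_comm M.M.a_lcomm)
  then show "left_module R ?T"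
    by (rule left_moduleI[OF M.R.ring_axioms])
       (auto simp: car add smult M.smult_closed M.smult_l_distr M.smult_r_distr M.smult_assoc M.smult_one)
  show "\<phi> \<in> module_hom R M ?T"
    by (rule module_homI) (auto simp: car add smult)
  show "bij_betw \<phi> (carrier M) (carrier ?T)"
    using inj by (simp add: bij_betw_def car)
qed

lemma left_module_direct_sum:
  assumes "left_module \<Lambda> M" and "left_module \<Lambda> N"
  shows "left_module \<Lambda> (direct_sum M N)"
proof -
  interpret M: left_module \<Lambda> M by fact
  interpret N: left_module \<Lambda> N by fact
  have "abelian_group (direct_sum M N)"
  proof (rule abelian_groupI)
    fix x assume "x \<in> carrier (direct_sum M N)"
    then show "\<exists>y\<in>carrier (direct_sum M N). y \<oplus>\<^bsub>direct_sum M N\<^esub> x = \<zero>\<^bsub>direct_sum M N\<^esub>"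
      by (intro bexI[of _ "(\<ominus>\<^bsub>M\<^esub> fst x, \<ominus>\<^bsub>N\<^esub> snd x)"])
         (auto simp: direct_sum_def M.M.l_neg N.M.l_neg)
  qed (auto simp: direct_sum_def M.M.a_assoc N.M.a_assoc M.M.a_comm N.M.a_comm
      M.M.a_lcomm N.M.a_lcomm)
  then show ?thesis
    by (rule left_moduleI[OF M.R.ring_axioms])
       (auto simp: direct_sum_def M.smult_closed N.smult_closed M.smult_l_distr N.smult_l_distr
          M.smult_r_distr N.smult_r_distr M.smult_assoc N.smult_assoc M.smult_one N.smult_one)
qed

lemma fin_gen_direct_sum:
  assumes M: "fin_gen_module \<Lambda> M" and N: "fin_gen_module \<Lambda> N"
  shows "fin_gen_module \<Lambda> (direct_sum M N)"
proof -
  have lM: "left_module \<Lambda> M" and lN: "left_module \<Lambda> N"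
    using M N by (auto simp: fin_gen_module_def)
  interpret M: left_module \<Lambda> M by fact
  interpret N: left_module \<Lambda> N by fact
  let ?D = "direct_sum M N"
  have lD: "left_module \<Lambda> ?D" by (rule left_module_direct_sum[OF lM lN])
  interpret D: left_module \<Lambda> ?D by fact
  obtain S where S: "finite S" "S \<subseteq> carrier M"
    "\<And>T. Module.submodule T \<Lambda> M \<Longrightarrow> S \<subseteq> T \<Longrightarrow> T = carrier M"
    using M unfolding fin_gen_module_def by blast
  obtain S' where S': "finite S'" "S' \<subseteq> carrier N"
    "\<And>T. Module.submodule T \<Lambda> N \<Longrightarrow> S' \<subseteq> T \<Longrightarrow> T = carrier N"
    using N unfolding fin_gen_module_def by blast
  define G where "G = (\<lambda>x. (x, \<zero>\<^bsub>N\<^esub>)) ` S \<union> (\<lambda>y. (\<zero>\<^bsub>M\<^esub>, y)) ` S'"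
  have i1: "(\<lambda>x. (x, \<zero>\<^bsub>N\<^esub>)) \<in> module_hom \<Lambda> M ?D"
    by (rule module_homI) (auto simp: direct_sum_def N.smult_r_null)
  have i2: "(\<lambda>y. (\<zero>\<^bsub>M\<^esub>, y)) \<in> module_hom \<Lambda> N ?D"
    by (rule module_homI) (auto simp: direct_sum_def M.smult_r_null)
  have "T = carrier ?D" if T: "Module.submodule T \<Lambda> ?D" "G \<subseteq> T" for T
  proof
    show "T \<subseteq> carrier ?D" by (rule D.submoduleD(1)[OF T(1)])
    have 1: "{x \<in> carrier M. (x, \<zero>\<^bsub>N\<^esub>) \<in> T} = carrier M"
      using S(2) T(2)
      by (intro S(3)[OF module_hom_preimage_submodule[OF lM lD i1 T(1)]]) (auto simp: G_def)
    have 2: "{y \<in> carrier N. (\<zero>\<^bsub>M\<^esub>, y) \<in> T} = carrier N"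
      using S'(2) T(2)
      by (intro S'(3)[OF module_hom_preimage_submodule[OF lN lD i2 T(1)]]) (auto simp: G_def)
    show "carrier ?D \<subseteq> T"
    proof
      fix z assume "z \<in> carrier ?D"
      then obtain x y where z: "z = (x, y)" "x \<in> carrier M" "y \<in> carrier N"
        by (auto simp: direct_sum_def)
      have "(x, \<zero>\<^bsub>N\<^esub>) \<in> T" using z(2) by (subst (asm) 1[symmetric]) simp
      moreover have "(\<zero>\<^bsub>M\<^esub>, y) \<in> T" using z(3) by (subst (asm) 2[symmetric]) simp
      ultimately have "(x, \<zero>\<^bsub>N\<^esub>) \<oplus>\<^bsub>?D\<^esub> (\<zero>\<^bsub>M\<^esub>, y) \<in> T"
        by (rule D.submoduleD(3)[OF T(1)])
      then show "z \<in> T"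
        using z by (simp add: direct_sum_def)
    qed
  qed
  moreover have "finite G" "G \<subseteq> carrier ?D"
    using S S' by (auto simp: G_def direct_sum_def)
  ultimately show ?thesis
    unfolding fin_gen_module_def using lD by blast
qed

text \<open>
  Lists over any type form an infinite set.
\<close>

lemma inj_pairs_to_lists: "\<exists>\<phi> :: 'a list \<times> 'a list \<Rightarrow> 'a list. inj \<phi>"
proof -
  have "infinite (UNIV :: 'a list set)" by (rule infinite_UNIV_listI)
  then obtain \<phi> :: "'a list \<times> 'a list \<Rightarrow> 'a list" where "bij_betw \<phi> (UNIV \<times> UNIV) UNIV"
    using card_of_Times_same_infinite card_of_ordIso by blast
  then show ?thesis
    by (auto simp: bij_betw_def)
qed

lemma mods_direct_sum:
  assumes M: "M \<in> mods \<Lambda>" and N: "N \<in> mods \<Lambda>"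
  obtains Z i p j q where "Z \<in> mods \<Lambda>"
    and "i \<in> module_hom \<Lambda> M Z" "inj_on i (carrier M)" "p \<in> module_hom \<Lambda> Z N"
    and "p ` carrier Z = carrier N" "i ` carrier M = {z \<in> carrier Z. p z = \<zero>\<^bsub>N\<^esub>}"
    and "j \<in> module_hom \<Lambda> N Z" "inj_on j (carrier N)" "q \<in> module_hom \<Lambda> Z M"
    and "q ` carrier Z = carrier M" "j ` carrier N = {z \<in> carrier Z. q z = \<zero>\<^bsub>M\<^esub>}"
proof -
  have fgM: "fin_gen_module \<Lambda> M" and fgN: "fin_gen_module \<Lambda> N"
    using M N by (auto simp: mods_def)
  then have lM: "left_module \<Lambda> M" and lN: "left_module \<Lambda> N"
    by (auto simp: fin_gen_module_def)
  interpret M: left_module \<Lambda> M by fact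
  interpret N: left_module \<Lambda> N by fact
  let ?D = "direct_sum M N"
  have carD: "carrier ?D = carrier M \<times> carrier N" by (simp add: direct_sum_def)
  have lD: "left_module \<Lambda> ?D" by (rule left_module_direct_sum[OF lM lN])
  obtain \<phi> :: "'a list \<times> 'a list \<Rightarrow> 'a list" where "inj \<phi>"
    using inj_pairs_to_lists by blast
  then have inj: "inj_on \<phi> (carrier ?D)" by (rule inj_on_subset) simp
  define Z where "Z = transport_module \<phi> ?D"
  note T = transport_module[OF lD inj, folded Z_def]
  define \<psi> where "\<psi> = inv_into (carrier ?D) \<phi>"
  have \<psi>: "\<psi> \<in> module_hom \<Lambda> Z ?D"
    unfolding \<psi>_def by (rule inv_into_module_hom[OF lD T(2,3)])
  have carZ: "carrier Z = \<phi> ` (carrier M \<times> carrier N)"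
    using T(3) by (simp add: bij_betw_def carD)
  have \<psi>\<phi>: "\<psi> (\<phi> z) = z" if "z \<in> carrier M \<times> carrier N" for z
    using that inj by (simp add: \<psi>_def inv_into_f_f carD)
  have "(\<lambda>x. (x, \<zero>\<^bsub>N\<^esub>)) \<in> module_hom \<Lambda> M ?D"
    by (rule module_homI) (auto simp: direct_sum_def N.smult_r_null)
  from module_hom_comp[OF this T(2)]
  have i: "(\<lambda>x. \<phi> (x, \<zero>\<^bsub>N\<^esub>)) \<in> module_hom \<Lambda> M Z" by (simp add: comp_def)
  have "(\<lambda>y. (\<zero>\<^bsub>M\<^esub>, y)) \<in> module_hom \<Lambda> N ?D"
    by (rule module_homI) (auto simp: direct_sum_def M.smult_r_null)
  from module_hom_comp[OF this T(2)]
  have j: "(\<lambda>y. \<phi> (\<zero>\<^bsub>M\<^esub>, y)) \<in> module_hom \<Lambda> N Z" by (simp add: comp_def)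
  have "fst \<in> module_hom \<Lambda> ?D M" "snd \<in> module_hom \<Lambda> ?D N"
    by (rule module_homI; auto simp: direct_sum_def)+
  then have q: "fst \<circ> \<psi> \<in> module_hom \<Lambda> Z M" and p: "snd \<circ> \<psi> \<in> module_hom \<Lambda> Z N"
    using module_hom_comp[OF \<psi>] by auto
  have "fin_gen_module \<Lambda> Z"
    using T(3) by (intro fin_gen_module_image[OF fin_gen_direct_sum[OF fgM fgN] T(1,2)])
      (simp add: bij_betw_def)
  then have Z: "Z \<in> mods \<Lambda>" by (simp add: mods_def)
  show ?thesis
  proof (rule that[OF Z i _ p _ _ j _ q])
    show "inj_on (\<lambda>x. \<phi> (x, \<zero>\<^bsub>N\<^esub>)) (carrier M)" "inj_on (\<lambda>y. \<phi> (\<zero>\<^bsub>M\<^esub>, y)) (carrier N)"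
      by (simp_all add: inj_on_def inj_eq[OF \<open>inj \<phi>\<close>])
    have "(snd \<circ> \<psi>) ` carrier Z = snd ` (carrier M \<times> carrier N)"
      "(fst \<circ> \<psi>) ` carrier Z = fst ` (carrier M \<times> carrier N)"
      unfolding carZ image_image by (rule image_cong; simp add: \<psi>\<phi>)+
    then show "(snd \<circ> \<psi>) ` carrier Z = carrier N" "(fst \<circ> \<psi>) ` carrier Z = carrier M"
      using M.M.zero_closed N.M.zero_closed by (auto simp only: fst_image_times snd_image_times split: if_splits)
    show "(\<lambda>x. \<phi> (x, \<zero>\<^bsub>N\<^esub>)) ` carrier M = {z \<in> carrier Z. (snd \<circ> \<psi>) z = \<zero>\<^bsub>N\<^esub>}"
      "(\<lambda>y. \<phi> (\<zero>\<^bsub>M\<^esub>, y)) ` carrier N = {z \<in> carrier Z. (fst \<circ> \<psi>) z = \<zero>\<^bsub>M\<^esub>}"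
      by (auto simp: carZ \<psi>\<phi>)
  qed
qed

section \<open>Indecomposable projectives detect nonzero modules\<close>

context fd_algebra
begin

lemma mem_left_ideal:
  assumes e: "e \<in> idempotents \<Lambda>"
  shows "x \<in> carrier (left_ideal_module \<Lambda> e) \<longleftrightarrow> x \<in> carrier \<Lambda> \<and> x \<otimes>\<^bsub>\<Lambda>\<^esub> e = x"
proof -
  have ec: "e \<in> carrier \<Lambda>" "e \<otimes>\<^bsub>\<Lambda>\<^esub> e = e"
    using e by (auto simp: idempotents_def)
  have "y \<otimes>\<^bsub>\<Lambda>\<^esub> e \<otimes>\<^bsub>\<Lambda>\<^esub> e = y \<otimes>\<^bsub>\<Lambda>\<^esub> e" if "y \<in> carrier \<Lambda>" for y
    using that ec by (simp add: L.m_assoc)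
  then show ?thesis
    using ec by (auto simp: left_ideal_module_def) (metis image_eqI)
qed

lemma left_ideal_simps [simp]:
  "\<zero>\<^bsub>left_ideal_module \<Lambda> e\<^esub> = \<zero>\<^bsub>\<Lambda>\<^esub>"
  "x \<oplus>\<^bsub>left_ideal_module \<Lambda> e\<^esub> y = x \<oplus>\<^bsub>\<Lambda>\<^esub> y"
  "x \<odot>\<^bsub>left_ideal_module \<Lambda> e\<^esub> y = x \<otimes>\<^bsub>\<Lambda>\<^esub> y"
  by (simp_all add: left_ideal_module_def)

lemma left_module_left_ideal:
  assumes e: "e \<in> idempotents \<Lambda>"
  shows "left_module \<Lambda> (left_ideal_module \<Lambda> e)"
proof -
  have ec: "e \<in> carrier \<Lambda>" "e \<otimes>\<^bsub>\<Lambda>\<^esub> e = e"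
    using e by (auto simp: idempotents_def)
  note mem = mem_left_ideal[OF e]
  have "abelian_group (left_ideal_module \<Lambda> e)"
  proof (rule abelian_groupI)
    fix x assume "x \<in> carrier (left_ideal_module \<Lambda> e)"
    then show "\<exists>y\<in>carrier (left_ideal_module \<Lambda> e).
        y \<oplus>\<^bsub>left_ideal_module \<Lambda> e\<^esub> x = \<zero>\<^bsub>left_ideal_module \<Lambda> e\<^esub>"
      using ec by (intro bexI[of _ "\<ominus>\<^bsub>\<Lambda>\<^esub> x"]) (auto simp: mem VS.M.l_neg L.l_minus)
  qed (use ec in \<open>auto simp: mem L.l_distr VS.M.a_assoc VS.M.a_comm VS.M.a_lcomm\<close>)
  then show ?thesis
    using ec by (intro left_moduleI[OF ring_algebra])
      (auto simp: mem L.m_assoc L.l_distr L.r_distr)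
qed

text \<open>
  The ideal \<open>\<Lambda>e\<close> has elements of the type of \<open>\<Lambda>\<close>, whereas projectivity and indecomposability are needed
  for a copy of it in \<open>mods \<Lambda>\<close>.  They are therefore proved for any module \<open>Q\<close> isomorphic to \<open>\<Lambda>e\<close>.
\<close>

lemma left_ideal_iso_fin_gen:
  assumes e: "e \<in> idempotents \<Lambda>" and Q: "left_module \<Lambda> Q"
    and \<phi>: "\<phi> \<in> module_hom \<Lambda> (left_ideal_module \<Lambda> e) Q"
      "bij_betw \<phi> (carrier (left_ideal_module \<Lambda> e)) (carrier Q)"
  shows "fin_gen_module \<Lambda> Q"
proof -
  have ec: "e \<in> carrier \<Lambda>" "e \<otimes>\<^bsub>\<Lambda>\<^esub> e = e"
    using e by (auto simp: idempotents_def)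
  note mem = mem_left_ideal[OF e]
  interpret I: left_module \<Lambda> "left_ideal_module \<Lambda> e" by (rule left_module_left_ideal[OF e])
  have "T = carrier (left_ideal_module \<Lambda> e)"
    if T: "Module.submodule T \<Lambda> (left_ideal_module \<Lambda> e)" "{e} \<subseteq> T" for T
  proof
    show "T \<subseteq> carrier (left_ideal_module \<Lambda> e)" by (rule I.submoduleD(1)[OF T(1)])
    show "carrier (left_ideal_module \<Lambda> e) \<subseteq> T"
    proof
      fix x assume "x \<in> carrier (left_ideal_module \<Lambda> e)"
      then have "x \<in> carrier \<Lambda>" "x = x \<otimes>\<^bsub>\<Lambda>\<^esub> e"
        by (auto simp: mem)
      then show "x \<in> T"
        using I.submoduleD(4)[OF T(1), of x e] T(2) by auto
    qed
  qed
  then have "fin_gen_module \<Lambda> (left_ideal_module \<Lambda> e)"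
    unfolding fin_gen_module_def using I.left_module_axioms ec
    by (intro conjI exI[of _ "{e}"]) (auto simp: mem)
  then show ?thesis
    using \<phi> by (intro fin_gen_module_image[OF _ Q]) (auto simp: bij_betw_def)
qed

text \<open>
  A homomorphism out of \<open>\<Lambda>e\<close> is right multiplication by the image of \<open>e\<close>, and multiplication by any
  preimage \<open>m\<close> of this image lifts it.
\<close>

lemma left_ideal_iso_projective:
  assumes e: "e \<in> idempotents \<Lambda>" and Q: "left_module \<Lambda> Q"
    and \<phi>: "\<phi> \<in> module_hom \<Lambda> (left_ideal_module \<Lambda> e) Q"
      "bij_betw \<phi> (carrier (left_ideal_module \<Lambda> e)) (carrier Q)"
  shows "projective_module \<Lambda> Q"
  unfolding projective_module_def
proof (intro ballI impI)
  fix M N g f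
  assume MN: "M \<in> mods \<Lambda>" "N \<in> mods \<Lambda>" and g: "g \<in> module_hom \<Lambda> M N"
    and f: "f \<in> module_hom \<Lambda> Q N" and surj: "g ` carrier M = carrier N"
  let ?I = "left_ideal_module \<Lambda> e"
  have ec: "e \<in> carrier \<Lambda>" "e \<otimes>\<^bsub>\<Lambda>\<^esub> e = e" "e \<in> carrier ?I"
    using e by (auto simp: idempotents_def mem_left_ideal)
  note mem = mem_left_ideal[OF e]
  interpret M: left_module \<Lambda> M using MN by (simp add: mods_def fin_gen_module_def)
  have lI: "left_module \<Lambda> ?I" by (rule left_module_left_ideal[OF e])
  define \<psi> where "\<psi> = inv_into (carrier ?I) \<phi>"
  have \<psi>: "\<psi> \<in> module_hom \<Lambda> Q ?I"
    unfolding \<psi>_def by (rule inv_into_module_hom[OF lI \<phi>])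
  have \<phi>\<psi>: "\<phi> (\<psi> x) = x" if "x \<in> carrier Q" for x
    using that \<phi>(2) by (auto simp: \<psi>_def bij_betw_def f_inv_into_f)
  have "f (\<phi> e) \<in> g ` carrier M"
    using surj module_homD(1)[OF f] module_homD(1)[OF \<phi>(1) ec(3)] by simp
  then obtain m where m: "m \<in> carrier M" "g m = f (\<phi> e)" by auto
  have "(\<lambda>y. y \<odot>\<^bsub>M\<^esub> m) \<in> module_hom \<Lambda> ?I M"
    using m(1) by (intro module_homI) (auto simp: mem M.smult_closed M.smult_l_distr M.smult_assoc)
  then have "(\<lambda>y. y \<odot>\<^bsub>M\<^esub> m) \<circ> \<psi> \<in> module_hom \<Lambda> Q M"
    by (rule module_hom_comp[OF \<psi>])
  moreover have "g (((\<lambda>y. y \<odot>\<^bsub>M\<^esub> m) \<circ> \<psi>) x) = f x" if x: "x \<in> carrier Q" for x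
  proof -
    have y: "\<psi> x \<in> carrier \<Lambda>" "\<psi> x \<otimes>\<^bsub>\<Lambda>\<^esub> e = \<psi> x"
      using module_homD(1)[OF \<psi> x] by (auto simp: mem)
    have "g (\<psi> x \<odot>\<^bsub>M\<^esub> m) = \<psi> x \<odot>\<^bsub>N\<^esub> f (\<phi> e)"
      using m y by (simp add: module_homD(3)[OF g])
    also have "\<dots> = f (\<psi> x \<odot>\<^bsub>Q\<^esub> \<phi> e)"
      using y ec module_homD(1)[OF \<phi>(1)] by (simp add: module_homD(3)[OF f])
    also have "\<psi> x \<odot>\<^bsub>Q\<^esub> \<phi> e = \<phi> (\<psi> x)"
      using module_homD(3)[OF \<phi>(1) y(1) ec(3)] y by simp
    finally show ?thesis using \<phi>\<psi>[OF x] by simp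
  qed
  ultimately show "\<exists>h\<in>module_hom \<Lambda> Q M. \<forall>x\<in>carrier Q. g (h x) = f x"
    by blast
qed

text \<open>
  A decomposition of \<open>\<Lambda>e\<close> splits \<open>e\<close> as \<open>f + g\<close>.  From \<open>f = fe = ff + fg\<close> the element \<open>fg = f - ff\<close> lies in
  both summands, so it vanishes; thus \<open>f\<close> and \<open>g\<close> are orthogonal idempotents, and one of them is zero
  because \<open>e\<close> is primitive.
\<close>

lemma left_ideal_iso_indecomposable:
  assumes e: "primitive_idempotent \<Lambda> e" and Q: "left_module \<Lambda> Q"
    and \<phi>: "\<phi> \<in> module_hom \<Lambda> (left_ideal_module \<Lambda> e) Q"
      "bij_betw \<phi> (carrier (left_ideal_module \<Lambda> e)) (carrier Q)"
  shows "indecomposable_module \<Lambda> Q"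
proof -
  let ?I = "left_ideal_module \<Lambda> e"
  have id: "e \<in> idempotents \<Lambda>" using e by (simp add: primitive_idempotent_def)
  have ec: "e \<in> carrier \<Lambda>" "e \<otimes>\<^bsub>\<Lambda>\<^esub> e = e" "e \<in> carrier ?I" "e \<noteq> \<zero>\<^bsub>\<Lambda>\<^esub>"
    using id e by (auto simp: idempotents_def mem_left_ideal primitive_idempotent_def)
  note mem = mem_left_ideal[OF id]
  have lI: "left_module \<Lambda> ?I" by (rule left_module_left_ideal[OF id])
  interpret I: left_module \<Lambda> ?I by fact
  interpret Q: left_module \<Lambda> Q by fact
  have \<phi>0: "\<phi> \<zero>\<^bsub>\<Lambda>\<^esub> = \<zero>\<^bsub>Q\<^esub>"
    using module_hom_zero[OF lI Q \<phi>(1)] by simp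
  have \<phi>_eq: "x = y" if "x \<in> carrier ?I" "y \<in> carrier ?I" "\<phi> x = \<phi> y" for x y
    using \<phi>(2) that by (auto simp: bij_betw_def inj_on_def)
  have z: "\<zero>\<^bsub>\<Lambda>\<^esub> \<in> carrier ?I" using ec by (simp add: mem)
  have full: "S = carrier Q" if S: "Module.submodule S \<Lambda> Q" "\<phi> e \<in> S" for S
  proof
    show "S \<subseteq> carrier Q" by (rule Q.submoduleD(1)[OF S(1)])
    show "carrier Q \<subseteq> S"
    proof
      fix q assume "q \<in> carrier Q"
      then obtain y where y: "y \<in> carrier ?I" "q = \<phi> y"
        using \<phi>(2) by (auto simp: bij_betw_def)
      then have yy: "y \<in> carrier \<Lambda>" "y \<otimes>\<^bsub>\<Lambda>\<^esub> e = y"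
        by (auto simp: mem)
      then have "q = y \<odot>\<^bsub>Q\<^esub> \<phi> e"
        using module_homD(3)[OF \<phi>(1) yy(1) ec(3)] y by simp
      then show "q \<in> S"
        using Q.submoduleD(4)[OF S(1) yy(1) S(2)] by simp
    qed
  qed
  have "\<phi> e \<noteq> \<zero>\<^bsub>Q\<^esub>"
    using \<phi>_eq[OF ec(3) z] \<phi>0 ec(4) by auto
  then have "nonzero_module Q"
    using module_homD(1)[OF \<phi>(1) ec(3)] by (auto simp: nonzero_module_def)
  moreover have "N = {\<zero>\<^bsub>Q\<^esub>} \<or> N' = {\<zero>\<^bsub>Q\<^esub>}"
    if N: "Module.submodule N \<Lambda> Q" "Module.submodule N' \<Lambda> Q"
      and int: "N \<inter> N' = {\<zero>\<^bsub>Q\<^esub>}" and sum: "N <+>\<^bsub>Q\<^esub> N' = carrier Q" for N N'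
  proof -
    have "\<phi> e \<in> N <+>\<^bsub>Q\<^esub> N'"
      using sum module_homD(1)[OF \<phi>(1) ec(3)] by simp
    then obtain s t where st: "s \<in> N" "t \<in> N'" "\<phi> e = s \<oplus>\<^bsub>Q\<^esub> t"
      by (auto simp: set_add_def set_mult_def)
    then have "s \<in> carrier Q" "t \<in> carrier Q"
      using Q.submoduleD(1)[OF N(1)] Q.submoduleD(1)[OF N(2)] by auto
    then obtain f g where fg: "f \<in> carrier ?I" "g \<in> carrier ?I" "s = \<phi> f" "t = \<phi> g"
      by (metis bij_betw_imp_surj_on[OF \<phi>(2)] imageE)
    then have fc: "f \<in> carrier \<Lambda>" "g \<in> carrier \<Lambda>" "f \<otimes>\<^bsub>\<Lambda>\<^esub> e = f" "g \<otimes>\<^bsub>\<Lambda>\<^esub> e = g"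
      by (auto simp: mem)
    have efg: "e = f \<oplus>\<^bsub>\<Lambda>\<^esub> g"
    proof (rule \<phi>_eq)
      show "f \<oplus>\<^bsub>\<Lambda>\<^esub> g \<in> carrier ?I"
        using I.M.a_closed[OF fg(1,2)] by simp
      show "\<phi> e = \<phi> (f \<oplus>\<^bsub>\<Lambda>\<^esub> g)"
        using module_homD(2)[OF \<phi>(1) fg(1,2)] st(3) fg by simp
    qed (rule ec)
    have \<phi>_mult: "\<phi> (a \<otimes>\<^bsub>\<Lambda>\<^esub> x) = a \<odot>\<^bsub>Q\<^esub> \<phi> x" if "a \<in> carrier \<Lambda>" "x \<in> carrier ?I" for a x
      using module_homD(3)[OF \<phi>(1) that] by simp
    have I_mult: "a \<otimes>\<^bsub>\<Lambda>\<^esub> x \<in> carrier ?I" if "a \<in> carrier \<Lambda>" "x \<in> carrier ?I" for a x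
      using I.smult_closed[OF that] by simp
    \<comment> \<open>Used for \<open>(f, g)\<close> and for \<open>(g, f)\<close>, as orthogonality is needed on both sides.\<close>
    have cross: "x \<otimes>\<^bsub>\<Lambda>\<^esub> y = \<zero>\<^bsub>\<Lambda>\<^esub> \<and> x \<otimes>\<^bsub>\<Lambda>\<^esub> x = x"
      if x: "x \<in> carrier ?I" "\<phi> x \<in> S" and y: "y \<in> carrier ?I" "\<phi> y \<in> S'" and e: "e = x \<oplus>\<^bsub>\<Lambda>\<^esub> y"
        and S: "Module.submodule S \<Lambda> Q" "Module.submodule S' \<Lambda> Q" "S \<inter> S' = {\<zero>\<^bsub>Q\<^esub>}" for x y S S'
    proof -
      have xc: "x \<in> carrier \<Lambda>" "y \<in> carrier \<Lambda>" "x \<otimes>\<^bsub>\<Lambda>\<^esub> e = x"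
        using x y by (auto simp: mem)
      have xe: "x = x \<otimes>\<^bsub>\<Lambda>\<^esub> x \<oplus>\<^bsub>\<Lambda>\<^esub> x \<otimes>\<^bsub>\<Lambda>\<^esub> y"
        using xc unfolding e by (simp add: L.r_distr)
      have "\<phi> (x \<otimes>\<^bsub>\<Lambda>\<^esub> x) \<in> S" "\<phi> (x \<otimes>\<^bsub>\<Lambda>\<^esub> y) \<in> S'"
        using Q.submoduleD(4)[OF S(1) xc(1) x(2)] Q.submoduleD(4)[OF S(2) xc(1) y(2)] \<phi>_mult xc x y
        by simp_all
      moreover have "x \<otimes>\<^bsub>\<Lambda>\<^esub> y = x \<oplus>\<^bsub>\<Lambda>\<^esub> (\<ominus>\<^bsub>\<Lambda>\<^esub> \<one>\<^bsub>\<Lambda>\<^esub>) \<otimes>\<^bsub>\<Lambda>\<^esub> (x \<otimes>\<^bsub>\<Lambda>\<^esub> x)"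
        using xc by (subst (2) xe) (simp add: L.l_minus VS.M.a_assoc VS.M.r_neg2
            VS.M.a_comm[of "x \<otimes>\<^bsub>\<Lambda>\<^esub> y" "\<ominus>\<^bsub>\<Lambda>\<^esub> (x \<otimes>\<^bsub>\<Lambda>\<^esub> x)"])
      then have "\<phi> (x \<otimes>\<^bsub>\<Lambda>\<^esub> y) = \<phi> x \<oplus>\<^bsub>Q\<^esub> (\<ominus>\<^bsub>\<Lambda>\<^esub> \<one>\<^bsub>\<Lambda>\<^esub>) \<odot>\<^bsub>Q\<^esub> \<phi> (x \<otimes>\<^bsub>\<Lambda>\<^esub> x)"
        using module_homD(2)[OF \<phi>(1) x(1) I_mult[OF _ I_mult[OF xc(1) x(1)]], of "\<ominus>\<^bsub>\<Lambda>\<^esub> \<one>\<^bsub>\<Lambda>\<^esub>"]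
          \<phi>_mult[OF _ I_mult[OF xc(1) x(1)], of "\<ominus>\<^bsub>\<Lambda>\<^esub> \<one>\<^bsub>\<Lambda>\<^esub>"] by simp
      ultimately have "\<phi> (x \<otimes>\<^bsub>\<Lambda>\<^esub> y) \<in> S \<inter> S'"
        using Q.submoduleD(3,4)[OF S(1)] x(2) by simp
      then have "\<phi> (x \<otimes>\<^bsub>\<Lambda>\<^esub> y) = \<phi> \<zero>\<^bsub>\<Lambda>\<^esub>"
        using S(3) \<phi>0 by simp
      then have "x \<otimes>\<^bsub>\<Lambda>\<^esub> y = \<zero>\<^bsub>\<Lambda>\<^esub>"
        using \<phi>_eq[OF I_mult[OF xc(1) y(1)] z] by simp
      then show ?thesis
        using xe xc by simp
    qed
    have "g \<otimes>\<^bsub>\<Lambda>\<^esub> f = \<zero>\<^bsub>\<Lambda>\<^esub> \<and> g \<otimes>\<^bsub>\<Lambda>\<^esub> g = g"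
      using fg st N int efg fc by (intro cross[of g N' f N]) (auto simp: VS.M.a_comm)
    moreover have "f \<otimes>\<^bsub>\<Lambda>\<^esub> g = \<zero>\<^bsub>\<Lambda>\<^esub> \<and> f \<otimes>\<^bsub>\<Lambda>\<^esub> f = f"
      using fg st N int efg by (intro cross[of f N g N']) auto
    ultimately have "f = \<zero>\<^bsub>\<Lambda>\<^esub> \<or> g = \<zero>\<^bsub>\<Lambda>\<^esub>"
      using e efg fc unfolding primitive_idempotent_def idempotents_def orthogonal_elems_def by blast
    then have "e = g \<or> e = f"
      using efg fc by auto
    then have "N = carrier Q \<or> N' = carrier Q"
      using full[OF N(1)] full[OF N(2)] st fg by auto
    then show ?thesis
      using int Q.submoduleD(1)[OF N(1)] Q.submoduleD(1)[OF N(2)] by (auto simp: Int_absorb1 Int_absorb2)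
  qed
  ultimately show ?thesis
    unfolding indecomposable_module_def by blast
qed

lemma idempotent_not_annihilating:
  assumes M: "left_module \<Lambda> M" and x: "x \<in> carrier M" "x \<noteq> \<zero>\<^bsub>M\<^esub>"
    and E: "finite E" "E \<subseteq> carrier \<Lambda>" "(\<Oplus>\<^bsub>\<Lambda>\<^esub>e\<in>E. e) = \<one>\<^bsub>\<Lambda>\<^esub>"
  shows "\<exists>e\<in>E. e \<odot>\<^bsub>M\<^esub> x \<noteq> \<zero>\<^bsub>M\<^esub>"
proof (rule ccontr)
  interpret M: left_module \<Lambda> M by fact
  assume "\<not> ?thesis"
  then have zero: "e \<odot>\<^bsub>M\<^esub> x = \<zero>\<^bsub>M\<^esub>" if "e \<in> E" for e
    using that by blast
  have "(\<Oplus>\<^bsub>\<Lambda>\<^esub>e\<in>F. e) \<odot>\<^bsub>M\<^esub> x = \<zero>\<^bsub>M\<^esub>" if "finite F" "F \<subseteq> E" for F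
    using that
  proof (induction F)
    case empty
    then show ?case using x by (simp add: M.smult_l_null)
  next
    case (insert e F)
    then have "F \<subseteq> carrier \<Lambda>" "e \<in> carrier \<Lambda>" using E by auto
    then have "(\<Oplus>\<^bsub>\<Lambda>\<^esub>e\<in>insert e F. e) = e \<oplus>\<^bsub>\<Lambda>\<^esub> (\<Oplus>\<^bsub>\<Lambda>\<^esub>e\<in>F. e)" "(\<Oplus>\<^bsub>\<Lambda>\<^esub>e\<in>F. e) \<in> carrier \<Lambda>"
      using insert.hyps by (auto intro!: VS.M.finsum_insert VS.M.finsum_closed)
    then show ?case
      using insert zero x \<open>e \<in> carrier \<Lambda>\<close> by (simp add: M.smult_l_distr)
  qed
  from this[OF E(1)] show False
    using E(3) x M.smult_one by simp
qed

text \<open>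
  Since the primitive idempotents \<open>e\<close> in the definition of a basic algebra add up to \<open>1\<close>, some
  \<open>e x\<close> is nonzero.  Then \<open>y \<mapsto> y x\<close> is a nonzero homomorphism on \<open>\<Lambda>e\<close>, and \<open>\<Lambda>e\<close> is isomorphic to
  one of the \<open>P i\<close>.  The copy of \<open>\<Lambda>e\<close> in \<open>mods \<Lambda>\<close> has the one-element lists as elements.
\<close>

lemma exists_nonzero_hom_from_projective:
  assumes basic: "basic_algebra \<Lambda>" and P: "indecomposable_projectives \<Lambda> P"
    and M: "left_module \<Lambda> M" and x: "x \<in> carrier M" "x \<noteq> \<zero>\<^bsub>M\<^esub>"
  shows "\<exists>i. \<exists>f\<in>module_hom \<Lambda> (P i) M. \<exists>p\<in>carrier (P i). f p \<noteq> \<zero>\<^bsub>M\<^esub>"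
proof -
  interpret M: left_module \<Lambda> M by fact
  obtain E where E: "finite E" "\<forall>e\<in>E. primitive_idempotent \<Lambda> e" "(\<Oplus>\<^bsub>\<Lambda>\<^esub>e\<in>E. e) = \<one>\<^bsub>\<Lambda>\<^esub>"
    using basic unfolding basic_algebra_def by (elim exE conjE) (rule that; assumption)
  have "E \<subseteq> carrier \<Lambda>"
    using E(2) by (auto simp: primitive_idempotent_def idempotents_def)
  then obtain e where e: "e \<in> E" "e \<odot>\<^bsub>M\<^esub> x \<noteq> \<zero>\<^bsub>M\<^esub>"
    using idempotent_not_annihilating[OF M x E(1) _ E(3)] by blast
  have prim: "primitive_idempotent \<Lambda> e" using E(2) e(1) by blast
  then have id: "e \<in> idempotents \<Lambda>" by (simp add: primitive_idempotent_def)
  note mem = mem_left_ideal[OF id]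
  let ?I = "left_ideal_module \<Lambda> e"
  have lI: "left_module \<Lambda> ?I" by (rule left_module_left_ideal[OF id])
  have eI: "e \<in> carrier ?I" using id by (simp add: mem) (simp add: idempotents_def)
  define \<phi> where "\<phi> y = [y]" for y :: 'a
  have inj: "inj_on \<phi> (carrier ?I)" by (simp add: \<phi>_def inj_on_def)
  let ?Q = "transport_module \<phi> ?I"
  note Q = transport_module[OF lI inj]
  have "?Q \<in> mods \<Lambda>"
    using left_ideal_iso_fin_gen[OF id Q] by (simp add: mods_def)
  then obtain i where "module_iso \<Lambda> ?Q (P i)"
    using P left_ideal_iso_projective[OF id Q] left_ideal_iso_indecomposable[OF prim Q]
    unfolding indecomposable_projectives_def by blast
  then obtain \<tau> where \<tau>: "\<tau> \<in> module_hom \<Lambda> ?Q (P i)" "bij_betw \<tau> (carrier ?Q) (carrier (P i))"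
    unfolding module_iso_def by blast
  let ?\<phi>' = "inv_into (carrier ?I) \<phi>" and ?\<tau>' = "inv_into (carrier ?Q) \<tau>"
  have "(\<lambda>y. y \<odot>\<^bsub>M\<^esub> x) \<in> module_hom \<Lambda> ?I M"
    using x by (intro module_homI) (auto simp: mem M.smult_closed M.smult_l_distr M.smult_assoc)
  then have f: "((\<lambda>y. y \<odot>\<^bsub>M\<^esub> x) \<circ> ?\<phi>') \<circ> ?\<tau>' \<in> module_hom \<Lambda> (P i) M"
    by (intro module_hom_comp[OF inv_into_module_hom[OF Q(1) \<tau>]]
          module_hom_comp[OF inv_into_module_hom[OF lI Q(2,3)]])
  have \<phi>e: "\<phi> e \<in> carrier ?Q"
    by (rule module_homD(1)[OF Q(2) eI])
  have "?\<tau>' (\<tau> (\<phi> e)) = \<phi> e"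
    using \<tau>(2) \<phi>e by (simp add: bij_betw_def inv_into_f_f)
  moreover have "?\<phi>' (\<phi> e) = e"
    using inj eI by (simp add: inv_into_f_f)
  ultimately have "(((\<lambda>y. y \<odot>\<^bsub>M\<^esub> x) \<circ> ?\<phi>') \<circ> ?\<tau>') (\<tau> (\<phi> e)) \<noteq> \<zero>\<^bsub>M\<^esub>"
    using e(2) by simp
  then show ?thesis
    using f module_homD(1)[OF \<tau>(1) \<phi>e] by blast
qed

end

section \<open>Dimension vectors and semistability\<close>

locale basic_fd_algebra = fd_algebra K \<Lambda>
  for K :: "'k ring" and \<Lambda> :: "('k, 'a) module" +
  fixes P :: "'n::finite \<Rightarrow> ('a, 'a list) module"
  assumes basic: "basic_algebra \<Lambda>" and projectives: "indecomposable_projectives \<Lambda> P"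
begin

abbreviation dv :: "('a, 'a list) module \<Rightarrow> real ^ 'n" where
  "dv \<equiv> dimension_vector K \<Lambda> P"

lemma P_fin_gen: "fin_gen_module \<Lambda> (P i)" and P_projective: "projective_module \<Lambda> (P i)"
  using projectives by (auto simp: indecomposable_projectives_def mods_def)

lemma mods_left_module: "M \<in> mods \<Lambda> \<Longrightarrow> left_module \<Lambda> M"
  by (simp add: mods_def fin_gen_module_def)

lemma mods_submodule:
  "M \<in> mods \<Lambda> \<Longrightarrow> Module.submodule N \<Lambda> M \<Longrightarrow> M\<lparr>carrier := N\<rparr> \<in> mods \<Lambda>"
  by (simp add: mods_def fin_gen_submodule)

lemma dv_exact:
  assumes "A \<in> mods \<Lambda>" "B \<in> mods \<Lambda>" "C \<in> mods \<Lambda>"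
    and "i \<in> module_hom \<Lambda> A B" "inj_on i (carrier A)"
    and "p \<in> module_hom \<Lambda> B C" "p ` carrier B = carrier C"
    and "i ` carrier A = {b \<in> carrier B. p b = \<zero>\<^bsub>C\<^esub>}"
  shows "dv B = dv A + dv C"
  using dim_hom_space_exact[OF P_fin_gen P_projective assms]
  by (simp add: dimension_vector_def vec_eq_iff)

text \<open>
  The zero module is an extension of itself by itself.
\<close>

lemma dv_zero:
  assumes M: "M \<in> mods \<Lambda>"
  shows "dv (M\<lparr>carrier := {\<zero>\<^bsub>M\<^esub>}\<rparr>) = 0"
proof -
  interpret M: left_module \<Lambda> M by (rule mods_left_module[OF M])
  let ?Z = "M\<lparr>carrier := {\<zero>\<^bsub>M\<^esub>}\<rparr>"
  have Z: "?Z \<in> mods \<Lambda>" by (rule mods_submodule[OF M M.submodule_zero])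
  have "id \<in> module_hom \<Lambda> ?Z ?Z" by (rule module_homI) (auto simp: M.smult_r_null)
  then have "dv ?Z = dv ?Z + dv ?Z"
    by (intro dv_exact[OF Z Z Z]) auto
  then show ?thesis by simp
qed

lemma dv_Nats: "dv M $ i \<in> \<nat>"
  by (simp add: dimension_vector_def)

lemma dv_submodule_le:
  assumes "M \<in> mods \<Lambda>" and "Module.submodule N \<Lambda> M"
  shows "dv (M\<lparr>carrier := N\<rparr>) $ i \<le> dv M $ i"
  using assms dim_hom_space_submodule[OF P_fin_gen] by (simp add: dimension_vector_def mods_def)

lemma dv_nonzero:
  assumes M: "M \<in> mods \<Lambda>" and nz: "nonzero_module M"
  shows "dv M \<noteq> 0"
proof -
  interpret M: left_module \<Lambda> M by (rule mods_left_module[OF M])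
  obtain x where "x \<in> carrier M" "x \<noteq> \<zero>\<^bsub>M\<^esub>"
    using nz M.M.zero_closed unfolding nonzero_module_def by blast
  then obtain i f p where f: "f \<in> module_hom \<Lambda> (P i) M" "p \<in> carrier (P i)" "f p \<noteq> \<zero>\<^bsub>M\<^esub>"
    using exists_nonzero_hom_from_projective[OF basic projectives M.left_module_axioms] by blast
  have "vectorspace.dim K (hom_space \<Lambda> (P i) M) > 0"
    using M by (intro dim_hom_space_pos[OF P_fin_gen _ f]) (simp add: mods_def)
  then have "dv M $ i \<noteq> 0"
    by (simp add: dimension_vector_def)
  then show ?thesis by auto
qed

abbreviation semistable :: "('a, 'a list) module \<Rightarrow> (real ^ 'n) set" where
  "semistable \<equiv> semistability_cone K \<Lambda> P"

lemma semistable_submodule: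
  assumes M: "M \<in> mods \<Lambda>" and N: "Module.submodule N \<Lambda> M" and u: "u \<in> semistable M"
    and 0: "u \<bullet> dv (M\<lparr>carrier := N\<rparr>) = 0"
  shows "u \<in> semistable (M\<lparr>carrier := N\<rparr>)"
proof -
  interpret M: left_module \<Lambda> M by (rule mods_left_module[OF M])
  show ?thesis
    using u 0 unfolding semistability_cone_def by (auto simp: M.submodule_of_submodule[OF N])
qed

text \<open>
  Through \<open>i\<close>, a submodule of \<open>A\<close> becomes one of \<open>B\<close> with the same dimension vector.
\<close>

lemma exact_sequence_submodule_bound:
  assumes mods: "A \<in> mods \<Lambda>" "B \<in> mods \<Lambda>" "C \<in> mods \<Lambda>"
    and i: "i \<in> module_hom \<Lambda> A B" "inj_on i (carrier A)" and p: "p \<in> module_hom \<Lambda> B C"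
    and exact: "i ` carrier A = {b \<in> carrier B. p b = \<zero>\<^bsub>C\<^esub>}"
    and u: "u \<in> semistable B" and N: "Module.submodule N \<Lambda> A"
  shows "u \<bullet> dv (A\<lparr>carrier := N\<rparr>) \<le> 0"
proof -
  note lm = mods_left_module[OF mods(1)] mods_left_module[OF mods(2)] mods_left_module[OF mods(3)]
  interpret A: left_module \<Lambda> A by (rule lm)
  interpret C: left_module \<Lambda> C by (rule lm)
  have NA: "N \<subseteq> carrier A" "\<zero>\<^bsub>A\<^esub> \<in> N" using A.submoduleD[OF N] by auto
  have iN: "Module.submodule (i ` N) \<Lambda> B"
    by (rule module_hom_image_submodule[OF lm(1,2) i(1) N])
  have pi: "p (i x) = \<zero>\<^bsub>C\<^esub>" "i x \<in> carrier B" if "x \<in> N" for x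
    using exact that NA(1) by auto
  have image0: "\<zero>\<^bsub>C\<^esub> \<in> p ` i ` N"
    using pi(1)[OF NA(2)] NA(2) by (metis imageI)
  have "dv (B\<lparr>carrier := i ` N\<rparr>) = dv (A\<lparr>carrier := N\<rparr>) + dv (C\<lparr>carrier := {\<zero>\<^bsub>C\<^esub>}\<rparr>)"
  proof (rule dv_exact)
    show "i \<in> module_hom \<Lambda> (A\<lparr>carrier := N\<rparr>) (B\<lparr>carrier := i ` N\<rparr>)"
      using module_homD[OF i(1)] NA by (intro module_homI) (simp_all add: subset_iff)
    show "p \<in> module_hom \<Lambda> (B\<lparr>carrier := i ` N\<rparr>) (C\<lparr>carrier := {\<zero>\<^bsub>C\<^esub>}\<rparr>)"
      using module_homD[OF p] pi by (intro module_homI) auto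
  qed (use mods mods_submodule N iN C.submodule_zero inj_on_subset[OF i(2) NA(1)] pi NA image0 in auto)
  then show ?thesis
    using u iN dv_zero[OF mods(3)] by (auto simp: semistability_cone_def)
qed

text \<open>
  A submodule \<open>N\<close> of \<open>B\<close> is an extension of its image in \<open>C\<close> by its preimage in \<open>A\<close>.
\<close>

lemma exact_sequence_semistable:
  assumes mods: "A \<in> mods \<Lambda>" "B \<in> mods \<Lambda>" "C \<in> mods \<Lambda>"
    and i: "i \<in> module_hom \<Lambda> A B" "inj_on i (carrier A)"
    and p: "p \<in> module_hom \<Lambda> B C" "p ` carrier B = carrier C"
    and exact: "i ` carrier A = {b \<in> carrier B. p b = \<zero>\<^bsub>C\<^esub>}"
    and u: "u \<in> semistable A" "u \<in> semistable C"
  shows "u \<in> semistable B"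
proof -
  note lm = mods_left_module[OF mods(1)] mods_left_module[OF mods(2)] mods_left_module[OF mods(3)]
  interpret B: left_module \<Lambda> B by (rule lm)
  have "u \<bullet> dv (B\<lparr>carrier := N\<rparr>) \<le> 0" if N: "Module.submodule N \<Lambda> B" for N
  proof -
    note ND = B.submoduleD[OF N]
    let ?N1 = "{x \<in> carrier A. i x \<in> N}"
    have N1: "Module.submodule ?N1 \<Lambda> A"
      by (rule module_hom_preimage_submodule[OF lm(1,2) i(1) N])
    have N2: "Module.submodule (p ` N) \<Lambda> C"
      by (rule module_hom_image_submodule[OF lm(2,3) p(1) N])
    have "dv (B\<lparr>carrier := N\<rparr>) = dv (A\<lparr>carrier := ?N1\<rparr>) + dv (C\<lparr>carrier := p ` N\<rparr>)"
    proof (rule dv_exact)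
      show "i \<in> module_hom \<Lambda> (A\<lparr>carrier := ?N1\<rparr>) (B\<lparr>carrier := N\<rparr>)"
        using module_homD[OF i(1)] by (intro module_homI) auto
      show "p \<in> module_hom \<Lambda> (B\<lparr>carrier := N\<rparr>) (C\<lparr>carrier := p ` N\<rparr>)"
        using module_homD[OF p(1)] ND(1) by (intro module_homI) (auto simp: subset_iff)
      show "i ` carrier (A\<lparr>carrier := ?N1\<rparr>) =
          {b \<in> carrier (B\<lparr>carrier := N\<rparr>). p b = \<zero>\<^bsub>C\<lparr>carrier := p ` N\<rparr>\<^esub>}"
      proof (intro equalityI subsetI)
        fix b assume "b \<in> i ` carrier (A\<lparr>carrier := ?N1\<rparr>)"
        then have "b \<in> N" "b \<in> i ` carrier A" by auto
        then show "b \<in> {b \<in> carrier (B\<lparr>carrier := N\<rparr>). p b = \<zero>\<^bsub>C\<lparr>carrier := p ` N\<rparr>\<^esub>}"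
          unfolding exact by simp
      next
        fix b assume "b \<in> {b \<in> carrier (B\<lparr>carrier := N\<rparr>). p b = \<zero>\<^bsub>C\<lparr>carrier := p ` N\<rparr>\<^esub>}"
        then have b: "b \<in> N" "b \<in> i ` carrier A"
          unfolding exact using ND(1) by auto
        then show "b \<in> i ` carrier (A\<lparr>carrier := ?N1\<rparr>)" by auto
      qed
    qed (use mods mods_submodule N N1 N2 inj_on_subset[OF i(2)] in auto)
    then show ?thesis
      using u N1 N2 by (auto simp: semistability_cone_def inner_add_right add_nonpos_nonpos)
  qed
  moreover have "u \<bullet> dv B = 0"
    using u dv_exact[OF assms(1-8)] by (simp add: semistability_cone_def inner_add_right)
  ultimately show ?thesis by (simp add: semistability_cone_def)
qed

text \<open>
  The direct sum is an extension in two ways, which yields the bounds for submodules of either summand;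
  both dimension vectors then pair with \<open>u\<close> to something nonpositive with sum zero.
\<close>

lemma mods_semistable_Int:
  assumes M: "M \<in> mods \<Lambda>" "nonzero_module M" and N: "N \<in> mods \<Lambda>"
  obtains Z where "Z \<in> mods \<Lambda>" "nonzero_module Z" "semistable Z = semistable M \<inter> semistable N"
proof -
  obtain Z i p j q where Z: "Z \<in> mods \<Lambda>"
    and i: "i \<in> module_hom \<Lambda> M Z" "inj_on i (carrier M)"
    and p: "p \<in> module_hom \<Lambda> Z N" "p ` carrier Z = carrier N"
    and ip: "i ` carrier M = {z \<in> carrier Z. p z = \<zero>\<^bsub>N\<^esub>}"
    and j: "j \<in> module_hom \<Lambda> N Z" "inj_on j (carrier N)"
    and q: "q \<in> module_hom \<Lambda> Z M" "q ` carrier Z = carrier M"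
    and jq: "j ` carrier N = {z \<in> carrier Z. q z = \<zero>\<^bsub>M\<^esub>}"
    using mods_direct_sum[OF M(1) N] .
  interpret M: left_module \<Lambda> M by (rule mods_left_module[OF M(1)])
  interpret N: left_module \<Lambda> N by (rule mods_left_module[OF N])
  have "semistable Z \<subseteq> semistable M \<inter> semistable N"
  proof
    fix u assume u: "u \<in> semistable Z"
    have bM: "u \<bullet> dv (M\<lparr>carrier := S\<rparr>) \<le> 0" if "Module.submodule S \<Lambda> M" for S
      by (rule exact_sequence_submodule_bound[OF M(1) Z N i p(1) ip u that])
    have bN: "u \<bullet> dv (N\<lparr>carrier := S\<rparr>) \<le> 0" if "Module.submodule S \<Lambda> N" for S
      by (rule exact_sequence_submodule_bound[OF N Z M(1) j q(1) jq u that])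
    have "u \<bullet> dv M + u \<bullet> dv N = 0"
      using u dv_exact[OF M(1) Z N i p ip] by (simp add: semistability_cone_def inner_add_right)
    moreover have "u \<bullet> dv M \<le> 0" "u \<bullet> dv N \<le> 0"
      using bM[OF M.submodule_carrier] bN[OF N.submodule_carrier] by simp_all
    ultimately show "u \<in> semistable M \<inter> semistable N"
      using bM bN by (simp add: semistability_cone_def)
  qed
  moreover have "semistable M \<inter> semistable N \<subseteq> semistable Z"
    using exact_sequence_semistable[OF M(1) Z N i p ip] by blast
  moreover have "nonzero_module Z"
  proof -
    have "carrier M = {\<zero>\<^bsub>M\<^esub>}" if "carrier Z = {\<zero>\<^bsub>Z\<^esub>}"
      using q module_hom_zero[OF mods_left_module[OF Z] M.left_module_axioms q(1)] that by auto
    then show ?thesis using M(2) by (auto simp: nonzero_module_def)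
  qed
  ultimately show ?thesis using that Z by blast
qed

definition semistable_modules :: "real ^ 'n \<Rightarrow> ('a, 'a list) module set" where
  "semistable_modules v = {M \<in> mods \<Lambda>. nonzero_module M \<and> v \<in> semistable M}"

definition semistable_submodules ::
  "real ^ 'n \<Rightarrow> ('a, 'a list) module \<Rightarrow> ('a, 'a list) module set" where
  "semistable_submodules v M =
     {M\<lparr>carrier := N\<rparr> | N. Module.submodule N \<Lambda> M \<and> N \<noteq> {\<zero>\<^bsub>M\<^esub>} \<and> v \<bullet> dv (M\<lparr>carrier := N\<rparr>) = 0}"

lemma semistable_system:
  "semistable_system v (semistable_modules v) dv (semistable_submodules v)"
proof
  fix M assume M: "M \<in> semistable_modules v"
  then have m: "M \<in> mods \<Lambda>" and nz: "nonzero_module M" and v: "v \<in> semistable M"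
    by (auto simp: semistable_modules_def)
  interpret M: left_module \<Lambda> M by (rule mods_left_module[OF m])
  show "M \<in> semistable_submodules v M"
    using nz v M.submodule_carrier
    by (auto simp: semistable_submodules_def nonzero_module_def semistability_cone_def
        intro!: exI[of _ "carrier M"])
  show "v \<bullet> dv M = 0"
    using v by (simp add: semistability_cone_def)
  show "dv M $ i \<in> \<nat>" for i by (rule dv_Nats)
  show "dv M \<noteq> 0" by (rule dv_nonzero[OF m nz])
  fix Y assume "Y \<in> semistable_submodules v M"
  then obtain N where N: "Y = M\<lparr>carrier := N\<rparr>" "Module.submodule N \<Lambda> M" "N \<noteq> {\<zero>\<^bsub>M\<^esub>}"
    "v \<bullet> dv (M\<lparr>carrier := N\<rparr>) = 0"
    by (auto simp: semistable_submodules_def)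
  show "dv Y $ i \<le> dv M $ i" for i
    unfolding N(1) by (rule dv_submodule_le[OF m N(2)])
  show "Y \<in> semistable_modules v"
    using mods_submodule[OF m N(2)] semistable_submodule[OF m N(2) v N(4)] N
    by (simp add: semistable_modules_def nonzero_module_def)
  fix Z assume "Z \<in> semistable_submodules v Y"
  then show "Z \<in> semistable_submodules v M"
    unfolding N(1) semistable_submodules_def
    by (auto simp: M.submodule_of_submodule[OF N(2)])
qed

text \<open>
  The two conditions come with different step lengths \<open>r\<close> and \<open>s\<close>.  As semistability cones are convex
  and contain \<open>v\<close>, the smaller one serves for both.
\<close>

lemma local_cone_Int:
  assumes v: "v \<in> semistable M" "v \<in> semistable N" and Z: "semistable Z = semistable M \<inter> semistable N"
  shows "local_cone K \<Lambda> P v Z = local_cone K \<Lambda> P v M \<inter> local_cone K \<Lambda> P v N"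
proof -
  have scale: "v + r *\<^sub>R w \<in> semistable L"
    if "v \<in> semistable L" "v + s *\<^sub>R w \<in> semistable L" "0 < r" "r \<le> s"
    for r s w and L :: "('a, 'a list) module"
  proof -
    have eq: "v + r *\<^sub>R w = (1 - r / s) *\<^sub>R v + (r / s) *\<^sub>R (v + s *\<^sub>R w)"
      using that by (simp add: algebra_simps)
    have c: "0 \<le> 1 - r / s" "0 \<le> r / s" using that by auto
    have "(v + r *\<^sub>R w) \<bullet> x = (1 - r / s) * (v \<bullet> x) + (r / s) * ((v + s *\<^sub>R w) \<bullet> x)" for x
      unfolding eq by (simp only: inner_add_left[of "(1 - r / s) *\<^sub>R v"] inner_scaleR_left)
    then show ?thesis
      using that(1,2) c unfolding semistability_cone_def mem_Collect_eq
      by (auto simp only: mult_zero_right add_0 intro!: add_nonpos_nonpos mult_nonneg_nonpos)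
  qed
  show ?thesis
  proof (intro equalityI subsetI)
    fix w assume "w \<in> local_cone K \<Lambda> P v Z"
    then show "w \<in> local_cone K \<Lambda> P v M \<inter> local_cone K \<Lambda> P v N"
      unfolding local_cone_def Z by blast
  next
    fix w assume "w \<in> local_cone K \<Lambda> P v M \<inter> local_cone K \<Lambda> P v N"
    then obtain r s where w: "w \<in> orth_hyperplane v"
      and rs: "r > 0" "v + r *\<^sub>R w \<in> semistable M" "s > 0" "v + s *\<^sub>R w \<in> semistable N"
      unfolding local_cone_def by blast
    have "v + min r s *\<^sub>R w \<in> semistable M" "v + min r s *\<^sub>R w \<in> semistable N"
      using rs by (auto intro!: scale[OF v(1) rs(2)] scale[OF v(2) rs(4)])
    then show "w \<in> local_cone K \<Lambda> P v Z"
      using w rs unfolding local_cone_def Z by (auto intro!: exI[of _ "min r s"])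
  qed
qed

text \<open>
  Finitely many inequalities are involved.  Those strict at \<open>v\<close> survive a small step in any direction,
  and those that are equalities at \<open>v\<close> survive it exactly when \<open>w\<close> satisfies them.
\<close>

lemma local_cone_inequalities:
  assumes M: "M \<in> semistable_modules v"
  shows "local_cone K \<Lambda> P v M =
    {w \<in> orth_hyperplane v. w \<bullet> dv M = 0 \<and> (\<forall>Y\<in>semistable_submodules v M. w \<bullet> dv Y \<le> 0)}"
    (is "_ = ?R")
proof (intro equalityI subsetI)
  have m: "M \<in> mods \<Lambda>" and v: "v \<in> semistable M"
    using M by (auto simp: semistable_modules_def)
  {
    fix w assume "w \<in> local_cone K \<Lambda> P v M"
    then obtain r where w: "w \<in> orth_hyperplane v" and r: "r > 0" "v + r *\<^sub>R w \<in> semistable M"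
      unfolding local_cone_def by blast
    have "w \<bullet> dv M = 0"
      using r v by (simp add: semistability_cone_def inner_add_left)
    moreover have "w \<bullet> dv Y \<le> 0" if Y: "Y \<in> semistable_submodules v M" for Y
    proof -
      obtain N where N: "Y = M\<lparr>carrier := N\<rparr>" "Module.submodule N \<Lambda> M" "v \<bullet> dv Y = 0"
        using Y by (auto simp: semistable_submodules_def)
      then have "(v + r *\<^sub>R w) \<bullet> dv Y \<le> 0"
        using r(2) by (auto simp: semistability_cone_def)
      then show ?thesis
        using N(3) r(1) by (simp add: inner_add_left mult_le_0_iff)
    qed
    ultimately show "w \<in> ?R" using w by simp
  }
  {
    fix w assume w: "w \<in> ?R"
    define E where "E = {dv (M\<lparr>carrier := N\<rparr>) | N. Module.submodule N \<Lambda> M}"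
    have "finite E"
      by (rule finite_subset[OF _ finite_nat_vectors_below[of "dv M"]])
         (auto simp: E_def dv_Nats dv_submodule_le[OF m])
    moreover have "v \<bullet> e < 0 \<or> v \<bullet> e = 0 \<and> w \<bullet> e \<le> 0" if e: "e \<in> E" for e
    proof -
      obtain N where N: "e = dv (M\<lparr>carrier := N\<rparr>)" "Module.submodule N \<Lambda> M"
        using e by (auto simp: E_def)
      have "v \<bullet> e \<le> 0"
        using v N by (auto simp: semistability_cone_def)
      moreover have "w \<bullet> e \<le> 0" if 0: "v \<bullet> e = 0"
      proof (cases "N = {\<zero>\<^bsub>M\<^esub>}")
        case True
        then show ?thesis using N(1) dv_zero[OF m] by simp
      next
        case False
        then show ?thesis
          using w N 0 unfolding semistable_submodules_def by auto
      qed
      ultimately show ?thesis by linarith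
    qed
    ultimately obtain r where r: "r > 0" "\<forall>e\<in>E. v \<bullet> e + r * (w \<bullet> e) \<le> 0"
      using positive_step_exists[of E "\<lambda>e. v \<bullet> e" "\<lambda>e. w \<bullet> e"] by blast
    then have "v + r *\<^sub>R w \<in> semistable M"
      using v w by (auto simp: semistability_cone_def inner_add_left E_def)
    then show "w \<in> local_cone K \<Lambda> P v M"
      using w r(1) unfolding local_cone_def by auto
  }
qed

end

theorem proposition3p1p5:
  fixes K :: "'k ring"
    and \<Lambda> :: "('k, 'a) module"
    and P :: "'n::finite \<Rightarrow> ('a, 'a list) module"
    and v :: "real ^ 'n"
  assumes "algebraically_closed K"
    and "fin_dim_algebra K \<Lambda>"
    and "basic_algebra \<Lambda>"
    and "connected_algebra \<Lambda>"
    and "card (simple_classes \<Lambda>) = CARD('n)"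
    and "indecomposable_projectives \<Lambda> P"
    and "v \<noteq> 0"
  shows "wall_and_chamber_structure (orth_hyperplane v) (local_cones K \<Lambda> P v)"
proof -
  interpret basic_fd_algebra K \<Lambda> P
    using assms(1,2,3,6)
    by (simp add: basic_fd_algebra_def basic_fd_algebra_axioms_def fd_algebra_def algebraically_closed_def)
  interpret S: semistable_system v "semistable_modules v" dv "semistable_submodules v"
    by (rule semistable_system)
  have cone: "S.cone M = local_cone K \<Lambda> P v M" if "M \<in> semistable_modules v" for M
    by (simp add: S.cone_def local_cone_inequalities[OF that])
  have "wall_and_chamber_structure (orth_hyperplane v) (S.cone ` semistable_modules v)"
  proof (rule S.wall_and_chamber_structure_cones)
    fix M N assume MN: "M \<in> semistable_modules v" "N \<in> semistable_modules v"
    then have M: "M \<in> mods \<Lambda>" "nonzero_module M" "v \<in> semistable M"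
      and N: "N \<in> mods \<Lambda>" "v \<in> semistable N"
      by (auto simp: semistable_modules_def)
    obtain Z where Z: "Z \<in> mods \<Lambda>" "nonzero_module Z" "semistable Z = semistable M \<inter> semistable N"
      by (rule mods_semistable_Int[OF M(1,2) N(1)])
    then have "Z \<in> semistable_modules v"
      using M N by (auto simp: semistable_modules_def)
    moreover from this have "S.cone Z = S.cone M \<inter> S.cone N"
      using local_cone_Int[OF M(3) N(2) Z(3)] MN by (simp add: cone)
    ultimately show "\<exists>Z\<in>semistable_modules v. S.cone Z = S.cone M \<inter> S.cone N"
      by blast
  qed
  moreover have "local_cones K \<Lambda> P v = S.cone ` semistable_modules v"
    using cone by (auto simp: local_cones_def semistable_modules_def)
  ultimately show ?thesis
    by simp
qed

end
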